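(* Let $X$, $\sigma$, $k$ be as described in the context and let $1\le p\le\infty$. Then for any point $x_0\in X$ and any continuous function $h$ on $S^{n-1}$, there is a function $g\in L^p(S^{n-1},L^\infty(\partial X))$ such that the boundary value problem $$\theta\cdot\nabla v+\sigma v=\int_{S^{n-1}}k(x,\theta,\theta')v(x,\theta')\,d\theta'\ \text{ on } X\times S^{n-1},\qquad v|_{\Gamma_-}=g|_{\Gamma_-},$$ has a unique solution $v\in L^p(S^{n-1},L^\infty(X))$, which is continuous in a neighbourhood of $x_0$ and satisfies $v(x_0,\theta)=h(\theta)$ for all $\theta\in S^{n-1}$. Moreover, $$\|v\|_{L^p(S^{n-1},L^\infty(X))}+\|g\|_{L^p(S^{n-1},L^\infty(\partial X))}\le C\|h\|_{L^p(S^{n-1})},$$ where $C$ depends only on $X$, $\sigma$ and $k$.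
   Context: Setting. Let $n\ge 2$ and let $X\subset\mathbb{R}^n$ be a bounded domain with smooth boundary $\partial X$, outward unit normal $n(x)$, and diameter $\tau$. Put $\Gamma_\pm=\{(x,\theta)\in\partial X\times S^{n-1}:\pm\theta\cdot n(x)>0\}$; $\nabla=\nabla_x$. Coefficients. The attenuation coefficient $\sigma=\sigma(x)\ge 0$ and the scattering kernel $k=k(x,\theta,\theta')\ge 0$ ($x\in X$, $\theta,\theta'\in S^{n-1}$) are continuous. The kernel satisfies the reciprocity relation $k(x,\theta,\theta')=k(x,-\theta',-\theta)$, the normalization $\int_{S^{n-1}}k(x,\theta,\theta')\,d\theta'=1$ for all $\theta\in S^{n-1}$, and is invariant under rotations, $k(x,\theta,\theta')=k(x,\theta\cdot\theta')$. With $\rho=\big\|\int_{S^{n-1}}k(x,\theta,\theta')\,d\theta'\big\|_{L^\infty(X\times S^{n-1})}$, it is assumed that at least one of the following holds: (i) $\sigma-\rho\ge\alpha$ on $X$ for some constant $\alpha>0$; or (ii) $\tau\rho<1$. Norms. $\|w\|_{L^p(S^{n-1},L^\infty(Y))}$ is the $L^p$ norm in $\theta\in S^{n-1}$ of $\theta\mapsto\|w(\cdot,\theta)\|_{L^\infty(Y)}$, for $Y=X$ or $Y=\partial X$. "Continuous in a neighbourhood of $x_0$" means continuous as a function of $(x,\theta)$ for $x$ near $x_0$ and $\theta\in S^{n-1}$.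
   Formalization: σ and k are assumed continuous up to the boundary of X, not only in the open domain; otherwise σ could blow up at the boundary with infinite attenuation along every entering line, and no nonzero h could be attained. *)

theory Defs
  imports "HOL-Analysis.Analysis"
begin

section \<open>Domains with smooth boundary\<close>

primrec Ck_on :: "nat \<Rightarrow> 'a::euclidean_space set \<Rightarrow> ('a \<Rightarrow> real) \<Rightarrow> bool" where
  "Ck_on 0 U f \<longleftrightarrow> continuous_on U f"
| "Ck_on (Suc m) U f \<longleftrightarrow>
     f differentiable_on U \<and> (\<forall>v. Ck_on m U (\<lambda>x. frechet_derivative f (at x) v))"

definition smooth_fun_on :: "'a::euclidean_space set \<Rightarrow> ('a \<Rightarrow> real) \<Rightarrow> bool" where
  "smooth_fun_on U f \<longleftrightarrow> (\<forall>m. Ck_on m U f)"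

definition gradient :: "('a::euclidean_space \<Rightarrow> real) \<Rightarrow> 'a \<Rightarrow> 'a" where
  "gradient f x = (\<Sum>b\<in>Basis. frechet_derivative f (at x) b *\<^sub>R b)"

definition local_defining_function ::
    "'a::euclidean_space set \<Rightarrow> 'a \<Rightarrow> 'a set \<Rightarrow> ('a \<Rightarrow> real) \<Rightarrow> bool" where
  "local_defining_function X y U r \<longleftrightarrow>
     open U \<and> y \<in> U \<and> smooth_fun_on U r \<and> (\<forall>x\<in>U. gradient r x \<noteq> 0) \<and>
     X \<inter> U = {x\<in>U. r x < 0}"

definition smooth_bounded_domain :: "'a::euclidean_space set \<Rightarrow> bool" where
  "smooth_bounded_domain X \<longleftrightarrow>
     open X \<and> connected X \<and> X \<noteq> {} \<and> bounded X \<and>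
     (\<forall>y\<in>frontier X. \<exists>U r. local_defining_function X y U r)"

text \<open>Independent of the defining function \<open>r\<close>, which is negative inside \<open>X\<close>.\<close>

definition outward_normal :: "'a::euclidean_space set \<Rightarrow> 'a \<Rightarrow> 'a" where
  "outward_normal X y =
     (THE \<nu>. \<exists>U r. local_defining_function X y U r \<and> \<nu> = sgn (gradient r y))"

definition Gamma_minus :: "'a::euclidean_space set \<Rightarrow> ('a \<times> 'a) set" where
  "Gamma_minus X = {(y, \<theta>). y \<in> frontier X \<and> \<theta> \<in> sphere 0 1 \<and> \<theta> \<bullet> outward_normal X y < 0}"

section \<open>Measures on the domain, the sphere and the boundary\<close>

abbreviation domain_measure :: "'a::euclidean_space set \<Rightarrow> 'a measure" where
  "domain_measure X \<equiv> restrict_space lborel X"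

text \<open>
  Surface measure on the unit sphere of an \<open>n\<close>-dimensional space, by polar coordinates: the
  measure of \<open>A\<close> is \<open>n\<close> times the volume of the cone \<open>{r\<theta> | 0 < r < 1, \<theta> \<in> A}\<close>.
\<close>

definition sphere_measure :: "'a::euclidean_space measure" where
  "sphere_measure =
     distr (scale_measure (of_nat DIM('a)) (restrict_space lborel (ball 0 1 - {0})))
       (restrict_space borel (sphere 0 1)) sgn"

text \<open>
  The \<open>s\<close>-dimensional Hausdorff measure, normalised so that on smooth \<open>s\<close>-dimensional
  submanifolds of Euclidean space it is the surface measure. As \<open>diameter\<close> is meaningless
  for unbounded sets, only bounded sets are admitted in coverings.
\<close>

definition hausdorff_gauge :: "nat \<Rightarrow> 'a::metric_space set \<Rightarrow> ennreal" where
  "hausdorff_gauge s U =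
     (if U = {} then 0 else ennreal (unit_ball_vol (real s) * (diameter U / 2) ^ s))"

definition hausdorff_pre :: "nat \<Rightarrow> real \<Rightarrow> 'a::metric_space set \<Rightarrow> ennreal" where
  "hausdorff_pre s \<delta> A =
     (INF U\<in>{U::nat \<Rightarrow> 'a set. A \<subseteq> (\<Union>i. U i) \<and> (\<forall>i. bounded (U i) \<and> diameter (U i) \<le> \<delta>)}.
        \<Sum>i. hausdorff_gauge s (U i))"

definition hausdorff_outer :: "nat \<Rightarrow> 'a::metric_space set \<Rightarrow> ennreal" where
  "hausdorff_outer s A = (SUP \<delta>\<in>{0<..}. hausdorff_pre s \<delta> A)"

definition hausdorff_measure :: "nat \<Rightarrow> 'a::metric_space measure" where
  "hausdorff_measure s = measure_of UNIV (sets borel) (hausdorff_outer s)"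

text \<open>
  \<open>measure_of\<close> is the null measure unless its argument is countably additive, so we check
  that Hausdorff outer measure is, by Caratheodory's criterion.
\<close>

lemma hausdorff_pre_mono: "A \<subseteq> B \<Longrightarrow> hausdorff_pre s \<delta> A \<le> hausdorff_pre s \<delta> B"
  unfolding hausdorff_pre_def by (rule INF_superset_mono) auto

lemma hausdorff_pre_antimono: "\<delta> \<le> \<epsilon> \<Longrightarrow> hausdorff_pre s \<epsilon> A \<le> hausdorff_pre s \<delta> A"
  unfolding hausdorff_pre_def by (rule INF_superset_mono) (auto intro: order_trans)

lemma hausdorff_pre_empty: 
  assumes "0 < \<delta>" shows "hausdorff_pre s \<delta> ({}::'a::metric_space set) = 0"
proof -
  have "(\<lambda>_::nat. {}::'a set) \<in> {U. {} \<subseteq> (\<Union>i. U i) \<and> (\<forall>i. bounded (U i) \<and> diameter (U i) \<le> \<delta>)}"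
    using assms by simp
  then have "hausdorff_pre s \<delta> ({}::'a set) \<le> (\<Sum>i::nat. hausdorff_gauge s ({}::'a set))"
    unfolding hausdorff_pre_def by (rule INF_lower[THEN order_trans]) simp
  then show ?thesis by (simp add: hausdorff_gauge_def)
qed

lemma hausdorff_pre_countably_subadditive:
  "hausdorff_pre s \<delta> (\<Union>i::nat. A i) \<le> (\<Sum>i. hausdorff_pre s \<delta> (A i))"
proof (rule ennreal_le_epsilon)
  fix e :: real
  assume fin: "(\<Sum>i. hausdorff_pre s \<delta> (A i)) < top" and e: "0 < e"
  define Ad where "Ad B = {U::nat \<Rightarrow> 'a set. B \<subseteq> (\<Union>i. U i) \<and> (\<forall>i. bounded (U i) \<and> diameter (U i) \<le> \<delta>)}" for B
  have pre: "hausdorff_pre s \<delta> B = (INF U\<in>Ad B. \<Sum>i. hausdorff_gauge s (U i))" for B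
    by (simp add: hausdorff_pre_def Ad_def)
  have "\<exists>U\<in>Ad (A i). (\<Sum>j. hausdorff_gauge s (U j)) \<le> hausdorff_pre s \<delta> (A i) + ennreal (e * (1/2)^Suc i)" for i
  proof -
    have "hausdorff_pre s \<delta> (A i) < top"
      using fin by (metis ennreal_suminf_lessD)
    then have "hausdorff_pre s \<delta> (A i) < hausdorff_pre s \<delta> (A i) + ennreal (e * (1/2)^Suc i)"
      using e by (simp add: ennreal_zero_less_divide less_top)
    then show ?thesis
      unfolding pre INF_less_iff by (auto intro: less_imp_le)
  qed
  then obtain U where U: "\<And>i. U i \<in> Ad (A i)"
    and le: "\<And>i. (\<Sum>j. hausdorff_gauge s (U i j)) \<le> hausdorff_pre s \<delta> (A i) + ennreal (e * (1/2)^Suc i)"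
    by metis
  define V where "V = (\<lambda>(i, j). U i j) \<circ> prod_decode"
  have "(\<Union>i. A i) \<subseteq> (\<Union>n. V n)"
  proof
    fix x assume "x \<in> (\<Union>i. A i)"
    then obtain i j where "x \<in> U i j" using U unfolding Ad_def by blast
    then have "x \<in> V (prod_encode (i, j))" by (simp add: V_def)
    then show "x \<in> (\<Union>n. V n)" by blast
  qed
  then have "V \<in> Ad (\<Union>i. A i)"
    using U by (auto simp: Ad_def V_def split: prod.split)
  then have "hausdorff_pre s \<delta> (\<Union>i. A i) \<le> (\<Sum>n. hausdorff_gauge s (V n))"
    unfolding pre by (rule INF_lower)
  also have "\<dots> = (\<Sum>i. \<Sum>j. hausdorff_gauge s (U i j))"
    using suminf_ennreal_2dimen[of "\<lambda>i. \<Sum>j. hausdorff_gauge s (U i j)" "\<lambda>p. hausdorff_gauge s (case p of (i,j) \<Rightarrow> U i j)"]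
    by (simp add: V_def comp_def)
  also have "\<dots> \<le> (\<Sum>i. hausdorff_pre s \<delta> (A i) + ennreal (e * (1/2)^Suc i))"
    by (intro suminf_le le summableI)
  also have "\<dots> = (\<Sum>i. hausdorff_pre s \<delta> (A i)) + (\<Sum>i. ennreal (e * (1/2)^Suc i))"
    by (rule suminf_add[symmetric]) (auto intro: summableI)
  also have "(\<Sum>i. ennreal (e * (1/2)^Suc i)) = ennreal e"
  proof -
    have "(\<lambda>i. e * (1/2)^Suc i) sums (e * 1)"
      by (intro sums_mult power_half_series)
    then show ?thesis using e by (intro sums_unique[symmetric]) (auto intro!: sums_ennreal[THEN iffD2])
  qed
  finally show "hausdorff_pre s \<delta> (\<Union>i. A i) \<le> (\<Sum>i. hausdorff_pre s \<delta> (A i)) + ennreal e" .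
qed

lemma hausdorff_pre_le_outer: "0 < \<delta> \<Longrightarrow> hausdorff_pre s \<delta> A \<le> hausdorff_outer s A"
  unfolding hausdorff_outer_def by (rule SUP_upper) auto

lemma hausdorff_outer_mono: "A \<subseteq> B \<Longrightarrow> hausdorff_outer s A \<le> hausdorff_outer s B"
  unfolding hausdorff_outer_def by (rule SUP_mono) (auto intro: hausdorff_pre_mono)

lemma hausdorff_outer_empty: "hausdorff_outer s {} = 0"
  unfolding hausdorff_outer_def by (simp add: hausdorff_pre_empty)

lemma hausdorff_outer_countably_subadditive:
  "hausdorff_outer s (\<Union>i::nat. A i) \<le> (\<Sum>i. hausdorff_outer s (A i))"
  unfolding hausdorff_outer_def[of s "\<Union>i. A i"]
proof (rule SUP_least)
  fix \<delta> :: real assume "\<delta> \<in> {0<..}"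
  then show "hausdorff_pre s \<delta> (\<Union>i. A i) \<le> (\<Sum>i. hausdorff_outer s (A i))"
    by (intro order_trans[OF hausdorff_pre_countably_subadditive] suminf_le summableI
        hausdorff_pre_le_outer) auto
qed

lemma hausdorff_outer_Un: "hausdorff_outer s (A \<union> B) \<le> hausdorff_outer s A + hausdorff_outer s B"
proof -
  have "hausdorff_outer s (A \<union> B) \<le> (\<Sum>i. hausdorff_outer s (binaryset A B i))"
    using hausdorff_outer_countably_subadditive[of s "binaryset A B"] by (simp add: UN_binaryset_eq)
  also have "\<dots> = hausdorff_outer s A + hausdorff_outer s B"
    by (rule suminf_binaryset_eq) (rule hausdorff_outer_empty)
  finally show ?thesis .
qed

lemma hausdorff_pre_separated:
  assumes d: "\<And>x y. x \<in> A \<Longrightarrow> y \<in> B \<Longrightarrow> \<delta> < dist x y" and pos: "0 < \<delta>"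
  shows "hausdorff_pre s \<delta> A + hausdorff_pre s \<delta> B \<le> hausdorff_pre s \<delta> (A \<union> B)"
  unfolding hausdorff_pre_def[of s \<delta> "A \<union> B"]
proof (rule INF_greatest)
  fix U :: "nat \<Rightarrow> 'a set"
  assume "U \<in> {U. A \<union> B \<subseteq> (\<Union>i. U i) \<and> (\<forall>i. bounded (U i) \<and> diameter (U i) \<le> \<delta>)}"
  then have cov: "A \<union> B \<subseteq> (\<Union>i. U i)" and bd: "\<And>i. bounded (U i)" and dm: "\<And>i. diameter (U i) \<le> \<delta>"
    by auto
  define UA where "UA i = (if U i \<inter> A = {} then {} else U i)" for i
  define UB where "UB i = (if U i \<inter> B = {} then {} else U i)" for i
  have disj: "U i \<inter> A = {} \<or> U i \<inter> B = {}" for i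
  proof (rule ccontr)
    assume "\<not> ?thesis"
    then obtain x y where "x \<in> U i" "x \<in> A" "y \<in> U i" "y \<in> B" by blast
    then show False
      using d[of x y] diameter_bounded_bound[OF bd[of i], of x y] dm[of i] by linarith
  qed
  have "hausdorff_pre s \<delta> A \<le> (\<Sum>i. hausdorff_gauge s (UA i))"
    unfolding hausdorff_pre_def using cov bd dm pos by (intro INF_lower) (auto simp: UA_def, blast)
  moreover have "hausdorff_pre s \<delta> B \<le> (\<Sum>i. hausdorff_gauge s (UB i))"
    unfolding hausdorff_pre_def using cov bd dm pos by (intro INF_lower) (auto simp: UB_def, blast)
  ultimately have "hausdorff_pre s \<delta> A + hausdorff_pre s \<delta> B
      \<le> (\<Sum>i. hausdorff_gauge s (UA i)) + (\<Sum>i. hausdorff_gauge s (UB i))"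
    by (rule add_mono)
  also have "\<dots> = (\<Sum>i. hausdorff_gauge s (UA i) + hausdorff_gauge s (UB i))"
    by (rule suminf_add) (auto intro: summableI)
  also have "\<dots> \<le> (\<Sum>i. hausdorff_gauge s (U i))"
  proof (intro suminf_le summableI)
    fix i
    show "hausdorff_gauge s (UA i) + hausdorff_gauge s (UB i) \<le> hausdorff_gauge s (U i)"
      using disj[of i] by (auto simp: UA_def UB_def hausdorff_gauge_def)
  qed
  finally show "hausdorff_pre s \<delta> A + hausdorff_pre s \<delta> B \<le> (\<Sum>i. hausdorff_gauge s (U i))" .
qed

lemma hausdorff_outer_separated:
  assumes d: "\<And>x y. x \<in> A \<Longrightarrow> y \<in> B \<Longrightarrow> d \<le> dist x y" and pos: "0 < d"
  shows "hausdorff_outer s A + hausdorff_outer s B \<le> hausdorff_outer s (A \<union> B)"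
proof -
  have "hausdorff_outer s A + hausdorff_outer s B
      = (SUP \<delta>\<in>{0<..}. hausdorff_pre s \<delta> A + hausdorff_pre s \<delta> B)"
    unfolding hausdorff_outer_def
  proof (rule SUP_add_directed_ennreal[symmetric])
    fix i j :: real assume "i \<in> {0<..}" "j \<in> {0<..}"
    then show "\<exists>k\<in>{0<..}. hausdorff_pre s i A + hausdorff_pre s j B
        \<le> hausdorff_pre s k A + hausdorff_pre s k B"
      by (intro bexI[of _ "min i j"] add_mono hausdorff_pre_antimono) auto
  qed
  also have "\<dots> \<le> hausdorff_outer s (A \<union> B)"
  proof (rule SUP_least)
    fix \<delta> :: real assume \<delta>: "\<delta> \<in> {0<..}"
    define \<epsilon> where "\<epsilon> = min \<delta> (d/2)"
    have e: "0 < \<epsilon>" "\<epsilon> < d" "\<epsilon> \<le> \<delta>" using pos \<delta> by (auto simp: \<epsilon>_def min_def)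
    have "hausdorff_pre s \<delta> A + hausdorff_pre s \<delta> B \<le> hausdorff_pre s \<epsilon> A + hausdorff_pre s \<epsilon> B"
      by (intro add_mono hausdorff_pre_antimono e)
    also have "\<dots> \<le> hausdorff_pre s \<epsilon> (A \<union> B)"
      using d e by (intro hausdorff_pre_separated) (auto intro: less_le_trans)
    also have "\<dots> \<le> hausdorff_outer s (A \<union> B)"
      by (rule hausdorff_pre_le_outer) (rule e)
    finally show "hausdorff_pre s \<delta> A + hausdorff_pre s \<delta> B \<le> hausdorff_outer s (A \<union> B)" .
  qed
  finally show ?thesis .
qed

lemma hausdorff_outer_sum_separated:
  fixes R :: "nat \<Rightarrow> 'a::metric_space set"
  assumes sep: "\<And>n. \<exists>d>0. \<forall>i<n. \<forall>x\<in>R i. \<forall>y\<in>R n. d \<le> dist x y"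
  shows "(\<Sum>i<n. hausdorff_outer s (R i)) \<le> hausdorff_outer s (\<Union>i<n. R i)"
proof (induction n)
  case (Suc n)
  obtain d where "d > 0" "\<forall>i<n. \<forall>x\<in>R i. \<forall>y\<in>R n. d \<le> dist x y" using sep by blast
  then have "hausdorff_outer s (\<Union>i<n. R i) + hausdorff_outer s (R n)
      \<le> hausdorff_outer s ((\<Union>i<n. R i) \<union> R n)"
    by (intro hausdorff_outer_separated[of _ _ d]) auto
  moreover have "(\<Union>i<n. R i) \<union> R n = (\<Union>i<Suc n. R i)" by (auto simp: less_Suc_eq)
  ultimately show ?case
    using Suc by (metis (no_types, lifting) add_right_mono order_trans sum.lessThan_Suc)
qed simp

lemma hausdorff_outer_closed_split:
  fixes C :: "'a::metric_space set"
  assumes C: "closed C"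
  shows "hausdorff_outer s (A \<inter> C) + hausdorff_outer s (A - C) \<le> hausdorff_outer s A"
proof (cases "C = {} \<or> hausdorff_outer s A = top")
  case True
  then show ?thesis by (auto simp: hausdorff_outer_empty)
next
  case False
  then have ne: "C \<noteq> {}" and fin: "hausdorff_outer s A < top" by (auto simp: less_top)
  let ?H = "hausdorff_outer s :: 'a set \<Rightarrow> ennreal"
  define r where "r n = 1 / real (Suc n)" for n
  have r: "0 < r n" "r (Suc n) < r n" for n by (auto simp: r_def field_simps)
  have r_anti: "m \<le> n \<Longrightarrow> r n \<le> r m" for m n by (auto simp: r_def field_simps)
  define B where "B n = {x \<in> A. r n \<le> infdist x C}" for n
  define R where "R n = {x \<in> A. r (Suc n) \<le> infdist x C \<and> infdist x C < r n}" for n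
  have lip: "infdist x C - infdist y C \<le> dist x y" for x y
    using infdist_triangle[of x C y] by simp
  have sepR: "\<exists>d>0. \<forall>i<n. \<forall>x\<in>R (2*i+c). \<forall>y\<in>R (2*n+c). d \<le> dist x y" for n c
  proof (cases n)
    case (Suc m)
    have "r (2*n+c) < r (2*m+c+1)" using r(2)[of "2*m+c+1"] by (simp add: Suc)
    moreover have "r (2*m+c+1) - r (2*n+c) \<le> dist x y"
      if "i < n" "x \<in> R (2*i+c)" "y \<in> R (2*n+c)" for i x y
    proof -
      have "r (2*m+c+1) \<le> r (Suc (2*i+c))" using that Suc by (intro r_anti) auto
      then show ?thesis using that lip[of x y] by (auto simp: R_def)
    qed
    ultimately show ?thesis by (intro exI[of _ "r (2*m+c+1) - r (2*n+c)"]) auto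
  qed (auto intro: exI[of _ 1])
  have bound: "(\<Sum>i<n. ?H (R (2*i+c))) \<le> ?H A" for n c
    by (rule order_trans[OF hausdorff_outer_sum_separated[OF sepR]])
       (auto intro!: hausdorff_outer_mono simp: R_def)
  have "(\<Sum>i<n. ?H (R i)) \<le> ?H A + ?H A" for n
  proof -
    have "(\<Sum>i<n. ?H (R i)) \<le> (\<Sum>i<2*n. ?H (R i))"
      by (intro sum_mono2) auto
    also have "\<dots> = (\<Sum>i<n. ?H (R (2*i+0))) + (\<Sum>i<n. ?H (R (2*i+1)))"
      by (induction n) (auto simp: ac_simps)
    also have "\<dots> \<le> ?H A + ?H A" by (intro add_mono bound)
    finally show ?thesis .
  qed
  then have "(\<Sum>i. ?H (R i)) \<le> ?H A + ?H A"
    by (intro suminf_le_const summableI)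
  then have sfin: "(\<Sum>i. ?H (R i)) \<noteq> top" using fin by (auto simp: top_unique)
  have tail: "(\<lambda>n. \<Sum>i. ?H (R (i + n))) \<longlonglongrightarrow> 0"
  proof -
    have fini: "?H (R i) \<noteq> top" for i
      using fin hausdorff_outer_mono[of "R i" A s] by (auto simp: R_def less_top[symmetric] top_unique)
    have "summable (\<lambda>i. enn2real (?H (R i)))"
      by (rule summable_suminf_not_top) (use sfin fini in \<open>auto simp: less_top\<close>)
    then have "(\<lambda>n. \<Sum>i. enn2real (?H (R (i + n)))) \<longlonglongrightarrow> 0"
      by (rule suminf_exist_split2)
    then have "(\<lambda>n. ennreal (\<Sum>i. enn2real (?H (R (i + n))))) \<longlonglongrightarrow> ennreal 0"
      by (rule tendsto_ennrealI)
    moreover have "ennreal (\<Sum>i. enn2real (?H (R (i + n)))) = (\<Sum>i. ?H (R (i + n)))" for n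
      using fini \<open>summable (\<lambda>i. enn2real (?H (R i)))\<close>
      by (subst suminf_ennreal2[symmetric])
         (auto simp: less_top intro: summable_ignore_initial_segment)
    ultimately show ?thesis by simp
  qed
  have main: "?H (A \<inter> C) + ?H (A - C) \<le> ?H A + (\<Sum>i. ?H (R (i + n)))" for n
  proof -
    have "A - C \<subseteq> B n \<union> (\<Union>i. R (i + n))"
    proof
      fix x assume x: "x \<in> A - C"
      then have "0 < infdist x C"
        using C ne in_closed_iff_infdist_zero[of C x] infdist_nonneg[of x C] by auto
      then obtain m where "r m < infdist x C"
        unfolding r_def by (metis nat_approx_posE)
      then have ex: "\<exists>m. r m \<le> infdist x C" by (auto intro: less_imp_le)
      define k where "k = (LEAST m. r m \<le> infdist x C)"
      have k: "r k \<le> infdist x C"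
        unfolding k_def using ex by (rule LeastI_ex)
      have k': "infdist x C < r j" if "j < k" for j
        using not_less_Least[OF that[unfolded k_def]] by (simp add: not_le)
      show "x \<in> B n \<union> (\<Union>i. R (i + n))"
      proof (cases "k \<le> n")
        case True
        then show ?thesis using k x r_anti[OF True] by (auto simp: B_def)
      next
        case False
        then obtain j where j: "k = Suc j" "n \<le> j" by (cases k) auto
        then have "x \<in> R ((j - n) + n)" using k k'[of j] x by (auto simp: R_def)
        then show ?thesis by blast
      qed
    qed
    then have "?H (A - C) \<le> ?H (B n \<union> (\<Union>i. R (i + n)))" by (rule hausdorff_outer_mono)
    also have "\<dots> \<le> ?H (B n) + ?H (\<Union>i. R (i + n))" by (rule hausdorff_outer_Un)
    also have "\<dots> \<le> ?H (B n) + (\<Sum>i. ?H (R (i + n)))"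
      by (intro add_left_mono hausdorff_outer_countably_subadditive)
    finally have "?H (A \<inter> C) + ?H (A - C) \<le> ?H (A \<inter> C) + ?H (B n) + (\<Sum>i. ?H (R (i + n)))"
      by (metis add.assoc add_left_mono)
    moreover have "?H (A \<inter> C) + ?H (B n) \<le> ?H ((A \<inter> C) \<union> B n)"
    proof (rule hausdorff_outer_separated)
      fix x y assume "x \<in> A \<inter> C" "y \<in> B n"
      then show "r n \<le> dist x y"
        using infdist_le[of x C y] by (auto simp: B_def dist_commute)
    qed (rule r)
    moreover have "?H ((A \<inter> C) \<union> B n) \<le> ?H A"
      by (rule hausdorff_outer_mono) (auto simp: B_def)
    ultimately show ?thesis by (meson add_right_mono order_trans)
  qed
  have "(\<lambda>n. ?H A + (\<Sum>i. ?H (R (i + n)))) \<longlonglongrightarrow> ?H A + 0"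
    by (intro tendsto_add tendsto_const tail)
  then have lim: "(\<lambda>n. ?H A + (\<Sum>i. ?H (R (i + n)))) \<longlonglongrightarrow> ?H A" by simp
  show ?thesis
    by (rule LIMSEQ_le_const[OF lim]) (use main in blast)
qed

lemma hausdorff_outer_measure_space:
  "measure_space UNIV (sets borel) (hausdorff_outer s :: 'a::metric_space set \<Rightarrow> ennreal)"
proof -
  let ?H = "hausdorff_outer s :: 'a set \<Rightarrow> ennreal"
  interpret P: sigma_algebra UNIV "Pow (UNIV :: 'a set)" by (rule sigma_algebra_Pow)
  have "outer_measure_space (Pow UNIV) ?H"
    unfolding outer_measure_space_def positive_def increasing_def countably_subadditive_def
    by (auto simp: hausdorff_outer_empty hausdorff_outer_mono hausdorff_outer_countably_subadditive)
  then have L: "measure_space UNIV (lambda_system UNIV (Pow UNIV) ?H) ?H"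
    by (rule P.caratheodory_lemma)
  then interpret L: sigma_algebra UNIV "lambda_system UNIV (Pow UNIV) ?H"
    by (simp add: measure_space_def)
  have "C \<in> lambda_system UNIV (Pow UNIV) ?H" if "closed C" for C
  proof -
    have "?H (A \<inter> C) + ?H (A - C) = ?H A" for A
      using hausdorff_outer_closed_split[OF that, of s A] hausdorff_outer_Un[of s "A \<inter> C" "A - C"]
      by (simp add: Un_Diff_Int Int_Diff_Un antisym)
    then show ?thesis unfolding P.lambda_system_eq[of ?H] by blast
  qed
  then have "sigma_sets UNIV {C. closed C} \<subseteq> lambda_system UNIV (Pow UNIV) ?H"
    by (intro L.sigma_sets_subset) auto
  then have "sets borel \<subseteq> lambda_system UNIV (Pow UNIV) ?H"
    by (simp add: borel_eq_closed)
  with L show ?thesis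
    by (intro measure_down[OF L]) (auto simp: sets.sigma_algebra_axioms[of borel, simplified])
qed

lemma sets_hausdorff_measure [simp, measurable_cong]: "sets (hausdorff_measure s) = sets borel"
  unfolding hausdorff_measure_def by (metis sets.sets_measure_of_eq space_borel)

lemma space_hausdorff_measure [simp]: "space (hausdorff_measure s) = UNIV"
  unfolding hausdorff_measure_def by (simp add: space_measure_of_conv)

lemma emeasure_hausdorff_measure:
  "A \<in> sets borel \<Longrightarrow> emeasure (hausdorff_measure s) A = hausdorff_outer s A"
  unfolding hausdorff_measure_def
  using hausdorff_outer_measure_space[of s]
  by (intro emeasure_measure_of_sigma) (auto simp: measure_space_def)

definition surface_measure :: "'a::euclidean_space set \<Rightarrow> 'a measure" where
  "surface_measure X = restrict_space (hausdorff_measure (DIM('a) - 1)) (frontier X)"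

section \<open>Norms\<close>

definition ennreal_powr :: "ennreal \<Rightarrow> real \<Rightarrow> ennreal" where
  "ennreal_powr x a = (if x = \<infinity> then \<infinity> else ennreal (enn2real x powr a))"

definition Linf_norm :: "'b measure \<Rightarrow> ('b \<Rightarrow> ennreal) \<Rightarrow> ennreal" where
  "Linf_norm M F = Inf {c. AE x in M. F x \<le> c}"

text \<open>\<open>F\<close> is the absolute value (or any norm) of the function whose norm is taken.\<close>

definition Lp_norm :: "ennreal \<Rightarrow> 'b measure \<Rightarrow> ('b \<Rightarrow> ennreal) \<Rightarrow> ennreal" where
  "Lp_norm p M F =
     (if p = \<infinity> then Linf_norm M F
      else ennreal_powr (\<integral>\<^sup>+x. ennreal_powr (F x) (enn2real p) \<partial>M) (1 / enn2real p))"

text \<open>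
  The norm and the space \<open>L\<^sup>p(S\<^sup>n\<^sup>-\<^sup>1, L\<^sup>\<infinity>(Y))\<close>, where \<open>N\<close> is the measure of \<open>Y\<close>. Elements of
  the space are represented by Borel functions of \<open>(x, \<theta>)\<close>.
\<close>

definition mixed_norm ::
    "ennreal \<Rightarrow> 'a::euclidean_space measure \<Rightarrow> ('a \<Rightarrow> 'a \<Rightarrow> real) \<Rightarrow> ennreal" where
  "mixed_norm p N w = Lp_norm p sphere_measure (\<lambda>\<theta>. Linf_norm N (\<lambda>x. ennreal \<bar>w x \<theta>\<bar>))"

definition mixed_space ::
    "ennreal \<Rightarrow> 'a::euclidean_space measure \<Rightarrow> ('a \<Rightarrow> 'a \<Rightarrow> real) set" where
  "mixed_space p N =
     {w. (\<lambda>(x, \<theta>). w x \<theta>) \<in> borel_measurable (N \<Otimes>\<^sub>M sphere_measure) \<and> mixed_norm p N w < \<infinity>}"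

section \<open>The transport equation\<close>

text \<open>The number \<open>\<rho>\<close>, for a bounded kernel.\<close>

definition scattering_bound ::
    "'a::euclidean_space set \<Rightarrow> ('a \<Rightarrow> 'a \<Rightarrow> 'a \<Rightarrow> real) \<Rightarrow> real" where
  "scattering_bound X k =
     enn2real (Linf_norm (domain_measure X \<Otimes>\<^sub>M sphere_measure)
       (\<lambda>(x, \<theta>). ennreal \<bar>\<integral>\<theta>'. k x \<theta> \<theta>' \<partial>sphere_measure\<bar>))"

definition scattering ::
    "('a::euclidean_space \<Rightarrow> 'a \<Rightarrow> 'a \<Rightarrow> real) \<Rightarrow> ('a \<Rightarrow> 'a \<Rightarrow> real) \<Rightarrow> 'a \<Rightarrow> 'a \<Rightarrow> real" where
  "scattering k v x \<theta> = (\<integral>\<theta>'. k x \<theta> \<theta>' * v x \<theta>' \<partial>sphere_measure)"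

definition test_function :: "'a::euclidean_space set \<Rightarrow> ('a \<Rightarrow> real) \<Rightarrow> bool" where
  "test_function X \<psi> \<longleftrightarrow>
     Ck_on 1 UNIV \<psi> \<and> compact (closure {x. \<psi> x \<noteq> 0}) \<and> closure {x. \<psi> x \<noteq> 0} \<subseteq> X"

text \<open>
  The equation \<open>\<theta>\<cdot>\<nabla>v + \<sigma>v = \<integral>k v\<close> in the weak sense on \<open>X\<close>, for almost every \<open>\<theta>\<close>; the
  functions \<open>v\<close> in question are only bounded in \<open>x\<close>.
\<close>

definition solves_transport ::
    "'a::euclidean_space set \<Rightarrow> ('a \<Rightarrow> real) \<Rightarrow> ('a \<Rightarrow> 'a \<Rightarrow> 'a \<Rightarrow> real) \<Rightarrow>
     ('a \<Rightarrow> 'a \<Rightarrow> real) \<Rightarrow> bool" where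
  "solves_transport X \<sigma> k v \<longleftrightarrow>
     (AE \<theta> in sphere_measure. \<forall>\<psi>. test_function X \<psi> \<longrightarrow>
        (\<integral>x. v x \<theta> * (\<sigma> x * \<psi> x - frechet_derivative \<psi> (at x) \<theta>) \<partial>domain_measure X) =
        (\<integral>x. scattering k v x \<theta> * \<psi> x \<partial>domain_measure X))"

text \<open>
  The boundary condition \<open>v = g\<close> on \<open>\<Gamma>\<^sub>-\<close>. The trace of \<open>v\<close> at \<open>(y, \<theta>)\<close> is the essential limit
  of \<open>v\<close> along the line entering \<open>X\<close> at \<open>y\<close> in direction \<open>\<theta>\<close>. Up to null sets of \<open>(y, \<theta>)\<close>, this
  depends only on the almost-everywhere class of \<open>v\<close>.
\<close>

definition inflow_trace ::
    "'a::euclidean_space set \<Rightarrow> ('a \<Rightarrow> 'a \<Rightarrow> real) \<Rightarrow> ('a \<Rightarrow> 'a \<Rightarrow> real) \<Rightarrow> bool" where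
  "inflow_trace X v g \<longleftrightarrow>
     (AE \<theta> in sphere_measure. AE y in surface_measure X. (y, \<theta>) \<in> Gamma_minus X \<longrightarrow>
        (\<forall>\<epsilon>>0. \<exists>\<delta>>0. AE t in lborel. 0 < t \<and> t < \<delta> \<longrightarrow> \<bar>v (y + t *\<^sub>R \<theta>) \<theta> - g y \<theta>\<bar> < \<epsilon>))"

definition solves_bvp ::
    "'a::euclidean_space set \<Rightarrow> ('a \<Rightarrow> real) \<Rightarrow> ('a \<Rightarrow> 'a \<Rightarrow> 'a \<Rightarrow> real) \<Rightarrow>
     ('a \<Rightarrow> 'a \<Rightarrow> real) \<Rightarrow> ('a \<Rightarrow> 'a \<Rightarrow> real) \<Rightarrow> bool" where
  "solves_bvp X \<sigma> k g v \<longleftrightarrow> solves_transport X \<sigma> k v \<and> inflow_trace X v g"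

end

theory Submission
  imports Defs
begin

text \<open>
  Extend \<open>\<sigma>\<close> and \<open>k\<close> to bounded continuous functions on the whole space. Since the boundary values
  \<open>g\<close> are at our disposal, we integrate the equation along lines not from the boundary but from the
  hyperplane through \<open>x\<^sub>0\<close> orthogonal to \<open>\<theta>\<close>, prescribing \<open>v = h(\<theta>)\<close> there:
  \<open>v(x, \<theta>) = h(\<theta>) + \<integral>\<^sub>0\<^sup>a (\<integral>k v - \<sigma> v)(x - t\<theta>, \<theta>) dt\<close> with \<open>a = (x - x\<^sub>0) \<bullet> \<theta>\<close>. The segments of integration
  approach \<open>x\<^sub>0\<close>, and in the sup norm with weight \<open>exp (- \<mu> |x - x\<^sub>0|\<^sup>2)\<close> the integral operator has norm
  \<open>O(\<mu>\<^sup>-\<^sup>1\<^sup>/\<^sup>2)\<close>. So for large \<open>\<mu>\<close> there is a unique fixed point; it is continuous, equals \<open>h\<close> at \<open>x\<^sub>0\<close>, and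
  is bounded by a multiple of \<open>|h(\<theta>)| + \<integral>|h|\<close>, which gives the norm estimate for all \<open>p\<close> at once. Its
  restriction to the boundary serves as \<open>g\<close>.

  Uniqueness is where subcriticality enters. The difference \<open>u\<close> of two solutions has a bounded
  scattering term. Testing the weak equation shows that \<open>u\<close> is absolutely continuous
  on almost every line. Lines that leave \<open>X\<close> backwards at a tangential point, or at a point of a given
  null set of the boundary, fill a null set, so \<open>u\<close> vanishes at the inflow end of almost every line.
  Comparison for the resulting ODE gives \<open>|u| \<le> \<kappa> sup |u|\<close> with \<open>\<kappa> < 1\<close>.
\<close>

section \<open>The sphere and the norms\<close>

text \<open>The weight pays off because of the hyperplane. With \<open>y = x - x\<^sub>0\<close> and
  \<open>a = y \<bullet> \<theta>\<close>, the point \<open>y - (s * a) *\<^sub>R \<theta>\<close>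
  has squared norm at most \<open>(norm y)\<^sup>2 - s * a\<^sup>2\<close>, so one application of
  the integral operator costs at most a constant times the integral of |a| exp(- \<mu> a^2 s) over 0
  \<le> s \<le> 1, and this integral stays below \<open>1 / sqrt \<mu>\<close> whatever a is. Hence
  \<mu> depends only on bounds for the coefficients, not on \<open>x\<^sub>0\<close>, h or p. In the
  uniqueness proof the obstacle is that u is only L^p in \<theta> and that each hypothesis holds off
  its own null set: the equation for almost every \<theta>, against test functions of x alone; the
  trace off a null set of the boundary. So \<theta> is fixed and one works on the lines in direction
  \<theta>; a null set of the boundary sweeps out a Lebesgue null set by a covering estimate valid
  for every direction. A first pass, resting on \<sigma> \<ge> 0 and the boundedness of k, makes u
  essentially bounded; the later passes, resting on the normalization, contract by \<kappa>.\<close>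

lemma sgn_measurable_sphere:
  "sgn \<in> scale_measure c (restrict_space lborel (ball 0 1 - {0::'a::euclidean_space}))
     \<rightarrow>\<^sub>M restrict_space borel (sphere 0 1)"
proof (rule measurable_restrict_space2)
  show "sgn \<in> space (scale_measure c (restrict_space lborel (ball 0 1 - {0::'a}))) \<rightarrow> sphere 0 1"
    by (auto simp: space_scale_measure space_restrict_space norm_sgn)
  have "(sgn :: 'a \<Rightarrow> 'a) \<in> borel_measurable borel"
    by (simp add: sgn_div_norm[abs_def])
  then have "(sgn :: 'a \<Rightarrow> 'a) \<in> restrict_space lborel (ball 0 1 - {0}) \<rightarrow>\<^sub>M borel"
    by (intro measurable_restrict_space1) simp
  then show "sgn \<in> scale_measure c (restrict_space lborel (ball 0 1 - {0::'a})) \<rightarrow>\<^sub>M borel"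
    by (simp add: measurable_def space_scale_measure sets_scale_measure)
qed

lemma space_sphere_measure [simp]: "space sphere_measure = sphere (0::'a::euclidean_space) 1"
  by (simp add: sphere_measure_def space_restrict_space)

lemma sets_sphere_measure [measurable_cong]:
  "sets sphere_measure = sets (restrict_space borel (sphere (0::'a::euclidean_space) 1))"
  by (simp add: sphere_measure_def)

lemma emeasure_sphere_measure_space:
  "emeasure sphere_measure (sphere (0::'a::euclidean_space) 1)
     = ennreal (of_nat DIM('a) * unit_ball_vol (real DIM('a)))"
proof -
  let ?B = "ball (0::'a) 1 - {0}"
  have "emeasure sphere_measure (sphere (0::'a) 1)
      = emeasure (scale_measure (of_nat DIM('a)) (restrict_space lborel ?B)) ?B"
    unfolding sphere_measure_def
  proof (subst emeasure_distr[OF sgn_measurable_sphere])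
    have "sgn -` sphere 0 1 \<inter> ?B = ?B" by (auto simp: norm_sgn)
    then show "emeasure (scale_measure (of_nat DIM('a)) (domain_measure ?B))
        (sgn -` sphere 0 1 \<inter> space (scale_measure (of_nat DIM('a)) (domain_measure ?B)))
      = emeasure (scale_measure (of_nat DIM('a)) (domain_measure ?B)) ?B"
      by (simp add: space_scale_measure space_restrict_space)
  qed (auto simp: sets_restrict_space)
  also have "\<dots> = of_nat DIM('a) * emeasure lborel ?B"
    by (simp add: emeasure_restrict_space)
  also have "emeasure lborel ?B = emeasure lborel (ball (0::'a) 1)"
    by (intro emeasure_Diff_null_set) (auto intro: finite_imp_null_set_lborel)
  also have "\<dots> = ennreal (unit_ball_vol (real DIM('a)))"
    by (subst emeasure_ball) auto
  finally show ?thesis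
    by (simp add: ennreal_mult ennreal_of_nat_eq_real_of_nat)
qed

lemma finite_measure_sphere: "finite_measure (sphere_measure :: 'a::euclidean_space measure)"
  by (rule finite_measureI) (simp add: emeasure_sphere_measure_space)

interpretation sphere: finite_measure "sphere_measure :: 'a::euclidean_space measure"
  by (rule finite_measure_sphere)

lemma sphere_measure_nonzero: "emeasure sphere_measure (sphere (0::'a::euclidean_space) 1) \<noteq> 0"
proof -
  have "0 < real DIM('a) * unit_ball_vol (real DIM('a))"
    by (intro mult_pos_pos unit_ball_vol_pos) auto
  then have "0 < emeasure sphere_measure (sphere (0::'a) 1)"
    unfolding emeasure_sphere_measure_space by (simp only: ennreal_less_zero_iff)
  then show ?thesis by (rule less_imp_neq[THEN not_sym])
qed

lemma borel_measurable_sphereI: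
  "f \<in> borel_measurable borel \<Longrightarrow> f \<in> borel_measurable (sphere_measure :: 'a::euclidean_space measure)"
  by (subst measurable_cong_sets[OF sets_sphere_measure refl]) (rule measurable_restrict_space1)

lemma integrable_sphere_continuous:
  fixes f :: "'a::euclidean_space \<Rightarrow> real"
  assumes "continuous_on UNIV f"
  shows "integrable sphere_measure f"
proof -
  have "bounded (f ` sphere 0 1)"
    by (intro compact_imp_bounded compact_continuous_image continuous_on_subset[OF assms]) auto
  then obtain B where "\<And>x. x \<in> sphere 0 1 \<Longrightarrow> norm (f x) \<le> B"
    unfolding bounded_iff by blast
  then show ?thesis
    by (intro sphere.integrable_const_bound[of _ B] AE_I2 borel_measurable_sphereI
        borel_measurable_continuous_onI assms) auto
qed

text \<open>Dominated convergence along a sequence: a convergent sequence stays in a closed ball,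
  and \<open>F\<close> is bounded on the compact product of that ball with the sphere. The class
  \<open>heine_borel\<close> makes the ball compact and includes the pairs (x, \<theta>), for which
  the lemma is used.\<close>

lemma continuous_on_sphere_integral:
  fixes F :: "'c::heine_borel \<Rightarrow> 'a::euclidean_space \<Rightarrow> real"
  assumes F: "continuous_on UNIV (\<lambda>(x, \<theta>). F x \<theta>)"
  shows "continuous_on UNIV (\<lambda>x. \<integral>\<theta>. F x \<theta> \<partial>sphere_measure)"
proof (rule continuous_at_imp_continuous_on, rule ballI)
  fix x :: 'c
  show "isCont (\<lambda>x. \<integral>\<theta>. F x \<theta> \<partial>sphere_measure) x"
    unfolding continuous_at_sequentially comp_def
  proof (intro allI impI)
    fix X :: "nat \<Rightarrow> 'c" assume X: "X \<longlonglongrightarrow> x"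
    then have "bounded (range X)" by (rule convergent_imp_bounded)
    then obtain r where "\<And>y. y \<in> range X \<Longrightarrow> dist x y \<le> r"
      unfolding bounded_any_center[of _ x] by blast
    then have r: "\<And>n. X n \<in> cball x r" by auto
    have "bounded ((\<lambda>(x, \<theta>). F x \<theta>) ` (cball x r \<times> sphere 0 1))"
      by (intro compact_imp_bounded compact_continuous_image continuous_on_subset[OF F] compact_Times) auto
    then obtain B where B: "\<And>y \<theta>. y \<in> cball x r \<Longrightarrow> \<theta> \<in> sphere 0 1 \<Longrightarrow> norm (F y \<theta>) \<le> B"
      unfolding bounded_iff by fast
    have F1: "continuous_on UNIV (F y)" for y
      using continuous_on_compose2[OF F, of UNIV "\<lambda>\<theta>. (y, \<theta>)"]
      by (simp add: continuous_on_Pair)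
    have F2: "isCont (\<lambda>y. F y \<theta>) x" for \<theta>
    proof -
      have "continuous_on UNIV (\<lambda>y. F y \<theta>)"
        using continuous_on_compose2[OF F, of UNIV "\<lambda>y. (y, \<theta>)"]
        by (simp add: continuous_on_Pair)
      then show ?thesis by (simp add: continuous_on_eq_continuous_at)
    qed
    show "(\<lambda>n. \<integral>\<theta>. F (X n) \<theta> \<partial>sphere_measure) \<longlonglongrightarrow> (\<integral>\<theta>. F x \<theta> \<partial>sphere_measure)"
    proof (rule integral_dominated_convergence[where w="\<lambda>_. B"])
      show "F x \<in> borel_measurable sphere_measure" "\<And>i. F (X i) \<in> borel_measurable sphere_measure"
        by (auto intro!: borel_measurable_sphereI borel_measurable_continuous_onI F1)
      show "AE \<theta> in sphere_measure. (\<lambda>i. F (X i) \<theta>) \<longlonglongrightarrow> F x \<theta>"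
        using F2 X by (auto intro!: isCont_tendsto_compose[where g="\<lambda>y. F y _"])
      show "\<And>i. AE \<theta> in sphere_measure. norm (F (X i) \<theta>) \<le> B"
        using B r by (auto intro!: AE_I2)
    qed simp
  qed
qed

section \<open>Essential suprema and \<open>L\<^sup>p\<close> norms\<close>

text \<open>The infimum in the definition is attained: each level above it by 1/(n+1) is an
  essential bound, and countably many exceptional null sets may be united.\<close>

lemma AE_le_Linf_norm: "AE x in M. F x \<le> Linf_norm M F"
proof (cases "Linf_norm M F = \<infinity>")
  case False
  define L where "L = Linf_norm M F"
  have *: "AE x in M. F x \<le> L + ennreal (inverse (Suc n))" for n
  proof -
    have "L < L + ennreal (inverse (Suc n))"
      using False ennreal_add_left_cancel_less[of L 0 "ennreal (inverse (Suc n))"] by (simp add: L_def)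
    then obtain c where c: "AE x in M. F x \<le> c" "c < L + ennreal (inverse (Suc n))"
      unfolding L_def Linf_norm_def Inf_less_iff by blast
    show ?thesis
      using c(1) by eventually_elim (rule order_trans[OF _ less_imp_le[OF c(2)]])
  qed
  have "AE x in M. \<forall>n. F x \<le> L + ennreal (inverse (Suc n))"
    using * by (simp add: AE_all_countable)
  then show ?thesis
    unfolding L_def[symmetric]
  proof (eventually_elim)
    fix x assume a: "\<forall>n. F x \<le> L + ennreal (inverse (Suc n))"
    have "(\<lambda>n. L + ennreal (inverse (Suc n))) \<longlonglongrightarrow> L + ennreal 0"
      by (intro tendsto_add tendsto_const tendsto_ennrealI LIMSEQ_inverse_real_of_nat)
    then have "(\<lambda>n. L + ennreal (inverse (Suc n))) \<longlonglongrightarrow> L" by simp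
    then show "F x \<le> L" by (rule LIMSEQ_le_const) (use a in blast)
  qed
qed simp

lemma Linf_norm_le: "AE x in M. F x \<le> c \<Longrightarrow> Linf_norm M F \<le> c"
  unfolding Linf_norm_def by (rule Inf_lower) simp

lemma ennreal_powr_mono: "x \<le> y \<Longrightarrow> 0 \<le> a \<Longrightarrow> ennreal_powr x a \<le> ennreal_powr y a"
  by (auto simp: ennreal_powr_def top_unique less_top[symmetric]
      intro!: ennreal_leI powr_mono2 enn2real_mono)

lemma ennreal_powr_ennreal: "0 \<le> x \<Longrightarrow> ennreal_powr (ennreal x) a = ennreal (x powr a)"
  by (simp add: ennreal_powr_def)

text \<open>Monotonicity of \<open>nn_integral\<close> holds for arbitrary functions, so the lemma
  can be applied to \<theta> \<mapsto> essential supremum of the section at \<theta>, for any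
  measure on the x-space, before anything is known about measurability in \<theta>.\<close>

lemma Lp_norm_mono:
  assumes "AE x in M. F x \<le> G x"
  shows "Lp_norm p M (F::_ \<Rightarrow> ennreal) \<le> Lp_norm p M G"
proof (cases "p = \<infinity>")
  case True
  have "AE x in M. F x \<le> Linf_norm M G"
    using assms AE_le_Linf_norm[where M=M and F=G] by eventually_elim auto
  then show ?thesis using True by (simp add: Lp_norm_def Linf_norm_le)
next
  case False
  then show ?thesis
    unfolding Lp_norm_def
    by (auto intro!: ennreal_powr_mono nn_integral_mono_AE eventually_mono[OF assms])
qed

text \<open>With \<open>m\<close> the \<open>L\<^sup>q\<close> norm of \<open>h\<close>, integrating \<open>|h| \<le> m + |h|\<^sup>q m\<^sup>1\<^sup>-\<^sup>q\<close> bounds the mean of \<open>|h|\<close> by a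
  multiple of \<open>m\<close> that does not depend on \<open>q\<close>.\<close>

lemma Lp_norm_add_mean_le:
  fixes h :: "'b \<Rightarrow> real" and p :: ennreal
  assumes fin: "finite_measure M" and h[measurable]: "h \<in> borel_measurable M"
    and B: "\<And>x. x \<in> space M \<Longrightarrow> \<bar>h x\<bar> \<le> B" and p: "1 \<le> p" and AD: "0 \<le> A" "0 \<le> D"
  defines "S \<equiv> measure M (space M)"
  shows "Lp_norm p M (\<lambda>x. ennreal (A * \<bar>h x\<bar> + D * (\<integral>y. \<bar>h y\<bar> \<partial>M)))
    \<le> ennreal (4 * (A + D * (S + 1)\<^sup>2)) * Lp_norm p M (\<lambda>x. ennreal \<bar>h x\<bar>)"
proof -
  interpret finite_measure M by (rule fin)
  define I where "I = (\<integral>y. \<bar>h y\<bar> \<partial>M)"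
  have S0: "0 \<le> S" by (simp add: S_def)
  have I0: "0 \<le> I" by (simp add: I_def)
  have ih: "integrable M (\<lambda>y. \<bar>h y\<bar>)"
    by (rule integrable_const_bound[of _ B]) (auto intro!: AE_I2 B)
  \<comment> \<open>One factor 2 comes from (a + b)^q \<le> 2^q (a^q + b^q), the other from a^q +
    b^q \<le> 2 (a + b)^q \<le> 2^q (a + b)^q. One factor \<open>S + 1\<close> is the bound of the
    mean, \<open>I \<le> m * (S + 1)\<close>; the other swallows the total mass that appears when
    the constant is integrated, since \<open>S \<le> (S + 1) powr q\<close>. After the q-th root
    nothing depends on q.\<close>
  let ?C = "4 * (A + D * (S + 1)\<^sup>2)"
  have C0: "0 \<le> ?C" using AD by simp
  show ?thesis
    unfolding I_def[symmetric]
  proof (cases "p = \<infinity>")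
    case True
    define L where "L = Linf_norm M (\<lambda>x. ennreal \<bar>h x\<bar>)"
    have "L \<le> ennreal B" unfolding L_def by (rule Linf_norm_le) (auto intro!: AE_I2 ennreal_leI B)
    then obtain l where l: "L = ennreal l" "0 \<le> l"
      by (metis ennreal_cases ennreal_less_top leD top_greatest not_le)
    have "AE x in M. ennreal \<bar>h x\<bar> \<le> ennreal l"
      using AE_le_Linf_norm[where F="\<lambda>x. ennreal \<bar>h x\<bar>" and M=M] unfolding L_def[symmetric] l .
    then have ae: "AE x in M. \<bar>h x\<bar> \<le> l" using l(2) by simp
    have "I \<le> (\<integral>y. l \<partial>M)"
      unfolding I_def by (rule integral_mono_AE[OF ih _ ae]) simp
    then have "I \<le> l * S" by (simp add: S_def mult.commute)
    also have "\<dots> \<le> l * (S + 1)\<^sup>2"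
      using S0 l by (intro mult_left_mono) (auto simp: power2_eq_square algebra_simps)
    finally have Il: "I \<le> l * (S + 1)\<^sup>2" .
    have "Linf_norm M (\<lambda>x. ennreal (A * \<bar>h x\<bar> + D * I)) \<le> ennreal (?C * l)"
    proof (rule Linf_norm_le)
      show "AE x in M. ennreal (A * \<bar>h x\<bar> + D * I) \<le> ennreal (?C * l)"
        using ae
      proof eventually_elim
        case (elim x)
        have "A * \<bar>h x\<bar> + D * I \<le> A * l + D * (l * (S + 1)\<^sup>2)"
          using elim Il AD by (intro add_mono mult_left_mono) auto
        also have "\<dots> = (A + D * (S + 1)\<^sup>2) * l" by (simp add: algebra_simps)
        also have "\<dots> \<le> ?C * l" using AD l by (intro mult_right_mono) auto
        finally show ?case by (rule ennreal_leI)
      qed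
    qed
    then show "Lp_norm p M (\<lambda>x. ennreal (A * \<bar>h x\<bar> + D * I))
        \<le> ennreal ?C * Lp_norm p M (\<lambda>x. ennreal \<bar>h x\<bar>)"
      using True C0 l by (simp add: Lp_norm_def L_def[symmetric] ennreal_mult)
  next
    case False
    define q where "q = enn2real p"
    have q: "1 \<le> q" using p False unfolding q_def
      by (metis enn2real_1 enn2real_mono ennreal_one_less_top infinity_ennreal_def le_less_trans less_top not_le top.not_eq_extremum)
    have ihq: "integrable M (\<lambda>y. \<bar>h y\<bar> powr q)"
      by (rule integrable_const_bound[of _ "B powr q"]) (use q B in \<open>auto intro!: AE_I2 powr_mono2\<close>)
    define P where "P = (\<integral>y. \<bar>h y\<bar> powr q \<partial>M)"
    define m where "m = P powr (1 / q)"
    have P0: "0 \<le> P" by (simp add: P_def)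
    have m0: "0 \<le> m" by (simp add: m_def)
    have mq: "m powr q = P" using q P0 by (simp add: m_def powr_powr)
    have nP: "(\<integral>\<^sup>+x. ennreal_powr (ennreal \<bar>h x\<bar>) q \<partial>M) = ennreal P"
      unfolding P_def using ihq by (simp add: ennreal_powr_ennreal nn_integral_eq_integral)
    have I: "I \<le> m * (S + 1)"
    \<comment> \<open>For \<open>m = 0\<close> the pointwise splitting fails, because
      \<open>0 powr (1 - q) = 0\<close>; but then h vanishes almost everywhere.\<close>
    proof (cases "P = 0")
      case True
      then have "AE y in M. \<bar>h y\<bar> powr q = 0"
        using integral_nonneg_eq_0_iff_AE[OF ihq] by (simp add: P_def)
      then have "AE y in M. \<bar>h y\<bar> = 0" by simp
      then have "I = 0" using integral_nonneg_eq_0_iff_AE[OF ih] by (simp add: I_def)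
      then show ?thesis using m0 S0 by simp
    next
      case P: False
      then have mpos: "0 < m" using P0 by (simp add: m_def)
      have "\<bar>h y\<bar> \<le> m + \<bar>h y\<bar> powr q * m powr (1 - q)" for y
      proof (cases "\<bar>h y\<bar> \<le> m")
        case True
        then show ?thesis by (simp add: add_increasing2)
      next
        case False
        then have "\<bar>h y\<bar> powr (1 - q) \<le> m powr (1 - q)"
          using mpos q by (intro powr_mono2') auto
        then have "\<bar>h y\<bar> powr q * \<bar>h y\<bar> powr (1 - q) \<le> \<bar>h y\<bar> powr q * m powr (1 - q)"
          by (rule mult_left_mono) simp
        then show ?thesis using False mpos by (simp add: powr_add[symmetric])
      qed
      then have "I \<le> (\<integral>y. m + \<bar>h y\<bar> powr q * m powr (1 - q) \<partial>M)"
        unfolding I_def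
        by (intro integral_mono ih Bochner_Integration.integrable_add integrable_mult_left ihq) auto
      also have "\<dots> = m * S + P * m powr (1 - q)"
        using ihq by (simp add: P_def S_def mult.commute)
      also have "P * m powr (1 - q) = m"
        using mpos by (simp add: mq[symmetric] powr_add[symmetric])
      finally show ?thesis by (simp add: algebra_simps)
    qed
    have bound: "(A * \<bar>h x\<bar> + D * I) powr q \<le> 2 powr q * (A powr q * \<bar>h x\<bar> powr q + (D * I) powr q)" for x
    proof -
      let ?a = "A * \<bar>h x\<bar>" and ?b = "D * I"
      have ab: "0 \<le> ?a" "0 \<le> ?b" using AD I0 by auto
      have "(?a + ?b) powr q \<le> (2 * max ?a ?b) powr q"
        using ab q by (intro powr_mono2) auto
      also have "\<dots> = 2 powr q * max ?a ?b powr q" using ab by (simp add: powr_mult)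
      also have "max ?a ?b powr q \<le> ?a powr q + ?b powr q" by (auto simp: max_def)
      finally show ?thesis using AD by (simp add: powr_mult)
    qed
    have "(\<integral>\<^sup>+x. ennreal_powr (ennreal (A * \<bar>h x\<bar> + D * I)) q \<partial>M)
        = (\<integral>\<^sup>+x. ennreal ((A * \<bar>h x\<bar> + D * I) powr q) \<partial>M)"
      by (intro nn_integral_cong ennreal_powr_ennreal add_nonneg_nonneg mult_nonneg_nonneg AD I0) auto
    also have "\<dots> \<le> (\<integral>\<^sup>+x. ennreal (2 powr q * (A powr q * \<bar>h x\<bar> powr q + (D * I) powr q)) \<partial>M)"
      by (intro nn_integral_mono ennreal_leI bound)
    also have "\<dots> = ennreal (\<integral>x. 2 powr q * (A powr q * \<bar>h x\<bar> powr q + (D * I) powr q) \<partial>M)"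
      by (rule nn_integral_eq_integral) (use ihq in auto)
    also have "(\<integral>x. 2 powr q * (A powr q * \<bar>h x\<bar> powr q + (D * I) powr q) \<partial>M)
        = 2 powr q * (A powr q * P + S * (D * I) powr q)"
      using ihq by (simp add: P_def S_def)
    also have "\<dots> \<le> (?C * m) powr q"
    proof -
      let ?a = "A * m" and ?b = "D * (m * (S + 1)) * (S + 1)"
      have ab: "0 \<le> ?a" "0 \<le> ?b" using AD m0 S0 by auto
      have "S \<le> (S + 1) powr q"
      proof -
        have "S \<le> (S + 1) powr 1" using S0 by simp
        also have "\<dots> \<le> (S + 1) powr q" using S0 q by (intro powr_mono) auto
        finally show ?thesis .
      qed
      moreover have "(D * I) powr q \<le> (D * (m * (S + 1))) powr q"
        using AD I I0 q by (intro powr_mono2 mult_left_mono) auto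
      ultimately have "S * (D * I) powr q \<le> (S + 1) powr q * (D * (m * (S + 1))) powr q"
        using S0 by (intro mult_mono) auto
      also have "\<dots> = ?b powr q"
        using AD m0 S0 by (simp add: powr_mult mult.commute)
      finally have 1: "S * (D * I) powr q \<le> ?b powr q" .
      have 2: "A powr q * P = ?a powr q"
        using AD m0 by (simp add: mq[symmetric] powr_mult)
      have "?a powr q + ?b powr q \<le> (?a + ?b) powr q + (?a + ?b) powr q"
        using ab q by (intro add_mono powr_mono2) auto
      also have "\<dots> \<le> 2 powr q * (?a + ?b) powr q"
      proof -
        have "(2::real) powr 1 \<le> 2 powr q" using q by (intro powr_mono) auto
        then show ?thesis using mult_right_mono[of 2 "2 powr q" "(?a + ?b) powr q"] by simp
      qed
      finally have "2 powr q * (A powr q * P + S * (D * I) powr q) \<le> 2 powr q * (2 powr q * (?a + ?b) powr q)"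
        using 1 2 by (intro mult_left_mono) auto
      also have "\<dots> = (2 * (2 * (?a + ?b))) powr q"
        using ab by (metis add_nonneg_nonneg mult_nonneg_nonneg powr_mult zero_le_numeral)
      also have "2 * (2 * (?a + ?b)) = ?C * m"
        by (simp add: algebra_simps power2_eq_square)
      finally show ?thesis .
    qed
    finally have *: "(\<integral>\<^sup>+x. ennreal_powr (ennreal (A * \<bar>h x\<bar> + D * I)) q \<partial>M) \<le> ennreal ((?C * m) powr q)"
      by (simp add: ennreal_leI)
    have "Lp_norm p M (\<lambda>x. ennreal (A * \<bar>h x\<bar> + D * I))
        = ennreal_powr (\<integral>\<^sup>+x. ennreal_powr (ennreal (A * \<bar>h x\<bar> + D * I)) q \<partial>M) (1 / q)"
      using False by (simp add: Lp_norm_def q_def)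
    also have "\<dots> \<le> ennreal_powr (ennreal ((?C * m) powr q)) (1 / q)"
      by (rule ennreal_powr_mono[OF *]) (use q in simp)
    also have "\<dots> = ennreal (?C * m)"
      using q C0 m0 by (simp add: ennreal_powr_ennreal powr_powr)
    also have "\<dots> = ennreal ?C * Lp_norm p M (\<lambda>x. ennreal \<bar>h x\<bar>)"
      using False C0 m0 P0 unfolding Lp_norm_def q_def[symmetric] nP
      by (simp add: ennreal_powr_ennreal m_def ennreal_mult)
    finally show "Lp_norm p M (\<lambda>x. ennreal (A * \<bar>h x\<bar> + D * I))
        \<le> ennreal ?C * Lp_norm p M (\<lambda>x. ennreal \<bar>h x\<bar>)" .
  qed
qed

section \<open>Solutions with prescribed value at a point\<close>

lemma continuous_on_compose_pair:
  assumes "continuous_on UNIV (\<lambda>(x, y). f x y)" "continuous_on S g" "continuous_on S h"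
  shows "continuous_on S (\<lambda>z. f (g z) (h z))"
  using continuous_on_compose2[OF assms(1) continuous_on_Pair[OF assms(2,3)]] by simp

section \<open>The weighted estimate on segments\<close>

text \<open>With z = sqrt(\<mu>) |a| the integral equals (1 - exp(-z^2)) / (z sqrt(\<mu>)), and 1 -
  exp(-z^2) is at most both z^2 and 1, hence at most z. The point is uniformity in a: short segments
  contribute little by their length, long ones by the decay of the weight.\<close>

lemma integral_exp_weight_le:
  fixes a \<mu> :: real
  assumes \<mu>: "0 < \<mu>"
  shows "integral {0..1} (\<lambda>s. \<bar>a\<bar> * exp (- \<mu> * a\<^sup>2 * s)) \<le> 1 / sqrt \<mu>"
proof (cases "a = 0")
  case True
  then show ?thesis using \<mu> by simp
next
  case False
  define z where "z = sqrt \<mu> * \<bar>a\<bar>"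
  have z: "0 < z" using False \<mu> by (simp add: z_def)
  have z2: "z\<^sup>2 = \<mu> * a\<^sup>2" using \<mu> by (simp add: z_def power_mult_distrib)
  have "((\<lambda>s. \<bar>a\<bar> * exp (- z\<^sup>2 * s)) has_integral
      - (\<bar>a\<bar> / z\<^sup>2) * exp (- z\<^sup>2 * 1) - - (\<bar>a\<bar> / z\<^sup>2) * exp (- z\<^sup>2 * 0)) {0..1}"
  proof (rule fundamental_theorem_of_calculus)
    fix s :: real
    have "((\<lambda>s. - (\<bar>a\<bar> / z\<^sup>2) * exp (- z\<^sup>2 * s)) has_real_derivative \<bar>a\<bar> * exp (- z\<^sup>2 * s)) (at s within {0..1})"
      using z by (auto intro!: derivative_eq_intros simp: field_simps power2_eq_square eval_nat_numeral)
    then show "((\<lambda>s. - (\<bar>a\<bar> / z\<^sup>2) * exp (- z\<^sup>2 * s)) has_vector_derivative \<bar>a\<bar> * exp (- z\<^sup>2 * s)) (at s within {0..1})"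
      by (simp add: has_real_derivative_iff_has_vector_derivative)
  qed simp
  then have "integral {0..1} (\<lambda>s. \<bar>a\<bar> * exp (- z\<^sup>2 * s)) = \<bar>a\<bar> / z\<^sup>2 * (1 - exp (- z\<^sup>2))"
    by (subst integral_unique) (auto simp: algebra_simps)
  then have "integral {0..1} (\<lambda>s. \<bar>a\<bar> * exp (- \<mu> * a\<^sup>2 * s)) = \<bar>a\<bar> / z\<^sup>2 * (1 - exp (- z\<^sup>2))"
    by (simp add: z2)
  also have "\<dots> \<le> \<bar>a\<bar> / z\<^sup>2 * z"
  proof (intro mult_left_mono)
    show "1 - exp (- z\<^sup>2) \<le> z"
    proof (cases "z \<le> 1")
      case True
      have "1 - exp (- z\<^sup>2) \<le> z\<^sup>2" using exp_ge_add_one_self[of "- z\<^sup>2"] by linarith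
      also have "\<dots> \<le> z" using True z by (simp add: power2_eq_square mult_left_le)
      finally show ?thesis .
    next
      case False
      then show ?thesis using exp_gt_zero[of "- z\<^sup>2"] by linarith
    qed
  qed simp
  also have "\<dots> = \<bar>a\<bar> / z" using z by (simp add: power2_eq_square)
  also have "\<dots> = 1 / sqrt \<mu>"
    using False by (simp add: z_def)
  finally show ?thesis .
qed

text \<open>Here y stands for \<open>x - x\<^sub>0\<close>. Expanding the square gives \<open>(norm
  y)\<^sup>2 - 2 * s * a\<^sup>2 + s\<^sup>2 * a\<^sup>2 * (norm \<theta>)\<^sup>2\<close> at the
  integration point, and the last term is at most \<open>s * a\<^sup>2\<close>. So relative to its
  value at y the weight gains the factor exp(- \<mu> a^2 s), and the previous estimate
  applies.\<close>

lemma weighted_ray_integral_le: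
  fixes y \<theta> :: "'a::euclidean_space" and g :: "real \<Rightarrow> real"
  assumes \<mu>: "0 < \<mu>" and \<theta>: "norm \<theta> \<le> 1" and g: "continuous_on {0..1} g" and B: "0 \<le> B"
    and le: "\<And>s. 0 \<le> s \<Longrightarrow> s \<le> 1 \<Longrightarrow> \<bar>g s\<bar> \<le> B * exp (\<mu> * (norm (y - (s * (y \<bullet> \<theta>)) *\<^sub>R \<theta>))\<^sup>2)"
  shows "\<bar>integral {0..1} (\<lambda>s. (y \<bullet> \<theta>) * g s)\<bar> \<le> B * exp (\<mu> * (norm y)\<^sup>2) / sqrt \<mu>"
proof -
  define a where "a = y \<bullet> \<theta>"
  let ?E = "B * exp (\<mu> * (norm y)\<^sup>2)"
  have "norm (integral {0..1} (\<lambda>s. a * g s)) \<le> integral {0..1} (\<lambda>s. ?E * (\<bar>a\<bar> * exp (- \<mu> * a\<^sup>2 * s)))"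
  proof (rule integral_norm_bound_integral)
    show "(\<lambda>s. a * g s) integrable_on {0..1}"
      by (intro integrable_continuous_interval continuous_intros g)
    show "(\<lambda>s. ?E * (\<bar>a\<bar> * exp (- \<mu> * a\<^sup>2 * s))) integrable_on {0..1}"
      by (intro integrable_continuous_interval continuous_intros)
    fix s :: real assume "s \<in> {0..1}"
    then have s: "0 \<le> s" "s \<le> 1" by auto
    have "(norm (y - (s * a) *\<^sub>R \<theta>))\<^sup>2 = (norm y)\<^sup>2 - 2 * s * a\<^sup>2 + s\<^sup>2 * a\<^sup>2 * (norm \<theta>)\<^sup>2"
      unfolding power2_norm_eq_inner a_def
      by (simp add: inner_diff inner_commute power2_eq_square algebra_simps)
    also have "s\<^sup>2 * a\<^sup>2 * (norm \<theta>)\<^sup>2 \<le> s * a\<^sup>2 * 1"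
      using s \<theta> by (intro mult_mono) (auto simp: power2_eq_square mult_left_le abs_square_le_1 mult_le_one)
    finally have n: "(norm (y - (s * a) *\<^sub>R \<theta>))\<^sup>2 \<le> (norm y)\<^sup>2 - s * a\<^sup>2" by simp
    have "\<bar>g s\<bar> \<le> B * exp (\<mu> * (norm (y - (s * a) *\<^sub>R \<theta>))\<^sup>2)" using le[OF s] by (simp add: a_def)
    also have "\<dots> \<le> B * exp (\<mu> * ((norm y)\<^sup>2 - s * a\<^sup>2))"
      using n \<mu> B by (intro mult_left_mono) auto
    also have "\<dots> = ?E * exp (- \<mu> * a\<^sup>2 * s)" by (simp add: exp_add[symmetric] algebra_simps)
    finally show "norm (a * g s) \<le> ?E * (\<bar>a\<bar> * exp (- \<mu> * a\<^sup>2 * s))"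
      using mult_left_mono[of "\<bar>g s\<bar>" _ "\<bar>a\<bar>"] by (simp add: abs_mult mult.left_commute)
  qed
  also have "\<dots> = ?E * integral {0..1} (\<lambda>s. \<bar>a\<bar> * exp (- \<mu> * a\<^sup>2 * s))"
    by (rule integral_mult_right)
  also have "\<dots> \<le> ?E * (1 / sqrt \<mu>)"
    using B by (intro mult_left_mono integral_exp_weight_le \<mu>) auto
  finally show ?thesis by (simp add: a_def)
qed

text \<open>The derivative of v along its ray. The absorption term stays on the right, without an
  integrating factor: the exponential weight absorbs any bounded zero-order term along with the
  scattering.\<close>

definition transport_source ::
    "('a::euclidean_space \<Rightarrow> real) \<Rightarrow> ('a \<Rightarrow> 'a \<Rightarrow> 'a \<Rightarrow> real) \<Rightarrow> ('a \<Rightarrow> 'a \<Rightarrow> real) \<Rightarrow> 'a \<Rightarrow> 'a \<Rightarrow> real" where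
  "transport_source \<sigma> k v x \<theta> = scattering k v x \<theta> - \<sigma> x * v x \<theta>"

lemma continuous_on_transport_source:
  fixes \<sigma> :: "'a::euclidean_space \<Rightarrow> real"
  assumes \<sigma>: "continuous_on UNIV \<sigma>"
    and k: "continuous_on UNIV (\<lambda>(x, \<theta>, \<theta>'). k x \<theta> \<theta>')"
    and v: "continuous_on UNIV (\<lambda>(x, \<theta>). v x \<theta>)"
  shows "continuous_on UNIV (\<lambda>(x, \<theta>). transport_source \<sigma> k v x \<theta>)"
    and "continuous_on UNIV (\<lambda>(x, \<theta>). scattering k v x \<theta>)"
proof -
  have k2: "continuous_on UNIV (\<lambda>z::('a \<times> 'a) \<times> 'a. k (fst (fst z)) (snd (fst z)) (snd z))"
    using continuous_on_compose2[OF k, of UNIV "\<lambda>z::('a \<times> 'a) \<times> 'a. (fst (fst z), snd (fst z), snd z)"]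
    by (simp add: continuous_on_Pair continuous_on_fst continuous_on_snd continuous_on_id)
  have v2: "continuous_on UNIV (\<lambda>z::('a \<times> 'a) \<times> 'a. v (fst (fst z)) (snd z))"
    by (intro continuous_on_compose_pair[OF v] continuous_intros)
  have "continuous_on UNIV (\<lambda>z. \<integral>\<theta>'. k (fst z) (snd z) \<theta>' * v (fst z) \<theta>' \<partial>sphere_measure)"
    by (rule continuous_on_sphere_integral) (use k2 v2 in \<open>auto simp: case_prod_beta' intro!: continuous_on_mult\<close>)
  then show sc: "continuous_on UNIV (\<lambda>(x, \<theta>). scattering k v x \<theta>)"
    by (simp add: scattering_def case_prod_beta')
  have "continuous_on UNIV (\<lambda>z::'a \<times> 'a. \<sigma> (fst z))"
    by (intro continuous_on_compose2[OF \<sigma>] continuous_intros) auto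
  with sc v show "continuous_on UNIV (\<lambda>(x, \<theta>). transport_source \<sigma> k v x \<theta>)"
    by (auto simp: transport_source_def case_prod_beta' intro!: continuous_on_diff continuous_on_mult)
qed

lemma integrable_kernel_mult:
  fixes k :: "'a::euclidean_space \<Rightarrow> 'a \<Rightarrow> 'a \<Rightarrow> real"
  assumes k: "continuous_on UNIV (\<lambda>(x, \<theta>, \<theta>'). k x \<theta> \<theta>')"
    and v: "continuous_on UNIV (\<lambda>(x, \<theta>). v x \<theta>)"
  shows "integrable sphere_measure (\<lambda>\<theta>'. k x \<theta> \<theta>' * v x \<theta>')"
proof (rule integrable_sphere_continuous, rule continuous_on_mult)
  show "continuous_on UNIV (k x \<theta>)"
    using continuous_on_compose2[OF k, of UNIV "\<lambda>\<theta>'. (x, \<theta>, \<theta>')"] by (simp add: continuous_on_Pair)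
  show "continuous_on UNIV (v x)"
    using continuous_on_compose2[OF v, of UNIV "\<lambda>\<theta>'. (x, \<theta>')"] by (simp add: continuous_on_Pair)
qed

definition unit_clip :: "'a::real_normed_vector \<Rightarrow> 'a" where
  "unit_clip \<theta> = \<theta> /\<^sub>R max 1 (norm \<theta>)"

text \<open>The fixed point is sought among functions of all \<open>\<theta>\<close>, not only of unit vectors; clipping keeps
  \<open>|\<theta>| \<le> 1\<close>, which is all that \<open>weighted_ray_integral_le\<close> needs.\<close>

lemma unit_clip:
  shows norm_unit_clip_le: "norm (unit_clip \<theta>) \<le> 1"
    and unit_clip_id: "norm \<theta> \<le> 1 \<Longrightarrow> unit_clip \<theta> = \<theta>"
    and continuous_on_unit_clip: "continuous_on S (unit_clip :: 'a \<Rightarrow> 'a::real_normed_vector)"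
proof -
  show "norm (unit_clip \<theta>) \<le> 1" by (auto simp: unit_clip_def field_simps max_def)
  show "norm \<theta> \<le> 1 \<Longrightarrow> unit_clip \<theta> = \<theta>" by (simp add: unit_clip_def max_absorb1)
  show "continuous_on S (unit_clip :: 'a \<Rightarrow> 'a)"
    unfolding unit_clip_def by (intro continuous_intros) (auto simp: max_def)
qed


text \<open>The scattering term sees v on the whole sphere, through the integral of a majorant
  \<open>H\<close>, while the absorption term sees it only at \<theta>; hence two separate bounds.
  \<open>e\<close> is the weight at x. A constant \<open>H\<close> serves the contraction estimate,
  \<open>H = 2 |h| + I\<close> the invariance of the set of candidates; \<theta> itself may lie off
  the sphere.\<close>

lemma transport_source_bound:
  fixes k :: "'a::euclidean_space \<Rightarrow> 'a \<Rightarrow> 'a \<Rightarrow> real"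
  assumes M: "\<And>x. \<bar>\<sigma> x\<bar> \<le> M" "\<And>x \<theta> \<theta>'. \<bar>k x \<theta> \<theta>'\<bar> \<le> M"
    and k: "continuous_on UNIV (\<lambda>(x, \<theta>, \<theta>'). k x \<theta> \<theta>')"
    and v: "continuous_on UNIV (\<lambda>(x, \<theta>). v x \<theta>)"
    and H: "integrable sphere_measure H" "\<And>\<theta>'. \<theta>' \<in> sphere 0 1 \<Longrightarrow> \<bar>v x \<theta>'\<bar> \<le> e * H \<theta>'"
    and \<theta>: "\<bar>v x \<theta>\<bar> \<le> e * b"
  shows "\<bar>transport_source \<sigma> k v x \<theta>\<bar> \<le> e * (M * ((\<integral>\<theta>'. H \<theta>' \<partial>sphere_measure) + b))"
proof -
  have M0: "0 \<le> M" using M(1)[of x] by linarith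
  have "\<bar>scattering k v x \<theta>\<bar> \<le> (\<integral>\<theta>'. \<bar>k x \<theta> \<theta>' * v x \<theta>'\<bar> \<partial>sphere_measure)"
    unfolding scattering_def by (rule integral_abs_bound)
  also have "\<dots> \<le> (\<integral>\<theta>'. M * (e * H \<theta>') \<partial>sphere_measure)"
  proof (rule integral_mono)
    show "integrable sphere_measure (\<lambda>\<theta>'. \<bar>k x \<theta> \<theta>' * v x \<theta>'\<bar>)"
      by (intro integrable_abs integrable_kernel_mult k v)
    show "integrable sphere_measure (\<lambda>\<theta>'. M * (e * H \<theta>'))"
      by (intro integrable_mult_right H)
    fix \<theta>' :: 'a assume "\<theta>' \<in> space sphere_measure"
    then show "\<bar>k x \<theta> \<theta>' * v x \<theta>'\<bar> \<le> M * (e * H \<theta>')"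
      unfolding abs_mult using M(2) M0 H(2) by (intro mult_mono) auto
  qed
  finally have 1: "\<bar>scattering k v x \<theta>\<bar> \<le> M * (e * (\<integral>\<theta>'. H \<theta>' \<partial>sphere_measure))" by simp
  have 2: "\<bar>\<sigma> x * v x \<theta>\<bar> \<le> M * (e * b)"
    unfolding abs_mult using M(1) M0 \<theta> by (intro mult_mono) auto
  show ?thesis
    using 1 2 unfolding transport_source_def by (simp add: algebra_simps)
qed

text \<open>Banach's theorem in the space of bounded continuous functions, applied to v divided by
  the weight. The fixed point is sought inside a set cut out by a pointwise majorant, so that the
  estimate in the conclusion comes with the solution. The order of quantifiers matters: \<mu> is
  fixed before \<open>x\<^sub>0\<close> and h.\<close>

lemma ray_fixpoint_exists:
  fixes \<sigma> :: "'a::euclidean_space \<Rightarrow> real" and k :: "'a \<Rightarrow> 'a \<Rightarrow> 'a \<Rightarrow> real"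
  assumes \<sigma>: "continuous_on UNIV \<sigma>" and k: "continuous_on UNIV (\<lambda>(x, \<theta>, \<theta>'). k x \<theta> \<theta>')"
    and M: "\<And>x. \<bar>\<sigma> x\<bar> \<le> M" "\<And>x \<theta> \<theta>'. \<bar>k x \<theta> \<theta>'\<bar> \<le> M"
  obtains \<mu> where "0 < \<mu>" and "\<And>x\<^sub>0 h B. continuous_on UNIV h \<Longrightarrow> (\<And>\<theta>. \<bar>h \<theta>\<bar> \<le> B) \<Longrightarrow>
    \<exists>v. continuous_on UNIV (\<lambda>(x, \<theta>). v x \<theta>) \<and>
      (\<forall>x. \<forall>\<theta>\<in>sphere 0 1. \<bar>v x \<theta>\<bar>
         \<le> exp (\<mu> * (norm (x - x\<^sub>0))\<^sup>2) * (2 * \<bar>h \<theta>\<bar> + (\<integral>\<theta>'. \<bar>h \<theta>'\<bar> \<partial>sphere_measure))) \<and>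
      (\<forall>x. \<forall>\<theta>\<in>sphere 0 1. v x \<theta> = h \<theta> + integral {0..1} (\<lambda>s. ((x - x\<^sub>0) \<bullet> \<theta>) *
         transport_source \<sigma> k v (x - (s * ((x - x\<^sub>0) \<bullet> \<theta>)) *\<^sub>R \<theta>) \<theta>))"
proof -
  define S where "S = measure sphere_measure (sphere (0::'a) 1)"
  have S0: "0 \<le> S" by (simp add: S_def)
  have M0: "0 \<le> M" using M(1)[of undefined] by linarith
  \<comment> \<open>\<open>r\<close> is the square root of \<mu>, by which the estimate on segments
    divides. The contraction needs \<open>M * (S + 1) / r \<le> 1 / 2\<close>; mapping the set
    \<open>T\<close> into itself involves M ((2 + S) I + 2 |h| + I), at most M (S + 3) times 2 (|h|
    + I). The summand 1 keeps \<open>r\<close> positive when \<open>M = 0\<close>.\<close>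
  define r where "r = 2 * M * (S + 3) + 1"
  have r: "0 < r" using M0 S0 by (simp add: r_def add_nonneg_pos)
  define \<mu> where "\<mu> = r\<^sup>2"
  have \<mu>: "0 < \<mu>" "sqrt \<mu> = r" using r by (auto simp: \<mu>_def)
  have small: "M * (S + 3) / r \<le> 1 / 2" using r M0 S0 by (simp add: r_def field_simps)
  show ?thesis
  proof (rule that[OF \<mu>(1)])
    fix x\<^sub>0 :: 'a and h :: "'a \<Rightarrow> real" and B :: real
    assume h: "continuous_on UNIV h" and hB: "\<And>\<theta>. \<bar>h \<theta>\<bar> \<le> B"
    define I where "I = (\<integral>\<theta>'. \<bar>h \<theta>'\<bar> \<partial>sphere_measure)"
    have I0: "0 \<le> I" by (simp add: I_def)
    have ih: "integrable sphere_measure (\<lambda>\<theta>'. \<bar>h \<theta>'\<bar>)"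
      by (intro integrable_sphere_continuous continuous_intros h)
    define E where "E x = exp (\<mu> * (norm (x - x\<^sub>0))\<^sup>2)" for x
    have E1: "1 \<le> E x" for x using \<mu> by (simp add: E_def)
    have Epos: "0 < E x" for x using E1[of x] by linarith
    define R where "R u x \<theta> = integral {0..1} (\<lambda>s. ((x - x\<^sub>0) \<bullet> \<theta>) *
         transport_source \<sigma> k u (x - (s * ((x - x\<^sub>0) \<bullet> \<theta>)) *\<^sub>R \<theta>) \<theta>)" for u x \<theta>
    have contE: "continuous_on T (\<lambda>z. E (f z))" if "continuous_on T f" for T :: "'c::topological_space set" and f
      unfolding E_def by (intro continuous_intros that)
    have seg: "continuous_on {0..1} (\<lambda>s. transport_source \<sigma> k u (x - (s * a) *\<^sub>R \<theta>) \<theta>)"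
      if "continuous_on UNIV (\<lambda>(x, \<theta>). u x \<theta>)" for u x a \<theta>
      by (rule continuous_on_compose_pair[OF continuous_on_transport_source(1)[OF \<sigma> k that]])
         (intro continuous_intros)+
    have R_bound: "\<bar>R u x \<theta>\<bar> \<le> b * E x / r"
      if u: "continuous_on UNIV (\<lambda>(x, \<theta>). u x \<theta>)" and \<theta>: "norm \<theta> \<le> 1" and b: "0 \<le> b"
        and le: "\<And>x. \<bar>transport_source \<sigma> k u x \<theta>\<bar> \<le> b * E x" for u x \<theta> b
      unfolding R_def E_def \<mu>(2)[symmetric]
    proof (rule weighted_ray_integral_le[OF \<mu>(1) \<theta> seg[OF u] b])
      fix s :: real
      have eq: "x - x\<^sub>0 - c = x - c - x\<^sub>0" for c by simp
      show "\<bar>transport_source \<sigma> k u (x - (s * ((x - x\<^sub>0) \<bullet> \<theta>)) *\<^sub>R \<theta>) \<theta>\<bar>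
          \<le> b * exp (\<mu> * (norm (x - x\<^sub>0 - (s * ((x - x\<^sub>0) \<bullet> \<theta>)) *\<^sub>R \<theta>))\<^sup>2)"
        unfolding eq by (rule le[unfolded E_def])
    qed
    have R_cont: "continuous_on UNIV (\<lambda>(x, \<theta>). R u x (unit_clip \<theta>))"
      if u: "continuous_on UNIV (\<lambda>(x, \<theta>). u x \<theta>)" for u
    proof -
      have c2: "continuous_on T (\<lambda>z::('a \<times> 'a) \<times> real. unit_clip (snd (fst z)))" for T
        by (rule continuous_on_compose2[OF continuous_on_unit_clip[of UNIV]]) (auto intro!: continuous_intros)
      have "continuous_on (UNIV \<times> cbox 0 1) (\<lambda>(z, s). ((fst z - x\<^sub>0) \<bullet> unit_clip (snd z)) *
         transport_source \<sigma> k u (fst z - (s * ((fst z - x\<^sub>0) \<bullet> unit_clip (snd z))) *\<^sub>R unit_clip (snd z)) (unit_clip (snd z)))"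
        unfolding case_prod_beta'
        by (intro continuous_on_mult continuous_on_compose_pair[OF continuous_on_transport_source(1)[OF \<sigma> k u]]
            continuous_on_inner continuous_on_diff continuous_on_scaleR c2 continuous_intros)
      then have "continuous_on UNIV (\<lambda>z. integral (cbox 0 1) (\<lambda>s. ((fst z - x\<^sub>0) \<bullet> unit_clip (snd z)) *
         transport_source \<sigma> k u (fst z - (s * ((fst z - x\<^sub>0) \<bullet> unit_clip (snd z))) *\<^sub>R unit_clip (snd z)) (unit_clip (snd z))))"
        by (rule integral_continuous_on_param)
      then show ?thesis by (simp add: R_def case_prod_beta')
    qed
    \<comment> \<open>The unknown \<open>U\<close> is the solution divided by the weight, so that
      the sup norm of \<open>U\<close> is the weighted norm of \<open>W U\<close>.\<close>
    define W where "W U x \<theta> = E x * apply_bcontfun U (x, \<theta>)" for U :: "('a \<times> 'a) \<Rightarrow>\<^sub>C real" and x \<theta>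
    have Wc: "continuous_on UNIV (\<lambda>(x, \<theta>). W U x \<theta>)" for U
      unfolding W_def case_prod_beta' by (intro continuous_intros contE) auto
    \<comment> \<open>The majorant keeps |h| at the individual direction instead of its supremum,
      which is what later yields an \<open>L\<^sup>p\<close> bound. It must contain
      \<open>I\<close>, because scattering feeds every direction with the mean of |h|, and twice
      |h|: once for h itself and once for the correction, which is at most |h| + I.\<close>
    define T :: "(('a \<times> 'a) \<Rightarrow>\<^sub>C real) set" where "T = PiC UNIV (\<lambda>z::'a \<times> 'a. cball 0 (2 * \<bar>h (unit_clip (snd z))\<bar> + I))"
    have T_iff: "U \<in> T \<longleftrightarrow> (\<forall>x \<theta>. \<bar>apply_bcontfun U (x, \<theta>)\<bar> \<le> 2 * \<bar>h (unit_clip \<theta>)\<bar> + I)" for U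
      by (auto simp: T_def mem_PiC_iff Pi_iff)
    have W_T: "\<bar>W U x \<theta>\<bar> \<le> E x * (2 * \<bar>h (unit_clip \<theta>)\<bar> + I)" if "U \<in> T" for U x \<theta>
    proof -
      have "\<bar>apply_bcontfun U (x, \<theta>)\<bar> \<le> 2 * \<bar>h (unit_clip \<theta>)\<bar> + I" using that unfolding T_iff by blast
      then show ?thesis using Epos[of x] by (simp add: W_def abs_mult)
    qed
    define G where "G U = (\<lambda>(x, \<theta>). (h (unit_clip \<theta>) + R (W U) x (unit_clip \<theta>)) / E x)" for U
    have sphere_clip: "unit_clip \<theta> = \<theta>" if "\<theta> \<in> sphere 0 1" for \<theta> :: 'a
      using that by (simp add: unit_clip_id)
    have clip_clip: "unit_clip (unit_clip \<theta>) = unit_clip \<theta>" for \<theta> :: 'a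
      by (simp add: unit_clip_id norm_unit_clip_le)
    have R_dist: "\<bar>R (W U) x \<theta> - R (W V) x \<theta>\<bar> \<le> dist U V / 2 * E x" if \<theta>: "norm \<theta> \<le> 1" for U V x \<theta>
    proof -
      have s: "transport_source \<sigma> k (W U) y \<theta> - transport_source \<sigma> k (W V) y \<theta>
          = transport_source \<sigma> k (\<lambda>x \<theta>. W U x \<theta> - W V x \<theta>) y \<theta>" for y
      proof -
        have "scattering k (W U) y \<theta> - scattering k (W V) y \<theta> = scattering k (\<lambda>x \<theta>. W U x \<theta> - W V x \<theta>) y \<theta>"
          unfolding scattering_def right_diff_distrib
          by (rule Bochner_Integration.integral_diff[symmetric]; rule integrable_kernel_mult[OF k Wc])
        then show ?thesis by (simp add: transport_source_def algebra_simps)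
      qed
      have Dc: "continuous_on UNIV (\<lambda>(x, \<theta>). W U x \<theta> - W V x \<theta>)"
        using continuous_on_diff[OF Wc[of U] Wc[of V]] by (simp add: case_prod_beta')
      have eq: "R (W U) x \<theta> - R (W V) x \<theta> = R (\<lambda>x \<theta>. W U x \<theta> - W V x \<theta>) x \<theta>"
        unfolding R_def s[symmetric] right_diff_distrib
        by (rule Henstock_Kurzweil_Integration.integral_diff[symmetric];
            intro integrable_continuous_interval continuous_intros seg Wc)
      have D: "\<bar>W U y \<theta>' - W V y \<theta>'\<bar> \<le> E y * dist U V" for y \<theta>'
        using dist_bounded[of U "(y, \<theta>')" V] Epos[of y]
        by (simp add: W_def right_diff_distrib[symmetric] abs_mult dist_real_def)
      have "\<bar>R (\<lambda>x \<theta>. W U x \<theta> - W V x \<theta>) x \<theta>\<bar> \<le> (M * ((S + 1) * dist U V)) * E x / r"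
      proof (rule R_bound[OF Dc \<theta>])
        fix y
        have "\<bar>transport_source \<sigma> k (\<lambda>x \<theta>. W U x \<theta> - W V x \<theta>) y \<theta>\<bar>
            \<le> E y * (M * (integral\<^sup>L sphere_measure (\<lambda>\<theta>'::'a. dist U V) + dist U V))"
          by (rule transport_source_bound[OF M k Dc]) (use D in auto)
        then show "\<bar>transport_source \<sigma> k (\<lambda>x \<theta>. W U x \<theta> - W V x \<theta>) y \<theta>\<bar> \<le> (M * ((S + 1) * dist U V)) * E y"
          by (simp add: S_def algebra_simps)
      qed (use M0 S0 in auto)
      also have "\<dots> = (M * (S + 1) / r) * (dist U V * E x)" by simp
      also have "\<dots> \<le> (1 / 2) * (dist U V * E x)"
      proof (rule mult_right_mono)
        have "M * (S + 1) / r \<le> M * (S + 3) / r" using M0 r by (intro divide_right_mono mult_left_mono) auto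
        then show "M * (S + 1) / r \<le> 1 / 2" using small by linarith
      qed (use less_imp_le[OF Epos[of x]] in simp)
      finally show ?thesis by (simp add: eq)
    qed
    have R_T: "\<bar>R (W U) x (unit_clip \<theta>)\<bar> \<le> (\<bar>h (unit_clip \<theta>)\<bar> + I) * E x" if U: "U \<in> T" for U x \<theta>
    proof -
      let ?b = "2 * \<bar>h (unit_clip \<theta>)\<bar> + I"
      have "\<bar>R (W U) x (unit_clip \<theta>)\<bar> \<le> (M * ((2 + S) * I + ?b)) * E x / r"
      proof (rule R_bound[OF Wc norm_unit_clip_le])
        fix y
        have "\<bar>transport_source \<sigma> k (W U) y (unit_clip \<theta>)\<bar>
          \<le> E y * (M * ((\<integral>\<theta>'. 2 * \<bar>h \<theta>'\<bar> + I \<partial>sphere_measure) + ?b))"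
        proof (rule transport_source_bound[OF M k Wc])
          show "\<bar>W U y \<theta>'\<bar> \<le> E y * (2 * \<bar>h \<theta>'\<bar> + I)" if "\<theta>' \<in> sphere 0 1" for \<theta>'
            using W_T[OF U, of y \<theta>'] by (simp add: sphere_clip[OF that])
          show "\<bar>W U y (unit_clip \<theta>)\<bar> \<le> E y * ?b"
            using W_T[OF U, of y "unit_clip \<theta>"] by (simp add: clip_clip)
        qed (use ih in auto)
        also have "(\<integral>\<theta>'. 2 * \<bar>h \<theta>'\<bar> + I \<partial>sphere_measure) = (2 + S) * I"
          using ih by (simp add: S_def I_def algebra_simps)
        finally show "\<bar>transport_source \<sigma> k (W U) y (unit_clip \<theta>)\<bar> \<le> (M * ((2 + S) * I + ?b)) * E y"
          by (simp add: mult.commute)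
      qed (use M0 S0 I0 in auto)
      also have "\<dots> \<le> (M * ((S + 3) * (2 * (\<bar>h (unit_clip \<theta>)\<bar> + I)))) * E x / r"
        using M0 S0 I0 Epos[of x] r
        by (intro divide_right_mono mult_right_mono mult_left_mono) (auto simp: algebra_simps intro: less_imp_le)
      also have "\<dots> = (M * (S + 3) / r) * (2 * (\<bar>h (unit_clip \<theta>)\<bar> + I) * E x)" by simp
      also have "\<dots> \<le> (1 / 2) * (2 * (\<bar>h (unit_clip \<theta>)\<bar> + I) * E x)"
        using I0 Epos[of x] by (intro mult_right_mono small) auto
      finally show ?thesis by (simp add: algebra_simps)
    qed
    have hc: "continuous_on UNIV (\<lambda>z::'a \<times> 'a. h (unit_clip (snd z)))"
      by (intro continuous_on_compose2[OF h] continuous_on_compose2[OF continuous_on_unit_clip[of UNIV]] continuous_intros) auto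
    have GT: "\<bar>G U (x, \<theta>)\<bar> \<le> 2 * \<bar>h (unit_clip \<theta>)\<bar> + I" if U: "U \<in> T" for U x \<theta>
    proof -
      have "\<bar>h (unit_clip \<theta>) + R (W U) x (unit_clip \<theta>)\<bar>
          \<le> \<bar>h (unit_clip \<theta>)\<bar> * E x + (\<bar>h (unit_clip \<theta>)\<bar> + I) * E x"
        using R_T[OF U, of x \<theta>] mult_left_mono[OF E1[of x], of "\<bar>h (unit_clip \<theta>)\<bar>"] by linarith
      then show ?thesis
        using Epos[of x] by (simp add: G_def field_simps)
    qed
    have Gc: "continuous_on UNIV (G U)" for U
      unfolding G_def case_prod_beta'
      using R_cont[OF Wc[of U]] hc Epos
      by (intro continuous_on_divide continuous_on_add contE continuous_intros)
         (auto simp: case_prod_beta' less_imp_neq[THEN not_sym])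
    have Gb: "G U \<in> bcontfun" if "U \<in> T" for U
    proof (rule bcontfun_normI[OF Gc])
      fix z show "norm (G U z) \<le> 2 * B + I"
        using GT[OF that, of "fst z" "snd z"] hB[of "unit_clip (snd z)"] by simp
    qed
    define F where "F U = Bcontfun (G U)" for U
    have F: "apply_bcontfun (F U) = G U" if "U \<in> T" for U
      unfolding F_def by (rule Bcontfun_inverse[OF Gb[OF that]])
    have "\<exists>!U\<in>T. F U = U"
    proof (rule Banach_fix[where c="1/2"])
      show "complete T" unfolding complete_eq_closed T_def by (rule closed_PiC) auto
      have "0 \<in> T" using I0 by (simp add: T_iff)
      then show "T \<noteq> {}" by blast
      show "F ` T \<subseteq> T" using GT by (auto simp: T_iff[of "F _"] F)
      fix U V assume UV: "U \<in> T" "V \<in> T"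
      show "dist (F U) (F V) \<le> 1 / 2 * dist U V"
      proof (rule dist_bound)
        fix z :: "'a \<times> 'a"
        obtain x \<theta> where z: "z = (x, \<theta>)" by (cases z)
        have "dist (F U z) (F V z) = \<bar>R (W U) x (unit_clip \<theta>) - R (W V) x (unit_clip \<theta>)\<bar> / E x"
          using Epos[of x] UV by (simp add: F z G_def dist_real_def diff_divide_distrib[symmetric])
        also have "\<dots> \<le> (dist U V / 2 * E x) / E x"
          using Epos[of x] by (intro divide_right_mono R_dist norm_unit_clip_le) auto
        finally show "dist (F U z) (F V z) \<le> 1 / 2 * dist U V"
          using Epos[of x] by simp
      qed
    qed auto
    then obtain U where U: "U \<in> T" "F U = U" by blast
    have fixpt: "W U x \<theta> = h \<theta> + R (W U) x \<theta>" if "\<theta> \<in> sphere 0 1" for x \<theta>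
    proof -
      have "apply_bcontfun U (x, \<theta>) = G U (x, \<theta>)" using F[OF U(1)] U(2) by simp
      then show ?thesis using Epos[of x] sphere_clip[OF that] by (simp add: W_def G_def)
    qed
    show "\<exists>v. continuous_on UNIV (\<lambda>(x, \<theta>). v x \<theta>) \<and>
      (\<forall>x. \<forall>\<theta>\<in>sphere 0 1. \<bar>v x \<theta>\<bar>
         \<le> exp (\<mu> * (norm (x - x\<^sub>0))\<^sup>2) * (2 * \<bar>h \<theta>\<bar> + (\<integral>\<theta>'. \<bar>h \<theta>'\<bar> \<partial>sphere_measure))) \<and>
      (\<forall>x. \<forall>\<theta>\<in>sphere 0 1. v x \<theta> = h \<theta> + integral {0..1} (\<lambda>s. ((x - x\<^sub>0) \<bullet> \<theta>) *
         transport_source \<sigma> k v (x - (s * ((x - x\<^sub>0) \<bullet> \<theta>)) *\<^sub>R \<theta>) \<theta>))"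
    proof (intro exI[of _ "W U"] conjI allI ballI Wc)
      fix x \<theta> :: 'a assume \<theta>: "\<theta> \<in> sphere 0 1"
      show "\<bar>W U x \<theta>\<bar> \<le> exp (\<mu> * (norm (x - x\<^sub>0))\<^sup>2) * (2 * \<bar>h \<theta>\<bar> + (\<integral>\<theta>'. \<bar>h \<theta>'\<bar> \<partial>sphere_measure))"
        using W_T[OF U(1), of x \<theta>] by (simp add: sphere_clip[OF \<theta>] E_def I_def)
    qed (use fixpt in \<open>auto simp: R_def\<close>)
  qed
qed


section \<open>Differentiation along rays\<close>

text \<open>Integration over the fixed interval \<open>{0..1}\<close> treats both sides of the
  hyperplane alike and makes continuity in (x, \<theta>) immediate; to differentiate along a ray it
  has to be read as a difference of one antiderivative. \<tau> may be negative, hence the oriented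
  integral in the construction of \<open>\<Phi>\<close>.\<close>

lemma line_integral_substitution:
  fixes \<phi> :: "real \<Rightarrow> real"
  assumes "continuous_on UNIV \<phi>"
  obtains \<Phi> where "\<And>t. (\<Phi> has_real_derivative \<phi> t) (at t)"
    and "\<And>\<tau>. integral {0..1} (\<lambda>s. \<tau> * \<phi> ((1 - s) * \<tau>)) = \<Phi> \<tau> - \<Phi> 0"
proof -
  obtain \<Phi> where \<Phi>: "\<And>t. (\<Phi> has_real_derivative \<phi> t) (at t)"
  proof -
    define \<Phi> where "\<Phi> t = (LBINT s=0..ereal t. \<phi> s)" for t
    have "(\<Phi> has_real_derivative \<phi> t) (at t)" for t
    proof -
      have "((\<lambda>u. LBINT y=0..u. \<phi> y) has_vector_derivative \<phi> t) (at t within {-\<bar>t\<bar>-1..\<bar>t\<bar>+1})"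
        using interval_integral_FTC2[of "-\<bar>t\<bar>-1" 0 "\<bar>t\<bar>+1" \<phi> t] continuous_on_subset[OF assms]
        by (auto simp: zero_ereal_def)
      then have "((\<lambda>u. LBINT y=0..u. \<phi> y) has_vector_derivative \<phi> t) (at t within {-\<bar>t\<bar>-1<..<\<bar>t\<bar>+1})"
        by (rule has_vector_derivative_within_subset) auto
      then have "((\<lambda>u. LBINT y=0..u. \<phi> y) has_vector_derivative \<phi> t) (at t)"
        by (subst (asm) has_vector_derivative_within_open) auto
      then show ?thesis
        by (simp add: \<Phi>_def[abs_def] has_real_derivative_iff_has_vector_derivative)
    qed
    then show thesis by (rule that)
  qed
  show thesis
  proof (rule that[OF \<Phi>])
    fix \<tau> :: real
    have "((\<lambda>s. \<tau> * \<phi> ((1 - s) * \<tau>)) has_integral - \<Phi> ((1 - 1) * \<tau>) - - \<Phi> ((1 - 0) * \<tau>)) {0..1}"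
    proof (rule fundamental_theorem_of_calculus)
      fix s :: real
      have "((\<lambda>s. - \<Phi> ((1 - s) * \<tau>)) has_real_derivative \<tau> * \<phi> ((1 - s) * \<tau>)) (at s within {0..1})"
        by (auto intro!: derivative_eq_intros DERIV_chain2[OF \<Phi>])
      then show "((\<lambda>s. - \<Phi> ((1 - s) * \<tau>)) has_vector_derivative \<tau> * \<phi> ((1 - s) * \<tau>)) (at s within {0..1})"
        by (simp add: has_real_derivative_iff_has_vector_derivative)
    qed simp
    then show "integral {0..1} (\<lambda>s. \<tau> * \<phi> ((1 - s) * \<tau>)) = \<Phi> \<tau> - \<Phi> 0"
      by (intro integral_unique) simp
  qed
qed

text \<open>All points \<open>x + t *\<^sub>R \<theta>\<close> have the same foot \<open>z\<close>
  on the hyperplane, and their signed distance to it is \<open>a + t\<close>. So on the line the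
  integral equation reads c + \<Phi>(a + t) - \<Phi>(0), with one antiderivative \<Phi> of the
  source along the line.\<close>

lemma ray_fixpoint_has_derivative:
  fixes f v :: "'a::euclidean_space \<Rightarrow> 'a \<Rightarrow> real"
  assumes \<theta>: "\<theta> \<in> sphere 0 1" and f: "continuous_on UNIV (\<lambda>x. f x \<theta>)"
    and eq: "\<And>x. v x \<theta> = c + integral {0..1} (\<lambda>s. ((x - x\<^sub>0) \<bullet> \<theta>) * f (x - (s * ((x - x\<^sub>0) \<bullet> \<theta>)) *\<^sub>R \<theta>) \<theta>)"
  shows "((\<lambda>t. v (x + t *\<^sub>R \<theta>) \<theta>) has_real_derivative f (x + t *\<^sub>R \<theta>) \<theta>) (at t)"
proof -
  have \<theta>\<theta>: "\<theta> \<bullet> \<theta> = 1" using \<theta> by (simp add: dot_square_norm)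
  define a where "a = (x - x\<^sub>0) \<bullet> \<theta>"
  define z where "z = x - a *\<^sub>R \<theta>"
  define \<phi> where "\<phi> \<tau> = f (z + \<tau> *\<^sub>R \<theta>) \<theta>" for \<tau>
  have "continuous_on UNIV \<phi>"
    unfolding \<phi>_def by (rule continuous_on_compose2[OF f]) (auto intro!: continuous_intros)
  then obtain \<Phi> where \<Phi>: "\<And>t. (\<Phi> has_real_derivative \<phi> t) (at t)"
    and sub: "\<And>\<tau>. integral {0..1} (\<lambda>s. \<tau> * \<phi> ((1 - s) * \<tau>)) = \<Phi> \<tau> - \<Phi> 0"
    using line_integral_substitution by blast
  have v: "v (x + t *\<^sub>R \<theta>) \<theta> = c + (\<Phi> (a + t) - \<Phi> 0)" for t
  proof -
    have at: "(x + t *\<^sub>R \<theta> - x\<^sub>0) \<bullet> \<theta> = a + t"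
      by (simp add: a_def inner_diff_left inner_add_left \<theta>\<theta>)
    have "x + t *\<^sub>R \<theta> - (s * (a + t)) *\<^sub>R \<theta> = z + ((1 - s) * (a + t)) *\<^sub>R \<theta>" for s
      by (simp add: z_def algebra_simps)
    then show ?thesis
      unfolding eq at sub[symmetric] \<phi>_def by simp
  qed
  have "((\<lambda>t. c + (\<Phi> (a + t) - \<Phi> 0)) has_real_derivative \<phi> (a + t)) (at t)"
    by (auto intro!: derivative_eq_intros DERIV_chain2[OF \<Phi>])
  moreover have "\<phi> (a + t) = f (x + t *\<^sub>R \<theta>) \<theta>" by (simp add: \<phi>_def z_def algebra_simps)
  ultimately show ?thesis by (simp add: v)
qed

section \<open>Test functions and the weak equation\<close>

lemma nn_integral_lborel_translate:
  fixes f :: "'a::euclidean_space \<Rightarrow> ennreal"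
  assumes "f \<in> borel_measurable borel"
  shows "(\<integral>\<^sup>+x. f (x + c) \<partial>lborel) = (\<integral>\<^sup>+x. f x \<partial>lborel)"
  using nn_integral_distr[of "(+) c" lborel borel f] assms by (simp add: lborel_distr_plus add.commute)

lemma integral_lborel_translate:
  fixes f :: "'a::euclidean_space \<Rightarrow> real"
  assumes "f \<in> borel_measurable borel"
  shows "(\<integral>x. f (x + c) \<partial>lborel) = (\<integral>x. f x \<partial>lborel)"
  using integral_distr[of "(+) c" lborel borel f] assms by (simp add: lborel_distr_plus add.commute)

lemma integrable_lborel_translate:
  fixes f :: "'a::euclidean_space \<Rightarrow> real"
  assumes "integrable lborel f"
  shows "integrable lborel (\<lambda>x. f (x + c))"
proof -
  have "integrable (distr lborel borel ((+) c)) f" using assms by (simp add: lborel_distr_plus)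
  then have "integrable lborel (\<lambda>x. f (c + x))" 
    using borel_measurable_integrable[OF assms] by (subst (asm) integrable_distr_eq) auto
  then show ?thesis by (simp add: add.commute)
qed

lemma AE_lborel_translate:
  fixes P :: "'a::euclidean_space \<Rightarrow> bool"
  assumes "AE x in lborel. P x"
  shows "AE x in lborel. P (x + c)"
proof -
  have "AE x in distr lborel borel ((+) c). P x" by (subst lborel_distr_plus) (rule assms)
  then have "AE x in lborel. P (c + x)" by (rule AE_distrD[rotated]) simp
  then show ?thesis by (simp add: add.commute)
qed

lemma has_real_derivative_lebesgue_integral:
  fixes F :: "real \<Rightarrow> 'b \<Rightarrow> real"
  assumes int: "\<And>t. integrable M (F t)"
    and F': "F' t\<^sub>0 \<in> borel_measurable M"
    and der: "\<And>t x. x \<in> space M \<Longrightarrow> ((\<lambda>t. F t x) has_real_derivative F' t x) (at t)"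
    and G: "integrable M G" "\<And>t x. x \<in> space M \<Longrightarrow> \<bar>t - t\<^sub>0\<bar> \<le> 1 \<Longrightarrow> \<bar>F' t x\<bar> \<le> G x"
  shows "((\<lambda>t. \<integral>x. F t x \<partial>M) has_real_derivative (\<integral>x. F' t\<^sub>0 x \<partial>M)) (at t\<^sub>0)"
  unfolding DERIV_def tendsto_at_iff_sequentially comp_def
proof (intro allI impI)
  fix X :: "nat \<Rightarrow> real" assume X: "\<forall>i. X i \<in> UNIV - {0}" "X \<longlonglongrightarrow> 0"
  obtain N where N: "\<And>i. N \<le> i \<Longrightarrow> \<bar>X i\<bar> < 1"
    using LIMSEQ_D[OF X(2), of 1] by auto
  let ?D = "\<lambda>i x. (F (t\<^sub>0 + X i) x - F t\<^sub>0 x) / X i"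
  have eq: "(\<integral>x. ?D i x \<partial>M) = ((\<integral>x. F (t\<^sub>0 + X i) x \<partial>M) - (\<integral>x. F t\<^sub>0 x \<partial>M)) / X i" for i
    using int by simp
  \<comment> \<open>Dropping the first \<open>N\<close> terms keeps \<open>t\<^sub>0 + X i\<close>
    in the unit neighbourhood of \<open>t\<^sub>0\<close>, where \<open>G\<close> dominates the
    derivative and, by the mean value inequality, the difference quotients.\<close>
  have "(\<lambda>i. \<integral>x. ?D (i + N) x \<partial>M) \<longlonglongrightarrow> (\<integral>x. F' t\<^sub>0 x \<partial>M)"
  proof (rule integral_dominated_convergence[OF F' _ G(1)])
    show "?D (i + N) \<in> borel_measurable M" for i
      using int[THEN borel_measurable_integrable] by measurable
    show "AE x in M. (\<lambda>i. ?D (i + N) x) \<longlonglongrightarrow> F' t\<^sub>0 x"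
    proof (rule AE_I2)
      fix x assume "x \<in> space M"
      from der[OF this, of t\<^sub>0] have "(\<lambda>i. ?D i x) \<longlonglongrightarrow> F' t\<^sub>0 x"
        using X unfolding DERIV_def tendsto_at_iff_sequentially comp_def by blast
      then show "(\<lambda>i. ?D (i + N) x) \<longlonglongrightarrow> F' t\<^sub>0 x" by (rule LIMSEQ_ignore_initial_segment)
    qed
    show "AE x in M. norm (?D (i + N) x) \<le> G x" for i
    proof (rule AE_I2)
      fix x assume x: "x \<in> space M"
      let ?h = "X (i + N)"
      have h: "\<bar>?h\<bar> < 1" "?h \<noteq> 0" using N[of "i + N"] X(1) by auto
      have "norm (F (t\<^sub>0 + ?h) x - F t\<^sub>0 x) \<le> G x * norm (t\<^sub>0 + ?h - t\<^sub>0)"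
      proof (rule field_differentiable_bound[of "cball t\<^sub>0 1" _ "\<lambda>t. F' t x"])
        fix t assume "t \<in> cball t\<^sub>0 1"
        then show "((\<lambda>a. F a x) has_real_derivative F' t x) (at t within cball t\<^sub>0 1)" "norm (F' t x) \<le> G x"
          using G(2)[OF x, of t] der[OF x, of t] by (auto simp: dist_real_def has_field_derivative_at_within)
      qed (use h in \<open>auto simp: dist_real_def\<close>)
      then show "norm (?D (i + N) x) \<le> G x"
        using h by (simp add: field_simps)
    qed
  qed
  then have "(\<lambda>i. \<integral>x. ?D i x \<partial>M) \<longlonglongrightarrow> (\<integral>x. F' t\<^sub>0 x \<partial>M)" by (rule LIMSEQ_offset)
  then show "(\<lambda>i. ((\<integral>x. F (t\<^sub>0 + X i) x \<partial>M) - (\<integral>x. F t\<^sub>0 x \<partial>M)) / X i) \<longlonglongrightarrow> (\<integral>x. F' t\<^sub>0 x \<partial>M)"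
    unfolding eq .
qed

text \<open>Trades the recursive definition for an explicit derivative as witness, so that closure
  properties follow from the rules for \<open>has_derivative\<close>.\<close>

lemma Ck_on_1_iff:
  fixes \<psi> :: "'a::euclidean_space \<Rightarrow> real"
  shows "Ck_on 1 UNIV \<psi> \<longleftrightarrow>
    (\<exists>D. (\<forall>x. (\<psi> has_derivative D x) (at x)) \<and> (\<forall>v. continuous_on UNIV (\<lambda>x. D x v)))" (is "_ \<longleftrightarrow> ?R")
proof
  assume "Ck_on 1 UNIV \<psi>"
  then show ?R
    by (intro exI[of _ "\<lambda>x. frechet_derivative \<psi> (at x)"])
       (auto simp: differentiable_on_def frechet_derivative_works[symmetric])
next
  assume ?R
  then obtain D where D: "\<And>x. (\<psi> has_derivative D x) (at x)" "\<And>v. continuous_on UNIV (\<lambda>x. D x v)" by blast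
  then have "frechet_derivative \<psi> (at x) = D x" for x by (simp add: frechet_derivative_at[symmetric])
  with D show "Ck_on 1 UNIV \<psi>" by (auto simp: differentiable_on_def intro: differentiableI)
qed

lemma Ck_on_1_translate:
  fixes \<psi> :: "'a::euclidean_space \<Rightarrow> real"
  assumes "Ck_on 1 UNIV \<psi>"
  shows "Ck_on 1 UNIV (\<lambda>x. \<psi> (x + c))" "frechet_derivative (\<lambda>x. \<psi> (x + c)) (at x) = frechet_derivative \<psi> (at (x + c))"
proof -
  obtain D where D: "\<And>x. (\<psi> has_derivative D x) (at x)" "\<And>v. continuous_on UNIV (\<lambda>x. D x v)"
    using assms unfolding Ck_on_1_iff by blast
  have D': "((\<lambda>x. \<psi> (x + c)) has_derivative D (x + c)) (at x)" for x
    by (rule has_derivative_compose[of "\<lambda>x. x + c" "\<lambda>h. h", OF _ D(1)]) (auto intro!: derivative_eq_intros)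
  moreover have "continuous_on UNIV (\<lambda>x. D (x + c) v)" for v
    by (rule continuous_on_compose2[OF D(2)]) (auto intro!: continuous_intros)
  ultimately show "Ck_on 1 UNIV (\<lambda>x. \<psi> (x + c))" 
    unfolding Ck_on_1_iff by (intro exI[of _ "\<lambda>x. D (x + c)"]) auto
  show "frechet_derivative (\<lambda>x. \<psi> (x + c)) (at x) = frechet_derivative \<psi> (at (x + c))"
    using frechet_derivative_at[OF D'] frechet_derivative_at[OF D(1)] by metis
qed

lemma Ck_on_1_const: "Ck_on 1 UNIV (\<lambda>x. c)"
  unfolding Ck_on_1_iff by (rule exI[of _ "\<lambda>_ _. 0"]) auto

lemma Ck_on_1_mult:
  assumes "Ck_on 1 UNIV f" "Ck_on 1 UNIV g"
  shows "Ck_on 1 UNIV (\<lambda>x. f x * g x)"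
proof -
  obtain D where D: "\<And>x. (f has_derivative D x) (at x)" "\<And>v. continuous_on UNIV (\<lambda>x. D x v)"
    using assms(1) unfolding Ck_on_1_iff by blast
  obtain E where E: "\<And>x. (g has_derivative E x) (at x)" "\<And>v. continuous_on UNIV (\<lambda>x. E x v)"
    using assms(2) unfolding Ck_on_1_iff by blast
  have c: "continuous_on UNIV f" "continuous_on UNIV g"
    by (auto intro!: continuous_at_imp_continuous_on has_derivative_continuous[OF D(1)] has_derivative_continuous[OF E(1)])
  show ?thesis unfolding Ck_on_1_iff
    by (rule exI[of _ "\<lambda>x h. f x * E x h + D x h * g x"])
       (auto intro!: has_derivative_mult D E continuous_intros c)
qed

lemma Ck_on_1_prod:
  "finite I \<Longrightarrow> (\<And>i. i \<in> I \<Longrightarrow> Ck_on 1 UNIV (f i)) \<Longrightarrow> Ck_on 1 UNIV (\<lambda>x. \<Prod>i\<in>I. f i x)"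
  by (induction I rule: finite_induct) (auto simp del: One_nat_def intro: Ck_on_1_const Ck_on_1_mult)

lemma Ck_on_1_compose_affine:
  fixes b :: "'a::euclidean_space"
  assumes "\<And>t. (\<beta> has_real_derivative \<beta>' t) (at t)" "continuous_on UNIV \<beta>'"
  shows "Ck_on 1 UNIV (\<lambda>x. \<beta> (x \<bullet> b + c))"
  unfolding Ck_on_1_iff
proof (intro exI[of _ "\<lambda>x h. \<beta>' (x \<bullet> b + c) * (h \<bullet> b)"] conjI allI)
  fix x v :: 'a
  have "((\<lambda>x. x \<bullet> b + c) has_derivative (\<lambda>h. h \<bullet> b)) (at x)"
    by (auto intro!: derivative_eq_intros)
  then show "((\<lambda>x. \<beta> (x \<bullet> b + c)) has_derivative (\<lambda>h. \<beta>' (x \<bullet> b + c) * (h \<bullet> b))) (at x)"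
    using has_derivative_compose[of "\<lambda>x. x \<bullet> b + c" "\<lambda>h. h \<bullet> b" x UNIV \<beta> "(*) (\<beta>' (x \<bullet> b + c))"] assms(1)
    by (simp add: has_field_derivative_def)
  show "continuous_on UNIV (\<lambda>x. \<beta>' (x \<bullet> b + c) * (v \<bullet> b))"
    by (intro continuous_on_mult continuous_on_compose2[OF assms(2)] continuous_intros) auto
qed

lemma Ck_on_1_along_line:
  fixes \<psi> :: "'a::euclidean_space \<Rightarrow> real"
  assumes "Ck_on 1 UNIV \<psi>"
  shows "continuous_on UNIV \<psi>" "continuous_on UNIV (\<lambda>x. frechet_derivative \<psi> (at x) v)"
    and "((\<lambda>t. \<psi> (x + t *\<^sub>R v)) has_real_derivative frechet_derivative \<psi> (at (x + t *\<^sub>R v)) v) (at t)"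
    and "((\<lambda>t. \<psi> (x - t *\<^sub>R v)) has_real_derivative - frechet_derivative \<psi> (at (x - t *\<^sub>R v)) v) (at t)"
proof -
  obtain D where D: "\<And>x. (\<psi> has_derivative D x) (at x)" "\<And>v. continuous_on UNIV (\<lambda>x. D x v)"
    using assms unfolding Ck_on_1_iff by blast
  then have fd: "frechet_derivative \<psi> (at x) = D x" for x by (simp add: frechet_derivative_at[symmetric])
  show "continuous_on UNIV \<psi>"
    by (auto intro!: continuous_at_imp_continuous_on has_derivative_continuous[OF D(1)])
  show "continuous_on UNIV (\<lambda>x. frechet_derivative \<psi> (at x) v)" using D(2) by (simp add: fd)
  have *: "((\<lambda>t. \<psi> (x + (c * t) *\<^sub>R v)) has_real_derivative c * D (x + (c * t) *\<^sub>R v) v) (at t)" for c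
  proof -
    have "((\<lambda>t. x + (c * t) *\<^sub>R v) has_derivative (\<lambda>h. (c * h) *\<^sub>R v)) (at t)"
      by (auto intro!: derivative_eq_intros)
    then have "((\<lambda>t. \<psi> (x + (c * t) *\<^sub>R v)) has_derivative (\<lambda>h. D (x + (c * t) *\<^sub>R v) ((c * h) *\<^sub>R v))) (at t)"
      by (rule has_derivative_compose) (rule D(1))
    moreover have "D (x + (c * t) *\<^sub>R v) ((c * h) *\<^sub>R v) = c * D (x + (c * t) *\<^sub>R v) v * h" for h
      using linear_scale[OF has_derivative_linear[OF D(1)]] by simp
    ultimately show ?thesis by (simp add: has_field_derivative_def)
  qed
  show "((\<lambda>t. \<psi> (x + t *\<^sub>R v)) has_real_derivative frechet_derivative \<psi> (at (x + t *\<^sub>R v)) v) (at t)"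
    using *[of 1] by (simp add: fd)
  show "((\<lambda>t. \<psi> (x - t *\<^sub>R v)) has_real_derivative - frechet_derivative \<psi> (at (x - t *\<^sub>R v)) v) (at t)"
    using *[of "-1"] by (simp add: fd)
qed

lemma frechet_derivative_zero_outside:
  fixes \<psi> :: "'a::euclidean_space \<Rightarrow> real"
  assumes "x \<notin> closure {x. \<psi> x \<noteq> 0}"
  shows "\<psi> x = 0" "frechet_derivative \<psi> (at x) = (\<lambda>_. 0)"
proof -
  show "\<psi> x = 0" using assms closure_subset[of "{x. \<psi> x \<noteq> 0}"] by auto
  have "(\<psi> has_derivative (\<lambda>_. 0)) (at x)"
    by (rule has_derivative_transform_within_open[of "\<lambda>_. 0" _ _ _ "- closure {x. \<psi> x \<noteq> 0}"])
       (use assms closure_subset[of "{x. \<psi> x \<noteq> 0}"] in auto)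
  then show "frechet_derivative \<psi> (at x) = (\<lambda>_. 0)" by (rule frechet_derivative_at[symmetric])
qed

lemma compact_support_bounded:
  fixes \<psi> :: "'a::euclidean_space \<Rightarrow> real"
  assumes "continuous_on UNIV \<psi>" "compact K" "\<And>x. x \<notin> K \<Longrightarrow> \<psi> x = 0"
  obtains B where "\<And>x. \<bar>\<psi> x\<bar> \<le> B"
proof -
  have "bounded (\<psi> ` K)"
    by (intro compact_imp_bounded compact_continuous_image continuous_on_subset[OF assms(1)] assms) auto
  then obtain B where "0 < B" "\<And>x. x \<in> K \<Longrightarrow> \<bar>\<psi> x\<bar> \<le> B" unfolding bounded_pos by auto
  then have "\<bar>\<psi> x\<bar> \<le> B" for x using assms(3)[of x] by (cases "x \<in> K") auto
  then show thesis by (rule that)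
qed

lemma Ck_on_1_compact_support_bounds:
  fixes \<psi> :: "'a::euclidean_space \<Rightarrow> real"
  assumes "Ck_on 1 UNIV \<psi>" "compact (closure {x. \<psi> x \<noteq> 0})"
  obtains B B' where "\<And>x. \<bar>\<psi> x\<bar> \<le> B" "\<And>x. \<bar>frechet_derivative \<psi> (at x) v\<bar> \<le> B'"
proof -
  note C = Ck_on_1_along_line(1,2)[OF assms(1)]
  obtain B where B: "\<And>x. \<bar>\<psi> x\<bar> \<le> B"
    using compact_support_bounded[OF C(1) assms(2)] frechet_derivative_zero_outside(1)[of _ \<psi>] by blast
  have "frechet_derivative \<psi> (at x) v = 0" if "x \<notin> closure {x. \<psi> x \<noteq> 0}" for x
    using frechet_derivative_zero_outside(2)[OF that] by simp
  then obtain B' where "\<And>x. \<bar>frechet_derivative \<psi> (at x) v\<bar> \<le> B'"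
    using compact_support_bounded[OF C(2) assms(2)] by blast
  with B show thesis by (rule that)
qed

lemma integrable_compact_support:
  fixes f :: "'a::euclidean_space \<Rightarrow> real"
  assumes f: "continuous_on UNIV f" and K: "compact K" "\<And>x. x \<notin> K \<Longrightarrow> f x = 0"
  shows "integrable lborel f"
proof -
  have "integrable lborel (\<lambda>x. indicator K x *\<^sub>R f x)"
    by (rule borel_integrable_compact[OF K(1)]) (rule continuous_on_subset[OF f], simp)
  moreover have "(\<lambda>x. indicator K x *\<^sub>R f x) = f" using K(2) by (auto simp: fun_eq_iff indicator_def)
  ultimately show ?thesis by simp
qed

text \<open>Since v is differentiable only in direction \<theta>, one does not integrate by parts in
  coordinates. By translation invariance the integrals of v(x + t\<theta>) \<psi>(x) and of v(x)
  \<psi>(x - t\<theta>) over x agree for every t; differentiating both at t = 0 gives the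
  claim.\<close>

lemma classical_transport_imp_weak:
  fixes v f \<psi> :: "'a::euclidean_space \<Rightarrow> real"
  assumes v: "continuous_on UNIV v" and f: "continuous_on UNIV f"
    and der: "\<And>x t. ((\<lambda>t. v (x + t *\<^sub>R \<theta>)) has_real_derivative f (x + t *\<^sub>R \<theta>)) (at t)"
    and \<psi>: "Ck_on 1 UNIV \<psi>" and supp: "compact (closure {x. \<psi> x \<noteq> 0})"
  shows "(\<integral>x. v x * frechet_derivative \<psi> (at x) \<theta> \<partial>lborel) = - (\<integral>x. f x * \<psi> x \<partial>lborel)"
proof -
  let ?d = "\<lambda>x. frechet_derivative \<psi> (at x) \<theta>"
  define S where "S = closure {x. \<psi> x \<noteq> 0}"
  have K: "compact S" using supp by (simp add: S_def)
  note C = Ck_on_1_along_line[OF \<psi>]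
  have Z: "\<psi> x = 0" "?d x = 0" if "x \<notin> S" for x
    using frechet_derivative_zero_outside[of x \<psi>] that by (auto simp: S_def)
  obtain B' where B': "\<And>x. \<bar>?d x\<bar> \<le> B'"
    using Ck_on_1_compact_support_bounds[OF \<psi> supp] by blast
  then have B0: "0 \<le> B'" by (rule order_trans[OF abs_ge_zero])
  \<comment> \<open>The support of \<psi> swept over |t| \<le> 1. Outside of it all these translates
    of \<psi> vanish, so |v| cut off to \<open>K'\<close> yields an integrable majorant.\<close>
  define K' where "K' = (\<lambda>(x, t). x + t *\<^sub>R \<theta>) ` (S \<times> {-1..1})"
  have K': "compact K'" unfolding K'_def
    by (intro compact_continuous_image compact_Times K) (auto intro!: continuous_intros simp: case_prod_beta')
  have inK': "x \<in> K'" if "x - t *\<^sub>R \<theta> \<in> S" "\<bar>t\<bar> \<le> 1" for x t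
    unfolding K'_def using that by (intro image_eqI[of _ _ "(x - t *\<^sub>R \<theta>, t)"]) auto
  have vK: "integrable lborel (\<lambda>x. indicator K' x * \<bar>v x\<bar>)"
    using borel_integrable_compact[OF K', of "\<lambda>x. \<bar>v x\<bar>"] continuous_on_subset[OF v]
    by (simp add: continuous_on_rabs)
  have comp: "continuous_on UNIV (\<lambda>x. g (x + c))" if "continuous_on UNIV g" for g :: "'a \<Rightarrow> real" and c
    by (rule continuous_on_compose2[OF that]) (auto intro!: continuous_intros)
  have comp': "continuous_on UNIV (\<lambda>x. g (x - c))" if "continuous_on UNIV g" for g :: "'a \<Rightarrow> real" and c
    using comp[OF that, of "- c"] by simp
  define P where "P = (\<lambda>(x, t). f (x + t *\<^sub>R \<theta>)) ` (S \<times> {-1..1})"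
  have "compact P" unfolding P_def
    unfolding case_prod_beta'
    by (intro compact_continuous_image compact_Times K continuous_on_compose2[OF f] continuous_intros) auto
  then have "bounded P" by (rule compact_imp_bounded)
  then obtain A where A: "\<And>y. y \<in> P \<Longrightarrow> \<bar>y\<bar> \<le> A" unfolding bounded_iff real_norm_def by blast
  have "((\<lambda>t. \<integral>x. v (x + t *\<^sub>R \<theta>) * \<psi> x \<partial>lborel) has_real_derivative (\<integral>x. f (x + 0 *\<^sub>R \<theta>) * \<psi> x \<partial>lborel)) (at 0)"
  proof (rule has_real_derivative_lebesgue_integral[where F="\<lambda>t x. v (x + t *\<^sub>R \<theta>) * \<psi> x"
        and F'="\<lambda>t x. f (x + t *\<^sub>R \<theta>) * \<psi> x" and G="\<lambda>x. A * \<bar>\<psi> x\<bar>"])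
    show "integrable lborel (\<lambda>x. v (x + t *\<^sub>R \<theta>) * \<psi> x)" for t
      by (rule integrable_compact_support[OF continuous_on_mult[OF comp[OF v] C(1)] K]) (simp add: Z)
    show "integrable lborel (\<lambda>x. A * \<bar>\<psi> x\<bar>)"
      by (rule integrable_compact_support[OF _ K]) (auto intro!: continuous_on_mult continuous_on_rabs C(1) simp: Z)
    show "(\<lambda>x. f (x + 0 *\<^sub>R \<theta>) * \<psi> x) \<in> borel_measurable lborel"
      using borel_measurable_continuous_onI[OF continuous_on_mult[OF f C(1)]] by simp
    show "((\<lambda>t. v (x + t *\<^sub>R \<theta>) * \<psi> x) has_real_derivative f (x + t *\<^sub>R \<theta>) * \<psi> x) (at t)" for x t
      by (intro DERIV_cmult_right der)
    show "\<bar>f (x + t *\<^sub>R \<theta>) * \<psi> x\<bar> \<le> A * \<bar>\<psi> x\<bar>" if "\<bar>t - 0\<bar> \<le> 1" for x t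
    proof (cases "x \<in> S")
      case True
      have "f (x + t *\<^sub>R \<theta>) \<in> P" unfolding P_def using True that by (intro image_eqI[of _ _ "(x, t)"]) auto
      then show ?thesis using A by (simp add: abs_mult mult_right_mono)
    qed (simp add: Z)
  qed
  moreover have "(\<integral>x. v (x + t *\<^sub>R \<theta>) * \<psi> x \<partial>lborel) = (\<integral>x. v x * \<psi> (x - t *\<^sub>R \<theta>) \<partial>lborel)" for t
    using integral_lborel_translate[of "\<lambda>x. v x * \<psi> (x - t *\<^sub>R \<theta>)" "t *\<^sub>R \<theta>"]
    using borel_measurable_continuous_onI[OF continuous_on_mult[OF v comp'[OF C(1)]]] by simp
  moreover have "((\<lambda>t. \<integral>x. v x * \<psi> (x - t *\<^sub>R \<theta>) \<partial>lborel) has_real_derivative (\<integral>x. v x * - ?d (x - 0 *\<^sub>R \<theta>) \<partial>lborel)) (at 0)"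
  proof (rule has_real_derivative_lebesgue_integral[where F="\<lambda>t x. v x * \<psi> (x - t *\<^sub>R \<theta>)"
        and F'="\<lambda>t x. v x * - ?d (x - t *\<^sub>R \<theta>)" and G="\<lambda>x. indicator K' x * \<bar>v x\<bar> * B'"])
    show "integrable lborel (\<lambda>x. v x * \<psi> (x - t *\<^sub>R \<theta>))" for t
    proof (rule integrable_compact_support)
      show "compact ((\<lambda>x. x + t *\<^sub>R \<theta>) ` S)" by (intro compact_continuous_image K continuous_intros)
      show "v x * \<psi> (x - t *\<^sub>R \<theta>) = 0" if "x \<notin> (\<lambda>x. x + t *\<^sub>R \<theta>) ` S" for x
        using that Z(1)[of "x - t *\<^sub>R \<theta>"] by (force simp: image_iff)
    qed (rule continuous_on_mult[OF v comp'[OF C(1)]])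
    show "integrable lborel (\<lambda>x. indicator K' x * \<bar>v x\<bar> * B')" using vK by simp
    show "(\<lambda>x. v x * - ?d (x - 0 *\<^sub>R \<theta>)) \<in> borel_measurable lborel"
      using borel_measurable_continuous_onI[OF continuous_on_mult[OF v C(2)]] by simp
    show "((\<lambda>t. v x * \<psi> (x - t *\<^sub>R \<theta>)) has_real_derivative v x * - ?d (x - t *\<^sub>R \<theta>)) (at t)" for x t
      by (intro DERIV_cmult C)
    show "\<bar>v x * - ?d (x - t *\<^sub>R \<theta>)\<bar> \<le> indicator K' x * \<bar>v x\<bar> * B'" if "\<bar>t - 0\<bar> \<le> 1" for x t
    proof (cases "x - t *\<^sub>R \<theta> \<in> S")
      case True
      then show ?thesis using inK'[OF True] that B'[of "x - t *\<^sub>R \<theta>"] by (simp add: abs_mult mult_left_mono)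
    qed (simp add: Z B0)
  qed
  ultimately have "(\<integral>x. f x * \<psi> x \<partial>lborel) = (\<integral>x. v x * - ?d x \<partial>lborel)"
    using DERIV_unique by fastforce
  then show ?thesis by simp
qed

section \<open>Bump functions and the fundamental lemma of the calculus of variations\<close>

text \<open>An elementary step of class C^1, the regularity that \<open>test_function\<close> asks
  for: quadratic contact at 0 and limit 1 at infinity, so that r \<mapsto>
  \<open>smooth_step (n * r)\<close> tends to the indicator of the positive half-line. Products of a
  rising and a falling step in every coordinate then approximate indicators of open boxes by
  functions that vanish outside the box.\<close>

definition smooth_step :: "real \<Rightarrow> real" where
  "smooth_step r = (max 0 r)\<^sup>2 / (1 + (max 0 r)\<^sup>2)"

lemma smooth_step_has_derivative:
  "(smooth_step has_real_derivative 2 * max 0 r / (1 + (max 0 r)\<^sup>2)\<^sup>2) (at r)"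
proof -
  have sq: "((\<lambda>r. (max 0 r)\<^sup>2) has_real_derivative 2 * max 0 r) (at r)"
  proof -
    consider "r > 0" | "r < 0" | "r = 0" by linarith
    then show ?thesis
    proof cases
      case 1
      have "((\<lambda>r. r\<^sup>2) has_real_derivative 2 * r) (at r)" by (auto intro!: derivative_eq_intros)
      then have "((\<lambda>r. (max 0 r)\<^sup>2) has_real_derivative 2 * r) (at r)"
        by (rule has_field_derivative_transform_within_open[of _ _ _ "{0<..}"]) (use 1 in auto)
      then show ?thesis using 1 by simp
    next
      case 2
      have "((\<lambda>r. 0) has_real_derivative 0) (at r)" by simp
      then have "((\<lambda>r. (max 0 r)\<^sup>2) has_real_derivative 0) (at r)"
        by (rule has_field_derivative_transform_within_open[of _ _ _ "{..<0}"]) (use 2 in auto)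
      then show ?thesis using 2 by simp
    next
      case 3
      have "((\<lambda>h::real. (max 0 h)\<^sup>2 / h) \<longlongrightarrow> 0) (at 0)"
      proof (rule Lim_null_comparison[of _ "\<lambda>h. \<bar>h\<bar>"])
        have "norm ((max 0 h)\<^sup>2 / h) \<le> \<bar>h\<bar>" for h :: real
          by (cases "h \<le> 0") (auto simp: max_def power2_eq_square)
        then show "\<forall>\<^sub>F h in at 0. norm ((max 0 h)\<^sup>2 / h) \<le> \<bar>h\<bar>" for h :: real by simp
        show "((\<lambda>h::real. \<bar>h\<bar>) \<longlongrightarrow> 0) (at 0)"
          using tendsto_rabs[OF tendsto_ident_at[of "0::real" UNIV]] by simp
      qed
      then show ?thesis using 3 by (simp add: DERIV_def)
    qed
  qed
  have pos: "1 + (max 0 r)\<^sup>2 \<noteq> 0" by (metis add_pos_nonneg less_irrefl zero_le_power2 zero_less_one)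
  have "(smooth_step has_real_derivative
      (2 * max 0 r * (1 + (max 0 r)\<^sup>2) - (max 0 r)\<^sup>2 * (2 * max 0 r)) / ((1 + (max 0 r)\<^sup>2) * (1 + (max 0 r)\<^sup>2))) (at r)"
    unfolding smooth_step_def[abs_def]
  proof (rule DERIV_divide[OF sq])
    show "((\<lambda>r. 1 + (max 0 r)\<^sup>2) has_real_derivative 2 * max 0 r) (at r)"
      using DERIV_add[OF DERIV_const sq, of 1] by simp
  qed (rule pos)
  then show ?thesis by (simp add: algebra_simps power2_eq_square)
qed

lemma smooth_step_bounds: "0 \<le> smooth_step r" "smooth_step r \<le> 1" "smooth_step r \<noteq> 0 \<longleftrightarrow> 0 < r"
proof -
  have "0 < 1 + (max 0 r)\<^sup>2" by (simp add: add_pos_nonneg)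
  then show "0 \<le> smooth_step r" "smooth_step r \<le> 1" "smooth_step r \<noteq> 0 \<longleftrightarrow> 0 < r"
    by (auto simp: smooth_step_def field_simps)
qed

lemma smooth_step_tendsto: "(\<lambda>n. smooth_step (real n * r)) \<longlonglongrightarrow> (if 0 < r then 1 else 0)"
proof (cases "0 < r")
  case True
  have "(\<lambda>n. 1 - inverse (1 + (real n * r)\<^sup>2)) \<longlonglongrightarrow> 1 - 0"
  proof (intro tendsto_intros tendsto_inverse_0_at_top)
    have "filterlim (\<lambda>n. real n * r) at_top sequentially"
      by (rule filterlim_at_top_mult_tendsto_pos[OF tendsto_const True filterlim_real_sequentially])
    then have "filterlim (\<lambda>n. (real n * r)\<^sup>2) at_top sequentially"
      by (rule filterlim_pow_at_top[rotated]) simp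
    then show "filterlim (\<lambda>n. 1 + (real n * r)\<^sup>2) at_top sequentially"
      by (rule filterlim_tendsto_add_at_top[OF tendsto_const])
  qed
  moreover have "smooth_step (real n * r) = 1 - inverse (1 + (real n * r)\<^sup>2)" for n
  proof -
    have "0 < 1 + (real n * r)\<^sup>2" by (simp add: add_pos_nonneg)
    then show ?thesis using True by (simp add: smooth_step_def field_simps max_def mult_le_0_iff)
  qed
  ultimately show ?thesis using True by simp
next
  case False
  then have "smooth_step (real n * r) = 0" for n
    using smooth_step_bounds(3)[of "real n * r"] by (simp add: zero_less_mult_iff)
  then show ?thesis using False by simp
qed

lemma continuous_on_smooth_step_deriv:
  "continuous_on UNIV (\<lambda>r::real. 2 * max 0 r / (1 + (max 0 r)\<^sup>2)\<^sup>2)"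
proof (intro continuous_intros ballI)
  fix r :: real
  have "0 < 1 + (max 0 r)\<^sup>2" by (simp add: add_pos_nonneg)
  then show "(1 + (max 0 r)\<^sup>2)\<^sup>2 \<noteq> 0" by simp
qed

definition box_bump :: "nat \<Rightarrow> 'a \<Rightarrow> 'a \<Rightarrow> 'a::euclidean_space \<Rightarrow> real" where
  "box_bump n c d x = (\<Prod>i\<in>Basis. smooth_step (n * (x \<bullet> i - c \<bullet> i)) * smooth_step (n * (d \<bullet> i - x \<bullet> i)))"

lemma Ck_on_1_box_bump: "Ck_on 1 UNIV (box_bump n c d :: 'a::euclidean_space \<Rightarrow> real)"
proof -
  have 1: "Ck_on 1 UNIV (\<lambda>x::'a. smooth_step (n * (x \<bullet> i - c \<bullet> i)))" for i
    using Ck_on_1_compose_affine[OF smooth_step_has_derivative continuous_on_smooth_step_deriv, of "n *\<^sub>R i" "- (n * (c \<bullet> i))"]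
    by (simp add: algebra_simps)
  have 2: "Ck_on 1 UNIV (\<lambda>x::'a. smooth_step (n * (d \<bullet> i - x \<bullet> i)))" for i
    using Ck_on_1_compose_affine[OF smooth_step_has_derivative continuous_on_smooth_step_deriv, of "- (n *\<^sub>R i)" "n * (d \<bullet> i)"]
    by (simp add: algebra_simps)
  show ?thesis
    unfolding box_bump_def[abs_def] by (intro Ck_on_1_prod Ck_on_1_mult 1 2) simp
qed

lemma box_bump_bounds: "0 \<le> box_bump n c d x" "box_bump n c d x \<le> 1"
  unfolding box_bump_def
  by (auto intro!: prod_nonneg prod_le_1 mult_le_one smooth_step_bounds mult_nonneg_nonneg)

lemma box_bump_nonzero: "box_bump n c d x \<noteq> 0 \<Longrightarrow> x \<in> box c d"
proof -
  assume "box_bump n c d x \<noteq> 0"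
  then have "smooth_step (n * (x \<bullet> i - c \<bullet> i)) \<noteq> 0" "smooth_step (n * (d \<bullet> i - x \<bullet> i)) \<noteq> 0" if "i \<in> Basis" for i
    using that unfolding box_bump_def by (auto simp: prod_zero_iff)
  then have "0 < n * (x \<bullet> i - c \<bullet> i) \<and> 0 < n * (d \<bullet> i - x \<bullet> i)" if "i \<in> Basis" for i
    using that smooth_step_bounds(3) by blast
  then show ?thesis by (auto simp: mem_box zero_less_mult_iff)
qed

lemma box_bump_tendsto: "(\<lambda>n. box_bump n c d x) \<longlonglongrightarrow> indicator (box c d) x"
proof -
  have "(\<lambda>n. box_bump n c d x) \<longlonglongrightarrow>
      (\<Prod>i\<in>Basis. (if 0 < x \<bullet> i - c \<bullet> i then 1 else 0) * (if 0 < d \<bullet> i - x \<bullet> i then 1 else 0))"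
    unfolding box_bump_def by (intro tendsto_prod tendsto_mult smooth_step_tendsto)
  also have "(\<Prod>i\<in>Basis. (if 0 < x \<bullet> i - c \<bullet> i then 1 else 0) * (if 0 < d \<bullet> i - x \<bullet> i then 1 else 0))
      = (indicator (box c d) x :: real)"
  proof (cases "x \<in> box c d")
    case True
    then show ?thesis by (auto simp: mem_box intro!: prod.neutral)
  next
    case False
    then obtain i where "i \<in> Basis" "\<not> (c \<bullet> i < x \<bullet> i \<and> x \<bullet> i < d \<bullet> i)" by (auto simp: mem_box)
    then show ?thesis using False by (auto intro!: prod_zero bexI[of _ i])
  qed
  finally show ?thesis .
qed

lemma integrable_mult_bounded:
  fixes f g :: "'b \<Rightarrow> real"
  assumes f: "integrable M f" and g: "g \<in> borel_measurable M" and B: "\<And>x. x \<in> space M \<Longrightarrow> \<bar>g x\<bar> \<le> B"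
  shows "integrable M (\<lambda>x. f x * g x)"
proof (rule Bochner_Integration.integrable_bound)
  show "integrable M (\<lambda>x. B * \<bar>f x\<bar>)" using f by simp
  show "(\<lambda>x. f x * g x) \<in> borel_measurable M"
    using f g by (intro borel_measurable_times) auto
  show "AE x in M. norm (f x * g x) \<le> norm (B * \<bar>f x\<bar>)"
  proof (rule AE_I2)
    fix x assume "x \<in> space M"
    then show "norm (f x * g x) \<le> norm (B * \<bar>f x\<bar>)"
      using B[of x] mult_left_mono[of "\<bar>g x\<bar>" B "\<bar>f x\<bar>"] by (simp add: abs_mult mult.commute)
  qed
qed

text \<open>The positive and the negative part of g are densities of two measures that agree on open
  boxes, an intersection-stable generator that exhausts the space by sets of finite mass. So the
  measures agree, and with them the densities. As \<open>ennreal\<close> sends negative numbers to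
  0, equality of \<open>ennreal (g x)\<close> and \<open>ennreal (- g x)\<close> forces
  \<open>g x = 0\<close>.\<close>

lemma AE_zero_if_box_integrals_zero:
  fixes g :: "'a::euclidean_space \<Rightarrow> real"
  assumes g: "integrable lborel g"
    and zero: "\<And>c d. (\<integral>x. indicator (box c d) x * g x \<partial>lborel) = 0"
  shows "AE x in lborel. g x = 0"
proof -
  have gm[measurable]: "g \<in> borel_measurable borel" using g by auto
  let ?p = "density lborel (\<lambda>x. ennreal (g x))" and ?n = "density lborel (\<lambda>x. ennreal (- g x))"
  have "?p = ?n"
  proof (rule measure_eqI_generator_eq)
    let ?E = "range (\<lambda>(a, b). box a b::'a set)"
    show "Int_stable ?E" by (auto simp: Int_stable_def box_Int_box)
    show "?E \<subseteq> Pow UNIV" "sets ?p = sigma_sets UNIV ?E" "sets ?n = sigma_sets UNIV ?E"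
      by (simp_all add: borel_eq_box)
    let ?A = "\<lambda>n::nat. box (- (real n *\<^sub>R One)) (real n *\<^sub>R One) :: 'a set"
    show "range ?A \<subseteq> ?E" "(\<Union>i. ?A i) = UNIV"
      unfolding UN_box_eq_UNIV by auto
    \<comment> \<open>The sign \<open>s\<close> handles the positive and the negative part of g at
      once.\<close>
    have part: "(\<integral>\<^sup>+x. ennreal (s * g x) * indicator (box c d) x \<partial>lborel) < \<infinity>"
      "(\<integral>\<^sup>+x. ennreal (s * g x) * indicator (box c d) x \<partial>lborel)
        = ennreal (\<integral>x. max 0 (s * (indicator (box c d) x * g x)) \<partial>lborel)" if "s = 1 \<or> s = -1" for s c d
    proof -
      have i: "integrable lborel (\<lambda>x. indicator (box c d) x * g x)"
        using integrable_mult_bounded[OF g, of "indicator (box c d)" 1] by (simp add: mult.commute)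
      have i2: "integrable lborel (\<lambda>x. max 0 (s * (indicator (box c d) x * g x)))"
        by (intro integrable_max integrable_mult_right i) simp
      have "(\<integral>\<^sup>+x. ennreal (s * g x) * indicator (box c d) x \<partial>lborel)
          = (\<integral>\<^sup>+x. ennreal (max 0 (s * (indicator (box c d) x * g x))) \<partial>lborel)"
        by (intro nn_integral_cong) (auto simp: indicator_def max_def ennreal_neg)
      also have "\<dots> = ennreal (\<integral>x. max 0 (s * (indicator (box c d) x * g x)) \<partial>lborel)"
        by (rule nn_integral_eq_integral[OF i2]) simp
      finally show eq: "(\<integral>\<^sup>+x. ennreal (s * g x) * indicator (box c d) x \<partial>lborel)
        = ennreal (\<integral>x. max 0 (s * (indicator (box c d) x * g x)) \<partial>lborel)" .
      show "(\<integral>\<^sup>+x. ennreal (s * g x) * indicator (box c d) x \<partial>lborel) < \<infinity>" unfolding eq by simp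
    qed
    show "emeasure ?p (?A i) \<noteq> \<infinity>" for i
      using part(1)[of 1] by (simp add: emeasure_density less_top)
    fix Y assume "Y \<in> ?E"
    then obtain c d where Y: "Y = box c d" by auto
    let ?h = "\<lambda>x. indicator (box c d) x * g x"
    have i: "integrable lborel ?h"
      using integrable_mult_bounded[OF g, of "indicator (box c d)" 1] by (simp add: mult.commute)
    have "(\<integral>x. max 0 (1 * ?h x) \<partial>lborel) - (\<integral>x. max 0 (-1 * ?h x) \<partial>lborel)
        = (\<integral>x. max 0 (1 * ?h x) - max 0 (-1 * ?h x) \<partial>lborel)"
      by (rule Bochner_Integration.integral_diff[symmetric]; intro integrable_max integrable_mult_right i) simp_all
    also have "\<dots> = (\<integral>x. ?h x \<partial>lborel)"
      by (rule Bochner_Integration.integral_cong) (auto simp: max_def)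
    also have "\<dots> = 0" by (rule zero)
    finally have "(\<integral>x. max 0 (1 * ?h x) \<partial>lborel) = (\<integral>x. max 0 (-1 * ?h x) \<partial>lborel)" by simp
    then show "emeasure ?p Y = emeasure ?n Y"
      using part(2)[of 1 c d] part(2)[of "-1" c d] unfolding Y by (simp add: emeasure_density)
  qed
  then have "AE x in lborel. ennreal (g x) = ennreal (- g x)"
    by (subst (asm) sigma_finite_measure.density_unique_iff[OF sigma_finite_lborel]) auto
  then show ?thesis
  proof eventually_elim
    case (elim x)
    then show ?case
      by (metis add.inverse_inverse ennreal_eq_0_iff ennreal_neg le_cases neg_le_0_iff_le order_antisym)
  qed
qed

text \<open>Bumps on a box inside \<open>box a b\<close> have their closed support in
  \<open>cbox a b\<close>, and by dominated convergence they turn the hypothesis into vanishing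
  integrals over such boxes; applied to g cut off to \<open>box a b\<close>, the previous lemma
  concludes. Tests are restricted to one closed box because, in the application, only translates of
  that box are known to remain in the domain.\<close>

lemma AE_zero_if_weakly_zero:
  fixes g :: "'a::euclidean_space \<Rightarrow> real"
  assumes g: "integrable lborel g"
    and zero: "\<And>\<psi>. Ck_on 1 UNIV \<psi> \<Longrightarrow> compact (closure {x. \<psi> x \<noteq> 0}) \<Longrightarrow> closure {x. \<psi> x \<noteq> 0} \<subseteq> cbox a b
      \<Longrightarrow> (\<integral>x. g x * \<psi> x \<partial>lborel) = 0"
  shows "AE x in lborel. x \<in> box a b \<longrightarrow> g x = 0"
proof -
  have gm[measurable]: "g \<in> borel_measurable borel" using g by auto
  have sub: "(\<integral>x. indicator (box c d) x * g x \<partial>lborel) = 0" if cd: "box c d \<subseteq> box a b" for c d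
  proof -
    have cl: "closure {x. box_bump n c d x \<noteq> 0} \<subseteq> cbox a b" for n
    proof -
      have "{x. box_bump n c d x \<noteq> 0} \<subseteq> cbox a b"
        using box_bump_nonzero cd box_subset_cbox by blast
      then show ?thesis by (rule closure_minimal) (rule closed_cbox)
    qed
    have co: "compact (closure {x. box_bump n c d x \<noteq> 0})" for n
      using bounded_subset[OF bounded_cbox cl] by (simp add: compact_eq_bounded_closed)
    have meas: "box_bump n c d \<in> borel_measurable borel" for n
      by (rule borel_measurable_continuous_onI[OF Ck_on_1_along_line(1)[OF Ck_on_1_box_bump]])
    have "(\<lambda>n. \<integral>x. g x * box_bump n c d x \<partial>lborel) \<longlonglongrightarrow> (\<integral>x. g x * indicator (box c d) x \<partial>lborel)"
    proof (rule integral_dominated_convergence[where w="\<lambda>x. \<bar>g x\<bar>"])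
      show "integrable lborel (\<lambda>x. \<bar>g x\<bar>)" using g by simp
      show "(\<lambda>x. g x * box_bump n c d x) \<in> borel_measurable lborel" for n using meas by measurable
      show "AE x in lborel. (\<lambda>n. g x * box_bump n c d x) \<longlonglongrightarrow> g x * indicator (box c d) x"
        by (intro AE_I2 tendsto_mult tendsto_const box_bump_tendsto)
      show "AE x in lborel. norm (g x * box_bump n c d x) \<le> \<bar>g x\<bar>" for n
        using box_bump_bounds[of n c d] by (intro AE_I2) (simp add: abs_mult mult_left_le)
    qed simp
    moreover have "(\<integral>x. g x * box_bump n c d x \<partial>lborel) = 0" for n
      by (rule zero[OF Ck_on_1_box_bump co cl])
    ultimately show ?thesis by (simp add: LIMSEQ_const_iff mult.commute)
  qed
  have "AE x in lborel. g x * indicator (box a b) x = 0"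
  proof (rule AE_zero_if_box_integrals_zero)
    show "integrable lborel (\<lambda>x. g x * indicator (box a b) x)"
      by (rule integrable_mult_bounded[OF g, of _ 1]) auto
    fix c d :: 'a
    obtain c' d' where "box c d \<inter> box a b = box c' d'" by (auto simp: box_Int_box)
    then have "(\<lambda>x. indicator (box c d) x * (g x * indicator (box a b) x)) = (\<lambda>x. indicator (box c' d') x * g x)"
      and "box c' d' \<subseteq> box a b"
      by (auto simp: indicator_def fun_eq_iff)
    then show "(\<integral>x. indicator (box c d) x * (g x * indicator (box a b) x) \<partial>lborel) = 0"
      using sub[of c' d'] by metis
  qed
  then show ?thesis by eventually_elim auto
qed


section \<open>Weak solutions along lines\<close>

lemma test_function_translate:
  fixes \<psi> :: "'a::euclidean_space \<Rightarrow> real"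
  assumes \<psi>: "Ck_on 1 UNIV \<psi>" and supp: "closure {x. \<psi> x \<noteq> 0} \<subseteq> cbox a b"
    and X: "\<And>x. x \<in> cbox a b \<Longrightarrow> x - c \<in> X"
  shows "test_function X (\<lambda>x. \<psi> (x + c))"
proof -
  let ?S = "(\<lambda>x. x - c) ` cbox a b"
  have S: "compact ?S" by (intro compact_continuous_image continuous_intros) simp
  have "{x. \<psi> (x + c) \<noteq> 0} \<subseteq> ?S"
  proof
    fix x assume "x \<in> {x. \<psi> (x + c) \<noteq> 0}"
    then have "x + c \<in> cbox a b" using supp closure_subset[of "{x. \<psi> x \<noteq> 0}"] by auto
    then show "x \<in> ?S" by (intro image_eqI[of _ _ "x + c"]) auto
  qed
  then have cl: "closure {x. \<psi> (x + c) \<noteq> 0} \<subseteq> ?S"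
    by (rule closure_minimal) (rule compact_imp_closed[OF S])
  then have "compact (closure {x. \<psi> (x + c) \<noteq> 0})"
    using bounded_subset[OF compact_imp_bounded[OF S]] by (simp add: compact_eq_bounded_closed)
  moreover have "closure {x. \<psi> (x + c) \<noteq> 0} \<subseteq> X" using cl X by blast
  ultimately show ?thesis using Ck_on_1_translate(1)[OF \<psi>] by (simp add: test_function_def)
qed

text \<open>u has no derivative of its own, so the identity is obtained by duality. For \<psi>
  supported in the box, let K(t) be the integral of u(x) \<psi>(x + t\<theta>). The translate of
  \<psi> is an admissible test function for 0 \<le> t \<le> T, and the weak equation gives K' = - J
  with J(t) the integral of f(x) \<psi>(x + t\<theta>). Integrating over \<open>{0..T}\<close>,
  shifting variables and Fubini show that u(x) - u(x - T\<theta>) - F(x) is orthogonal to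
  \<psi>.\<close>

lemma weak_transport_translate:
  fixes u f :: "'a::euclidean_space \<Rightarrow> real"
  assumes u: "integrable lborel u" and fm[measurable]: "f \<in> borel_measurable borel" and fC: "\<And>x. \<bar>f x\<bar> \<le> C"
    and T: "0 \<le> T"
    and weak: "\<And>\<psi>. test_function X \<psi> \<Longrightarrow>
      (\<integral>x. u x * frechet_derivative \<psi> (at x) \<theta> \<partial>lborel) = - (\<integral>x. f x * \<psi> x \<partial>lborel)"
    and box: "\<And>x s. x \<in> cbox a b \<Longrightarrow> 0 \<le> s \<Longrightarrow> s \<le> T \<Longrightarrow> x - s *\<^sub>R \<theta> \<in> X"
  shows "AE x in lborel. x \<in> box a b \<longrightarrow>
    u x - u (x - T *\<^sub>R \<theta>) = (\<integral>s. indicator {0..T} s * f (x - s *\<^sub>R \<theta>) \<partial>lborel)"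
proof -
  have um[measurable]: "u \<in> borel_measurable borel" using u by auto
  have C0: "0 \<le> C" using fC[of undefined] by linarith
  have fin: "emeasure lborel (cbox a b) < top" by (metis emeasure_lborel_cbox_finite infinity_ennreal_def)
  define F where "F x = (\<integral>s. indicator {0..T} s * f (x - s *\<^sub>R \<theta>) \<partial>lborel)" for x
  let ?I = "indicator (cbox a b) :: 'a \<Rightarrow> real"
  \<comment> \<open>The cut-off is there for integrability: \<open>F\<close> is bounded, but it need
    not be integrable over the whole space.\<close>
  define g where "g x = ?I x * (u x - u (x - T *\<^sub>R \<theta>) - F x)" for x
  have uT: "integrable lborel (\<lambda>x. u (x - T *\<^sub>R \<theta>))"
    using integrable_lborel_translate[OF u, of "- (T *\<^sub>R \<theta>)"] by simp
  have Fm[measurable]: "F \<in> borel_measurable borel" unfolding F_def by measurable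
  have Fb: "\<bar>F x\<bar> \<le> C * T" for x
  proof -
    have i: "integrable lborel (\<lambda>s. indicator {0..T} s * C)"
      by (intro integrable_mult_left integrable_real_indicator) (auto simp: emeasure_lborel_Icc_eq)
    have "\<bar>F x\<bar> \<le> (\<integral>s. indicator {0..T} s * C \<partial>lborel)"
      unfolding F_def
    proof (rule integral_abs_bound_integral)
      show "integrable lborel (\<lambda>s. indicator {0..T} s * f (x - s *\<^sub>R \<theta>))"
        by (rule Bochner_Integration.integrable_bound[OF i]) (auto simp: indicator_def fC abs_of_nonneg[OF C0])
      show "\<bar>indicator {0..T} s * f (x - s *\<^sub>R \<theta>)\<bar> \<le> indicator {0..T} s * C" for s
        using fC by (auto simp: indicator_def)
    qed (rule i)
    then show ?thesis using T by (simp add: mult.commute)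
  qed
  have gi: "integrable lborel g"
  proof -
    have "integrable lborel (\<lambda>x. ?I x * F x)"
      by (rule integrable_mult_bounded[of lborel ?I F "C * T"]) (auto simp: Fb fin intro!: integrable_real_indicator)
    moreover have "integrable lborel (\<lambda>x. (u x - u (x - T *\<^sub>R \<theta>)) * ?I x)"
      by (rule integrable_mult_bounded[OF Bochner_Integration.integrable_diff[OF u uT], of _ 1]) auto
    ultimately have "integrable lborel (\<lambda>x. (u x - u (x - T *\<^sub>R \<theta>)) * ?I x - ?I x * F x)"
      by (rule Bochner_Integration.integrable_diff[rotated])
    then show ?thesis by (simp add: g_def[abs_def] algebra_simps)
  qed
  have "AE x in lborel. x \<in> box a b \<longrightarrow> g x = 0"
  proof (rule AE_zero_if_weakly_zero[OF gi])
    fix \<psi> :: "'a \<Rightarrow> real"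
    assume \<psi>: "Ck_on 1 UNIV \<psi>" and co: "compact (closure {x. \<psi> x \<noteq> 0})" and supp: "closure {x. \<psi> x \<noteq> 0} \<subseteq> cbox a b"
    note C = Ck_on_1_along_line[OF \<psi>]
    obtain B B' where B: "\<And>x. \<bar>\<psi> x\<bar> \<le> B" and B': "\<And>x. \<bar>frechet_derivative \<psi> (at x) \<theta>\<bar> \<le> B'"
      using Ck_on_1_compact_support_bounds[OF \<psi> co] by blast
    have Z: "\<psi> x = 0" if "x \<notin> cbox a b" for x
      by (rule frechet_derivative_zero_outside(1)) (use that supp in blast)
    have \<psi>m[measurable]: "\<psi> \<in> borel_measurable borel" by (rule borel_measurable_continuous_onI[OF C(1)])
    have dm[measurable]: "(\<lambda>x. frechet_derivative \<psi> (at x) \<theta>) \<in> borel_measurable borel"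
      by (rule borel_measurable_continuous_onI[OF C(2)])
    define J where "J t = (\<integral>x. f x * \<psi> (x + t *\<^sub>R \<theta>) \<partial>lborel)" for t
    define K where "K t = (\<integral>x. u x * \<psi> (x + t *\<^sub>R \<theta>) \<partial>lborel)" for t
    have dK: "(K has_real_derivative - J t) (at t)" if t: "0 \<le> t" "t \<le> T" for t
    proof -
      have "(K has_real_derivative (\<integral>x. u x * frechet_derivative \<psi> (at (x + t *\<^sub>R \<theta>)) \<theta> \<partial>lborel)) (at t)"
        unfolding K_def[abs_def]
      proof (rule has_real_derivative_lebesgue_integral[where F="\<lambda>t x. u x * \<psi> (x + t *\<^sub>R \<theta>)"
            and F'="\<lambda>t x. u x * frechet_derivative \<psi> (at (x + t *\<^sub>R \<theta>)) \<theta>" and G="\<lambda>x. \<bar>u x\<bar> * B'"])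
        show "integrable lborel (\<lambda>x. u x * \<psi> (x + t *\<^sub>R \<theta>))" for t
          by (rule integrable_mult_bounded[OF u, of _ B]) (auto simp: B)
        show "(\<lambda>x. u x * frechet_derivative \<psi> (at (x + t *\<^sub>R \<theta>)) \<theta>) \<in> borel_measurable lborel"
        proof -
          have "(\<lambda>x. frechet_derivative \<psi> (at (x + t *\<^sub>R \<theta>)) \<theta>) \<in> borel_measurable borel"
            by (rule measurable_compose[OF _ dm, of "\<lambda>x. x + t *\<^sub>R \<theta>"]) measurable
          then show ?thesis by (intro borel_measurable_times) auto
        qed
        show "((\<lambda>t. u x * \<psi> (x + t *\<^sub>R \<theta>)) has_real_derivative u x * frechet_derivative \<psi> (at (x + t *\<^sub>R \<theta>)) \<theta>) (at t)" for t x
          by (rule DERIV_cmult[OF C(3)])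
        show "integrable lborel (\<lambda>x. \<bar>u x\<bar> * B')" using u by simp
        show "\<bar>u x * frechet_derivative \<psi> (at (x + t *\<^sub>R \<theta>)) \<theta>\<bar> \<le> \<bar>u x\<bar> * B'" for t x
          using B' by (simp add: abs_mult mult_left_mono)
      qed
      moreover have "test_function X (\<lambda>x. \<psi> (x + t *\<^sub>R \<theta>))"
        by (rule test_function_translate[OF \<psi> supp]) (use box t in auto)
      from weak[OF this] have "(\<integral>x. u x * frechet_derivative \<psi> (at (x + t *\<^sub>R \<theta>)) \<theta> \<partial>lborel) = - J t"
        by (simp add: Ck_on_1_translate(2)[OF \<psi>] J_def)
      ultimately show ?thesis by simp
    qed
    have hi: "((\<lambda>t. - J t) has_integral (K T - K 0)) {0..T}"
    proof (rule fundamental_theorem_of_calculus[OF T])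
      fix t assume "t \<in> {0..T}"
      then have "(K has_real_derivative - J t) (at t)" using dK by simp
      then show "(K has_vector_derivative - J t) (at t within {0..T})"
        unfolding has_real_derivative_iff_has_vector_derivative by (rule has_vector_derivative_at_within)
    qed
    define H where "H x t = indicator {0..T} t * (f (x - t *\<^sub>R \<theta>) * \<psi> x)" for x t
    have Hm: "(\<lambda>(x, t). H x t) \<in> borel_measurable (lborel \<Otimes>\<^sub>M lborel)" unfolding H_def by measurable
    have "integrable (lborel \<Otimes>\<^sub>M lborel) (\<lambda>z. indicator (cbox a b \<times> {0..T}) z *\<^sub>R (case z of (x, t) \<Rightarrow> H x t))"
    proof (rule integrableI_bounded_set_indicator[where B="C * B"])
      show "emeasure (lborel \<Otimes>\<^sub>M lborel) (cbox a b \<times> {0..T}) < \<infinity>"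
        by (subst lborel.emeasure_pair_measure_Times) (auto simp: ennreal_mult_less_top fin emeasure_lborel_Icc_eq)
      have "\<bar>H x t\<bar> \<le> C * B" for x t
      proof -
        have "0 \<le> B" using B[of x] by linarith
        moreover have "\<bar>f (x - t *\<^sub>R \<theta>)\<bar> * \<bar>\<psi> x\<bar> \<le> C * B" by (intro mult_mono fC B C0) simp
        ultimately show ?thesis using C0 by (simp add: H_def indicator_def abs_mult)
      qed
      then show "AE z in lborel \<Otimes>\<^sub>M lborel. z \<in> cbox a b \<times> {0..T} \<longrightarrow> norm (case z of (x, t) \<Rightarrow> H x t) \<le> C * B"
        by auto
    qed (use Hm in auto)
    moreover have "(\<lambda>z. indicator (cbox a b \<times> {0..T}) z *\<^sub>R (case z of (x, t) \<Rightarrow> H x t)) = (\<lambda>(x, t). H x t)"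
      using Z by (auto simp: fun_eq_iff H_def indicator_def)
    ultimately have Hi: "integrable (lborel \<Otimes>\<^sub>M lborel) (\<lambda>(x, t). H x t)" by simp
    have J: "J t = (\<integral>x. f (x - t *\<^sub>R \<theta>) * \<psi> x \<partial>lborel)" for t
      using integral_lborel_translate[of "\<lambda>x. f x * \<psi> (x + t *\<^sub>R \<theta>)" "- (t *\<^sub>R \<theta>)"] by (simp add: J_def)
    have HJ: "(\<integral>x. H x t \<partial>lborel) = indicator {0..T} t * J t" for t
      unfolding H_def J by simp
    have HF: "(\<integral>t. H x t \<partial>lborel) = F x * \<psi> x" for x
      unfolding H_def F_def mult.assoc[symmetric] by (rule integral_mult_left_zero)
    \<comment> \<open>Integrability in t, supplied by Fubini, identifies the Lebesgue integral of
      \<open>J\<close> with the gauge integral that the fundamental theorem of calculus produced in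
      \<open>hi\<close>.\<close>
    have "integrable lborel (\<lambda>t. indicator {0..T} t * J t)"
      using lborel_pair.integrable_snd[OF Hi] by (simp add: HJ)
    then have "((\<lambda>t. indicator {0..T} t * J t) has_integral (\<integral>t. indicator {0..T} t * J t \<partial>lborel)) UNIV"
      by (rule has_integral_integral_lborel)
    moreover have "(\<lambda>t. indicator {0..T} t * J t) = (\<lambda>t. if t \<in> {0..T} then J t else 0)"
      by (auto simp: fun_eq_iff)
    ultimately have "(J has_integral (\<integral>t. indicator {0..T} t * J t \<partial>lborel)) {0..T}"
      using has_integral_restrict_UNIV[of "{0..T}" J] by simp
    moreover have "(J has_integral - (K T - K 0)) {0..T}" using has_integral_neg[OF hi] by simp
    ultimately have "K 0 - K T = (\<integral>t. (\<integral>x. H x t \<partial>lborel) \<partial>lborel)"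
      by (simp add: HJ has_integral_unique)
    also have "\<dots> = (\<integral>x. F x * \<psi> x \<partial>lborel)"
      using lborel_pair.Fubini_integral[OF Hi] by (simp add: HF)
    finally have main: "K 0 - K T = (\<integral>x. F x * \<psi> x \<partial>lborel)" .
    have KT: "K T = (\<integral>x. u (x - T *\<^sub>R \<theta>) * \<psi> x \<partial>lborel)"
      using integral_lborel_translate[of "\<lambda>x. u x * \<psi> (x + T *\<^sub>R \<theta>)" "- (T *\<^sub>R \<theta>)"] by (simp add: K_def)
    have g\<psi>: "g x * \<psi> x = u x * \<psi> x - u (x - T *\<^sub>R \<theta>) * \<psi> x - F x * \<psi> x" for x
    proof (cases "x \<in> cbox a b")
      case False
      then show ?thesis by (simp add: Z)
    qed (simp add: g_def algebra_simps)
    have i1: "integrable lborel (\<lambda>x. u x * \<psi> x)" "integrable lborel (\<lambda>x. u (x - T *\<^sub>R \<theta>) * \<psi> x)"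
      by (rule integrable_mult_bounded[OF u, of _ B] integrable_mult_bounded[OF uT, of _ B]; simp add: B)+
    have i2: "integrable lborel (\<lambda>x. F x * \<psi> x)"
      using lborel_pair.integrable_fst[OF Hi] by (simp add: HF)
    have "(\<integral>x. g x * \<psi> x \<partial>lborel) = K 0 - K T - (\<integral>x. F x * \<psi> x \<partial>lborel)"
      using i1 i2 unfolding g\<psi> KT by (simp add: K_def)
    then show "(\<integral>x. g x * \<psi> x \<partial>lborel) = 0" using main by simp
  qed
  then show ?thesis
  proof eventually_elim
    case (elim x)
    then show ?case using box_subset_cbox[of a b] by (auto simp: g_def F_def)
  qed
qed

text \<open>For negative T the condition is void, since \<open>{0..T}\<close> is empty. Otherwise
  the segment is compact and has a whole neighbourhood of radius e in X; a nearby segment may be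
  slightly longer, which is handled by comparing its parameter s with \<open>min s T\<close>.
  Openness provides both the countable cover by boxes and the joint measurability in the next
  lemma.\<close>

lemma open_segment_domain:
  fixes X :: "'a::euclidean_space set"
  assumes X: "open X"
  shows "open {(x, T). \<forall>s\<in>{0..T}. x - s *\<^sub>R \<theta> \<in> X}" (is "open ?O")
proof (rule openI)
  fix z assume "z \<in> ?O"
  then obtain x T where z: "z = (x, T)" and xT: "\<And>s. 0 \<le> s \<Longrightarrow> s \<le> T \<Longrightarrow> x - s *\<^sub>R \<theta> \<in> X" by (cases z) auto
  show "\<exists>e>0. ball z e \<subseteq> ?O"
  proof (cases "T < 0")
    case True
    have "ball z (- T) \<subseteq> ?O"
    proof
      fix w assume "w \<in> ball z (- T)"
      then have "dist T (snd w) < - T" using dist_snd_le[of z w] by (simp add: z)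
      then show "w \<in> ?O" by (cases w) (auto simp: dist_real_def)
    qed
    then show ?thesis using True by (intro exI[of _ "- T"]) simp
  next
    case False
    have "compact ((\<lambda>s. x - s *\<^sub>R \<theta>) ` {0..T})" by (intro compact_continuous_image continuous_intros) simp
    moreover have "(\<lambda>s. x - s *\<^sub>R \<theta>) ` {0..T} \<subseteq> X" using xT by auto
    ultimately obtain e where e: "e > 0" "(\<Union>y\<in>(\<lambda>s. x - s *\<^sub>R \<theta>) ` {0..T}. ball y e) \<subseteq> X"
      using compact_subset_open_imp_ball_epsilon_subset[OF _ X] by metis
    define n where "n = 1 + norm \<theta>"
    have n: "0 < n" by (simp add: n_def add_pos_nonneg)
    define d where "d = e / n / 2"
    have d: "0 < d" and de: "d * n = e / 2" using e(1) n by (auto simp: d_def)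
    have "ball z d \<subseteq> ?O"
    proof
      fix w assume w: "w \<in> ball z d"
      obtain x' T' where w': "w = (x', T')" by (cases w)
      have dx: "dist x x' < d" "\<bar>T - T'\<bar> < d"
        using w dist_fst_le[of z w] dist_snd_le[of z w] by (auto simp: z w' dist_real_def)
      have "x' - s *\<^sub>R \<theta> \<in> X" if s: "0 \<le> s" "s \<le> T'" for s
      proof -
        define s' where "s' = min s T"
        have s': "s' \<in> {0..T}" "\<bar>s - s'\<bar> < d" using False s dx d by (auto simp: s'_def min_def)
        have "dist (x - s' *\<^sub>R \<theta>) (x' - s *\<^sub>R \<theta>) = norm ((x - x') + (s - s') *\<^sub>R \<theta>)"
          by (simp add: dist_norm algebra_simps)
        also have "\<dots> \<le> norm (x - x') + \<bar>s - s'\<bar> * norm \<theta>"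
          by (metis norm_scaleR norm_triangle_ineq)
        also have "\<dots> \<le> d + d * norm \<theta>"
          using dx(1) s'(2) by (intro add_mono mult_right_mono) (auto simp: dist_norm)
        also have "\<dots> < e" using de e(1) by (simp add: n_def algebra_simps)
        finally have "x' - s *\<^sub>R \<theta> \<in> ball (x - s' *\<^sub>R \<theta>) e" by simp
        then show ?thesis using e(2) s'(1) by blast
      qed
      then show "w \<in> ?O" by (simp add: w')
    qed
    then show ?thesis using d by blast
  qed
qed

text \<open>For fixed T the admissible x form an open set, a countable union of closed boxes whose
  faces are null; on each box the translation identity holds. This gives almost every x for every T.
  To exchange the quantifiers and obtain almost every T on almost every line, the property must be
  jointly measurable, which is the purpose of \<open>Pm\<close>.\<close>

lemma weak_transport_along_lines:
  fixes u f :: "'a::euclidean_space \<Rightarrow> real"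
  assumes X: "open X" and u: "integrable lborel u"
    and fm[measurable]: "f \<in> borel_measurable borel" and fC: "\<And>x. \<bar>f x\<bar> \<le> C"
    and weak: "\<And>\<psi>. test_function X \<psi> \<Longrightarrow>
      (\<integral>x. u x * frechet_derivative \<psi> (at x) \<theta> \<partial>lborel) = - (\<integral>x. f x * \<psi> x \<partial>lborel)"
  shows "AE x in lborel. AE T in lborel. 0 \<le> T \<longrightarrow> (\<forall>s\<in>{0..T}. x - s *\<^sub>R \<theta> \<in> X) \<longrightarrow>
    u x - u (x - T *\<^sub>R \<theta>) = (\<integral>s. indicator {0..T} s * f (x - s *\<^sub>R \<theta>) \<partial>lborel)"
proof -
  have um[measurable]: "u \<in> borel_measurable borel" using u by auto
  define O' where "O' = {(x, T). \<forall>s\<in>{0..T}. x - s *\<^sub>R \<theta> \<in> X}"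
  have O': "open O'" unfolding O'_def by (rule open_segment_domain[OF X])
  have Om[measurable]: "O' \<in> sets (borel \<Otimes>\<^sub>M borel)"
    using borel_open[OF O'] unfolding borel_prod[symmetric] by (simp only:)
  define P where "P x T \<longleftrightarrow> (0 \<le> T \<longrightarrow> (x, T) \<in> O' \<longrightarrow>
    u x - u (x - T *\<^sub>R \<theta>) = (\<integral>s. indicator {0..T} s * f (x - s *\<^sub>R \<theta>) \<partial>lborel))" for x T
  have Pm: "Measurable.pred (lborel \<Otimes>\<^sub>M lborel) (\<lambda>z. P (fst z) (snd z))"
    unfolding P_def prod.collapse
  proof (intro pred_intros_logic)
    show "Measurable.pred (lborel \<Otimes>\<^sub>M lborel) (\<lambda>z::'a \<times> real. 0 \<le> snd z)" by measurable
    have "sets ((lborel :: 'a measure) \<Otimes>\<^sub>M (lborel :: real measure)) = sets (borel \<Otimes>\<^sub>M borel)"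
      by (intro sets_pair_measure_cong) auto
    then show "Measurable.pred (lborel \<Otimes>\<^sub>M lborel) (\<lambda>z. z \<in> O')"
      using Om by (simp add: pred_def space_pair_measure)
    have "(\<integral>s. indicator {0..T} s * f (x - s *\<^sub>R \<theta>) \<partial>lborel)
        = (\<integral>s. (if 0 \<le> s \<and> s \<le> T then f (x - s *\<^sub>R \<theta>) else 0) \<partial>lborel)" for x T
      by (rule Bochner_Integration.integral_cong) auto
    then show "Measurable.pred (lborel \<Otimes>\<^sub>M lborel) (\<lambda>z. u (fst z) - u (fst z - snd z *\<^sub>R \<theta>)
        = (\<integral>s. indicator {0..snd z} s * f (fst z - s *\<^sub>R \<theta>) \<partial>lborel))"
      by simp
  qed
  have "AE x in lborel. P x T" for T
  proof (cases "0 \<le> T")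
    case T: True
    have "open {x. (x, T) \<in> O'}"
      using open_vimage[OF O', of "\<lambda>x. (x, T)"] by (simp add: vimage_def continuous_on_Pair)
    then obtain \<D> where \<D>: "countable \<D>" "\<D> \<subseteq> Pow {x. (x, T) \<in> O'}" "\<And>Y. Y \<in> \<D> \<Longrightarrow> \<exists>a b. Y = cbox a b"
      "\<Union>\<D> = {x. (x, T) \<in> O'}"
      by (rule open_countable_Union_open_cbox) blast
    have "AE x in lborel. x \<in> Y \<longrightarrow> P x T" if Y: "Y \<in> \<D>" for Y
    proof -
      obtain a b where ab: "Y = cbox a b" using \<D>(3)[OF Y] by blast
      have "cbox a b - box a b \<in> null_sets lborel"
        using negligible_frontier_interval[of a b] null_sets_completion_iff[of "cbox a b - box a b" lborel]
        by (simp add: negligible_iff_null_sets)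
      then have 1: "AE x in lborel. x \<notin> cbox a b - box a b" by (rule AE_not_in)
      have 2: "AE x in lborel. x \<in> box a b \<longrightarrow>
          u x - u (x - T *\<^sub>R \<theta>) = (\<integral>s. indicator {0..T} s * f (x - s *\<^sub>R \<theta>) \<partial>lborel)"
      proof (rule weak_transport_translate[OF u fm fC T weak])
        fix x s assume "x \<in> cbox a b" "0 \<le> s" "s \<le> T"
        moreover have "(x, T) \<in> O'" using \<D>(2) Y ab \<open>x \<in> cbox a b\<close> by blast
        ultimately show "x - s *\<^sub>R \<theta> \<in> X" by (simp add: O'_def)
      qed
      show ?thesis using 1 2 by eventually_elim (auto simp: P_def ab)
    qed
    then have "AE x in lborel. \<forall>Y\<in>\<D>. x \<in> Y \<longrightarrow> P x T"
      using AE_ball_countable[OF \<D>(1), of "\<lambda>x Y. x \<in> Y \<longrightarrow> P x T" lborel] by blast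
    then show ?thesis
    proof eventually_elim
      case (elim x)
      then show ?case using \<D>(4) by (cases "(x, T) \<in> O'") (auto simp: P_def)
    qed
  qed (simp add: P_def)
  then have "AE T in lborel. AE x in lborel. P x T" by simp
  then have "AE x in lborel. AE T in lborel. P x T"
    using lborel_pair.AE_commute[of P] Pm by (simp add: pred_def)
  then show ?thesis by (simp add: P_def O'_def)
qed

section \<open>Lines meeting the boundary\<close>

lemma frechet_derivative_eq_gradient:
  fixes f :: "'a::euclidean_space \<Rightarrow> real"
  assumes "f differentiable at x"
  shows "frechet_derivative f (at x) v = gradient f x \<bullet> v"
proof -
  have lin: "linear (frechet_derivative f (at x))"
    using assms by (simp add: linear_frechet_derivative)
  have "frechet_derivative f (at x) v = frechet_derivative f (at x) (\<Sum>b\<in>Basis. (v \<bullet> b) *\<^sub>R b)"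
    by (simp add: euclidean_representation)
  also have "\<dots> = (\<Sum>b\<in>Basis. (v \<bullet> b) * frechet_derivative f (at x) b)"
    by (simp add: linear_sum[OF lin] linear_scale[OF lin])
  also have "\<dots> = gradient f x \<bullet> v"
    by (simp add: gradient_def inner_sum_left inner_commute[of v] mult.commute)
  finally show ?thesis .
qed

lemma local_defining_functionD:
  fixes X :: "'a::euclidean_space set"
  assumes "local_defining_function X y U r"
  shows "open U" "y \<in> U" "\<And>x. x \<in> U \<Longrightarrow> gradient r x \<noteq> 0" "\<And>x. x \<in> U \<Longrightarrow> x \<in> X \<longleftrightarrow> r x < 0"
    and "\<And>x. x \<in> U \<Longrightarrow> (r has_derivative (\<lambda>v. gradient r x \<bullet> v)) (at x)"
    and "continuous_on U r" "\<And>v. continuous_on U (\<lambda>x. gradient r x \<bullet> v)"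
proof -
  show U: "open U" and "y \<in> U" and "\<And>x. x \<in> U \<Longrightarrow> gradient r x \<noteq> 0" and "\<And>x. x \<in> U \<Longrightarrow> x \<in> X \<longleftrightarrow> r x < 0"
    using assms by (auto simp: local_defining_function_def)
  have "Ck_on 0 U r" and "Ck_on (Suc 0) U r"
    using assms by (auto simp: local_defining_function_def smooth_fun_on_def)
  then have c0: "continuous_on U r" and d: "r differentiable_on U"
    and c: "\<And>v. continuous_on U (\<lambda>x. frechet_derivative r (at x) v)" by auto
  have d': "r differentiable at x" if "x \<in> U" for x
    using d that U by (simp add: differentiable_on_eq_differentiable_at)
  show "continuous_on U r" by (rule c0)
  show "(r has_derivative (\<lambda>v. gradient r x \<bullet> v)) (at x)" if "x \<in> U" for x
    using d'[OF that] frechet_derivative_works[of r "at x"] frechet_derivative_eq_gradient[OF d'[OF that]]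
    by (metis (no_types, lifting) ext)
  show "continuous_on U (\<lambda>x. gradient r x \<bullet> v)" for v
    using c[of v] by (rule continuous_on_eq) (simp add: frechet_derivative_eq_gradient d')
qed

lemma has_derivative_along_line:
  fixes r :: "'a::euclidean_space \<Rightarrow> real"
  assumes "(r has_derivative (\<lambda>v. g \<bullet> v)) (at (x + t *\<^sub>R d))"
  shows "((\<lambda>t. r (x + t *\<^sub>R d)) has_real_derivative g \<bullet> d) (at t)"
proof -
  have "((\<lambda>t. x + t *\<^sub>R d) has_derivative (\<lambda>h. h *\<^sub>R d)) (at t)"
    by (auto intro!: derivative_eq_intros)
  then have "((\<lambda>t. r (x + t *\<^sub>R d)) has_derivative (\<lambda>h. g \<bullet> (h *\<^sub>R d))) (at t)"
    by (rule has_derivative_compose) (rule assms)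
  then show ?thesis by (simp add: has_field_derivative_def mult_commute_abs)
qed

text \<open>The definition describes only the set where r is negative. That r vanishes on the
  boundary has to be derived: a positive value would give an open neighbourhood disjoint from
  X.\<close>

lemma defining_function_zero:
  fixes X :: "'a::euclidean_space set"
  assumes X: "open X" and y: "y \<in> frontier X" and L: "local_defining_function X z U r" and yU: "y \<in> U"
  shows "r y = 0"
proof -
  note D = local_defining_functionD[OF L]
  have "y \<notin> X" using y X by (simp add: frontier_def interior_open)
  then have ge: "0 \<le> r y" using D(4)[OF yU] by linarith
  have "r y \<le> 0"
  proof (rule ccontr)
    assume "\<not> r y \<le> 0"
    then have "open {x\<in>U. 0 < r x}" "y \<in> {x\<in>U. 0 < r x}"
      using continuous_on_open_vimage[THEN iffD1, OF D(1) D(6), rule_format, of "{0<..}"] yU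
      by (auto simp: vimage_def Int_def conj_commute)
    moreover have "X \<inter> {x\<in>U. 0 < r x} = {}" using D(4) by force
    moreover have "y \<in> closure X" using y by (simp add: frontier_def)
    ultimately show False by (metis disjoint_iff open_Int_closure_eq_empty)
  qed
  with ge show ?thesis by linarith
qed

lemma directional_sign:
  fixes r :: "'a::euclidean_space \<Rightarrow> real"
  assumes U: "open U" "y \<in> U" and d: "(r has_derivative (\<lambda>v. g \<bullet> v)) (at y)" and r0: "r y = 0"
  shows "g \<bullet> v < 0 \<Longrightarrow> \<exists>\<delta>>0. \<forall>t. 0 < t \<and> t < \<delta> \<longrightarrow> y + t *\<^sub>R v \<in> U \<and> r (y + t *\<^sub>R v) < 0"
    and "0 < g \<bullet> v \<Longrightarrow> \<exists>\<delta>>0. \<forall>t. 0 < t \<and> t < \<delta> \<longrightarrow> y + t *\<^sub>R v \<in> U \<and> 0 < r (y + t *\<^sub>R v)"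
proof -
  have der: "((\<lambda>t. r (y + t *\<^sub>R v)) has_real_derivative g \<bullet> v) (at 0)"
    using has_derivative_along_line[of r g y 0 v] d by simp
  have "open ((\<lambda>t. y + t *\<^sub>R v) -` U)" by (intro open_vimage U continuous_intros)
  then obtain \<epsilon> where \<epsilon>: "0 < \<epsilon>" "ball 0 \<epsilon> \<subseteq> (\<lambda>t. y + t *\<^sub>R v) -` U"
    using U(2) by (metis (no_types, lifting) add.right_neutral open_contains_ball scaleR_zero_left vimageI)
  have inU: "y + t *\<^sub>R v \<in> U" if "0 < t" "t < \<epsilon>" for t using \<epsilon>(2) that by (auto simp: subset_iff)
  show "\<exists>\<delta>>0. \<forall>t. 0 < t \<and> t < \<delta> \<longrightarrow> y + t *\<^sub>R v \<in> U \<and> r (y + t *\<^sub>R v) < 0" if v: "g \<bullet> v < 0"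
  proof -
    obtain \<delta> where "0 < \<delta>" "\<forall>h>0. h < \<delta> \<longrightarrow> r (y + (0 + h) *\<^sub>R v) < r (y + 0 *\<^sub>R v)"
      using DERIV_neg_dec_right[OF der v] by auto
    then show ?thesis using \<epsilon>(1) inU r0 by (intro exI[of _ "min \<delta> \<epsilon>"]) auto
  qed
  show "\<exists>\<delta>>0. \<forall>t. 0 < t \<and> t < \<delta> \<longrightarrow> y + t *\<^sub>R v \<in> U \<and> 0 < r (y + t *\<^sub>R v)" if v: "0 < g \<bullet> v"
  proof -
    obtain \<delta> where "0 < \<delta>" "\<forall>h>0. h < \<delta> \<longrightarrow> r (y + (0 + h) *\<^sub>R v) > r (y + 0 *\<^sub>R v)"
      using DERIV_pos_inc_right[OF der v] by auto
    then show ?thesis using \<epsilon>(1) inU r0 by (intro exI[of _ "min \<delta> \<epsilon>"]) auto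
  qed
qed

text \<open>If two defining functions had different unit gradients at y, the difference v of these
  unit vectors would have positive product with one and negative product with the other; moving from
  y along v would then leave X according to one function and enter it according to the other. The
  formula is stated for all boundary points y in the chart around z, so that one r describes the
  normal on a whole neighbourhood.\<close>

lemma outward_normal_eq:
  fixes X :: "'a::euclidean_space set"
  assumes X: "open X" and y: "y \<in> frontier X" and L: "local_defining_function X z U r" and yU: "y \<in> U"
  shows "outward_normal X y = sgn (gradient r y)"
proof -
  have L': "local_defining_function X y U r" using L yU by (simp add: local_defining_function_def)
  show ?thesis
    unfolding outward_normal_def
  proof (rule the_equality)
    show "\<exists>U' r'. local_defining_function X y U' r' \<and> sgn (gradient r y) = sgn (gradient r' y)"
      using L' by blast
    fix \<nu> assume "\<exists>U' r'. local_defining_function X y U' r' \<and> \<nu> = sgn (gradient r' y)"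
    then obtain U' r' where L2: "local_defining_function X y U' r'" and \<nu>: "\<nu> = sgn (gradient r' y)" by blast
    note D = local_defining_functionD[OF L'] and D' = local_defining_functionD[OF L2]
    let ?g = "gradient r y" and ?g' = "gradient r' y"
    show "\<nu> = sgn ?g"
    proof (rule ccontr)
      assume ne: "\<nu> \<noteq> sgn ?g"
      define v where "v = sgn ?g - sgn ?g'"
      have n1: "norm (sgn ?g) = 1" "norm (sgn ?g') = 1" using D(3) D'(3) yU D'(2) by (auto simp: norm_sgn)
      have ss: "sgn ?g \<bullet> sgn ?g = 1" "sgn ?g' \<bullet> sgn ?g' = 1"
        unfolding dot_square_norm using n1 by simp_all
      have "0 < (sgn ?g - sgn ?g') \<bullet> (sgn ?g - sgn ?g')" using ne \<nu> by simp
      then have "sgn ?g \<bullet> sgn ?g' < 1" using ss by (simp add: inner_diff inner_commute)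
      then have s: "0 < sgn ?g \<bullet> v" "sgn ?g' \<bullet> v < 0"
        using ss by (simp_all add: v_def inner_diff inner_commute)
      have "0 < ?g \<bullet> v" "?g' \<bullet> v < 0"
      proof -
        have sg: "g \<bullet> v = norm g * (sgn g \<bullet> v)" for g :: 'a by (cases "g = 0") (auto simp: sgn_div_norm)
        have "0 < norm ?g" "0 < norm ?g'" using D(3)[OF yU] D'(3)[OF D'(2)] by auto
        then show "0 < ?g \<bullet> v" "?g' \<bullet> v < 0" using s unfolding sg[of ?g] sg[of ?g'] by (auto intro: mult_pos_pos mult_pos_neg)
      qed
      then obtain \<delta> \<delta>' where "0 < \<delta>" and 1: "\<And>t. 0 < t \<Longrightarrow> t < \<delta> \<Longrightarrow> y + t *\<^sub>R v \<in> U \<and> 0 < r (y + t *\<^sub>R v)"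
        and "0 < \<delta>'" and 2: "\<And>t. 0 < t \<Longrightarrow> t < \<delta>' \<Longrightarrow> y + t *\<^sub>R v \<in> U' \<and> r' (y + t *\<^sub>R v) < 0"
        using directional_sign(2)[OF D(1) yU D(5)[OF yU] defining_function_zero[OF X y L' yU], of v]
          directional_sign(1)[OF D'(1,2) D'(5)[OF D'(2)] defining_function_zero[OF X y L2 D'(2)], of v]
        by blast
      define t where "t = min \<delta> \<delta>' / 2"
      have t: "0 < t" "t < \<delta>" "t < \<delta>'" using \<open>0 < \<delta>\<close> \<open>0 < \<delta>'\<close> by (auto simp: t_def)
      then have "y + t *\<^sub>R v \<notin> X" using 1 D(4) by fastforce
      moreover have "y + t *\<^sub>R v \<in> X" using t 2 D'(4) by blast
      ultimately show False by blast
    qed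
  qed
qed

text \<open>A direction pointing strictly outward would make the defining function positive just
  after y. Tangency cannot be excluded at an individual point; it is disposed of later by
  measure.\<close>

lemma entering_line_tangent_or_inflow:
  fixes X :: "'a::euclidean_space set"
  assumes X: "smooth_bounded_domain X" and y: "y \<in> frontier X" and \<theta>: "\<theta> \<in> sphere 0 1"
    and \<delta>: "0 < \<delta>" "\<And>t. 0 < t \<Longrightarrow> t < \<delta> \<Longrightarrow> y + t *\<^sub>R \<theta> \<in> X"
  shows "(y, \<theta>) \<in> Gamma_minus X \<or> \<theta> \<bullet> outward_normal X y = 0"
proof -
  have op: "open X" using X by (simp add: smooth_bounded_domain_def)
  obtain U r where L: "local_defining_function X y U r" using X y unfolding smooth_bounded_domain_def by blast
  note D = local_defining_functionD[OF L]
  have n: "outward_normal X y = sgn (gradient r y)" by (rule outward_normal_eq[OF op y L D(2)])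
  have "\<not> 0 < gradient r y \<bullet> \<theta>"
  proof
    assume "0 < gradient r y \<bullet> \<theta>"
    then obtain \<delta>' where \<delta>': "0 < \<delta>'" "\<And>t. 0 < t \<Longrightarrow> t < \<delta>' \<Longrightarrow> y + t *\<^sub>R \<theta> \<in> U \<and> 0 < r (y + t *\<^sub>R \<theta>)"
      using directional_sign(2)[OF D(1,2) D(5)[OF D(2)] defining_function_zero[OF op y L D(2)], of \<theta>] by blast
    define t where "t = min \<delta> \<delta>' / 2"
    have "0 < t" "t < \<delta>" "t < \<delta>'" using \<delta> \<delta>' by (auto simp: t_def)
    then show False using \<delta>(2)[of t] \<delta>'(2)[of t] D(4)[of "y + t *\<^sub>R \<theta>"] by force
  qed
  then have "\<theta> \<bullet> outward_normal X y \<le> 0"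
    by (simp add: n sgn_div_norm inner_commute mult_nonneg_nonpos)
  then show ?thesis using y \<theta> by (auto simp: Gamma_minus_def)
qed

section \<open>Null sets swept out by parallel lines\<close>

lemma null_cover:
  fixes S :: "'a::euclidean_space set"
  assumes "\<And>e::real. 0 < e \<Longrightarrow> \<exists>T\<in>sets borel. S \<subseteq> T \<and> emeasure lborel T \<le> ennreal e"
  obtains N where "N \<in> null_sets lborel" "S \<subseteq> N"
proof -
  have "\<forall>n. \<exists>T\<in>sets borel. S \<subseteq> T \<and> emeasure lborel T \<le> ennreal (inverse (Suc n))" using assms by simp
  then obtain T where T: "\<And>n. T n \<in> sets borel" "\<And>n. S \<subseteq> T n" "\<And>n. emeasure lborel (T n) \<le> ennreal (inverse (Suc n))"
    by metis
  let ?N = "\<Inter>n::nat. T n"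
  have m: "?N \<in> sets lborel" using T(1) by auto
  have "emeasure lborel ?N \<le> ennreal (inverse (Suc n))" for n
    using T(1) by (intro order_trans[OF emeasure_mono T(3)[of n]]) auto
  then have "emeasure lborel ?N \<le> 0"
    using LIMSEQ_le_const[OF tendsto_ennrealI[OF LIMSEQ_inverse_real_of_nat]] by (metis ennreal_0)
  then have "?N \<in> null_sets lborel" using m by (simp add: null_sets_def)
  then show thesis using T(2) by (intro that[of ?N]) auto
qed

text \<open>Tonelli and translation invariance. It is used from both sides: a lower bound of the
  inner integral estimates the set of lines that spend a given length in \<open>E\<close>, an upper
  bound estimates the volume of \<open>E\<close> by the length of its sections.\<close>

lemma nn_integral_sweep:
  fixes E :: "'a::euclidean_space set"
  assumes E[measurable]: "E \<in> sets borel" and ab: "a \<le> b"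
  shows "(\<integral>\<^sup>+x. (\<integral>\<^sup>+s. indicator {a..b} s * indicator E (x + s *\<^sub>R d) \<partial>(lborel :: real measure)) \<partial>lborel)
    = ennreal (b - a) * emeasure lborel E"
proof -
  have "(\<integral>\<^sup>+x. (\<integral>\<^sup>+s. indicator {a..b} s * indicator E (x + s *\<^sub>R d) \<partial>(lborel :: real measure)) \<partial>lborel)
      = (\<integral>\<^sup>+s. (\<integral>\<^sup>+x. indicator {a..b} s * indicator E (x + s *\<^sub>R d) \<partial>lborel) \<partial>(lborel :: real measure))"
    by (rule lborel_pair.Fubini'[symmetric]) measurable
  also have "\<dots> = (\<integral>\<^sup>+s. indicator {a..b} s * emeasure lborel E \<partial>(lborel :: real measure))"
  proof (rule nn_integral_cong)
    fix s :: real
    have "(\<integral>\<^sup>+x. indicator {a..b} s * indicator E (x + s *\<^sub>R d) \<partial>lborel)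
        = indicator {a..b} s * (\<integral>\<^sup>+x. indicator E (x + s *\<^sub>R d) \<partial>lborel)"
      by (rule nn_integral_cmult) measurable
    also have "(\<integral>\<^sup>+x. indicator E (x + s *\<^sub>R d) \<partial>lborel) = emeasure lborel E"
      by (subst nn_integral_lborel_translate) auto
    finally show "(\<integral>\<^sup>+x. indicator {a..b} s * indicator E (x + s *\<^sub>R d) \<partial>lborel) = indicator {a..b} s * emeasure lborel E" .
  qed
  also have "\<dots> = ennreal (b - a) * emeasure lborel E"
    using ab by (subst nn_integral_multc) auto
  finally show ?thesis .
qed

lemma sweep_measure_bound:
  fixes A E :: "'a::euclidean_space set"
  assumes A: "A \<in> sets borel" and E: "E \<in> sets borel" and ab: "a \<le> b" and \<delta>: "0 \<le> \<delta>"
    and len: "\<And>x. x \<in> A \<Longrightarrow> \<exists>c. {c..c + \<delta>} \<subseteq> {a..b} \<and> (\<forall>s\<in>{c..c + \<delta>}. x + s *\<^sub>R d \<in> E)"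
  shows "emeasure lborel A * ennreal \<delta> \<le> ennreal (b - a) * emeasure lborel E"
proof -
  have [measurable]: "A \<in> sets borel" "E \<in> sets borel" by fact+
  have "emeasure lborel A * ennreal \<delta> = (\<integral>\<^sup>+x. ennreal \<delta> * indicator A x \<partial>lborel)"
    by (subst nn_integral_cmult_indicator) (auto simp: mult.commute)
  also have "\<dots> \<le> (\<integral>\<^sup>+x. (\<integral>\<^sup>+s. indicator {a..b} s * indicator E (x + s *\<^sub>R d) \<partial>lborel) \<partial>lborel)"
  proof (rule nn_integral_mono)
    fix x :: 'a
    show "ennreal \<delta> * indicator A x \<le> (\<integral>\<^sup>+s. indicator {a..b} s * indicator E (x + s *\<^sub>R d) \<partial>lborel)"
    proof (cases "x \<in> A")
      case True
      then obtain c where c: "{c..c + \<delta>} \<subseteq> {a..b}" "\<forall>s\<in>{c..c + \<delta>}. x + s *\<^sub>R d \<in> E" using len by blast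
      have "ennreal \<delta> = (\<integral>\<^sup>+s. indicator {c..c + \<delta>} s \<partial>lborel)" using \<delta> by simp
      also have "\<dots> \<le> (\<integral>\<^sup>+s. indicator {a..b} s * indicator E (x + s *\<^sub>R d) \<partial>lborel)"
        using c by (intro nn_integral_mono) (auto simp: indicator_def)
      finally show ?thesis using True by simp
    qed simp
  qed
  also have "\<dots> = ennreal (b - a) * emeasure lborel E" by (rule nn_integral_sweep[OF E ab])
  finally show ?thesis .
qed

text \<open>As r grows at rate at least c in direction e, any two points of \<open>E\<close> on a
  line parallel to e are at most 2 \<eta> / c apart. Integrating the lengths of these sections over
  the starting points bounds the volume; the points that reach \<open>E\<close> within parameter
  distance 1 lie in the ball of radius \<rho> + 1.\<close>

lemma monotone_slab_measure:
  fixes E :: "'a::euclidean_space set" and r :: "'a \<Rightarrow> real"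
  assumes E: "E \<in> sets borel" "E \<subseteq> cball y \<rho>" and \<rho>: "0 \<le> \<rho>" and e: "norm e = 1" and c: "0 < c" and \<eta>: "0 \<le> \<eta>"
    and small: "\<And>x. x \<in> E \<Longrightarrow> \<bar>r x\<bar> \<le> \<eta>"
    and mono: "\<And>x t. x \<in> cball y \<rho> \<Longrightarrow> x + t *\<^sub>R e \<in> cball y \<rho> \<Longrightarrow> 0 \<le> t \<Longrightarrow> c * t \<le> r (x + t *\<^sub>R e) - r x"
  shows "emeasure lborel E \<le> ennreal (2 * \<eta> / c) * emeasure lborel (cball y (\<rho> + 1))"
proof -
  have [measurable]: "E \<in> sets borel" by fact
  let ?B = "cball y (\<rho> + 1)"
  have "2 * emeasure lborel E
      = (\<integral>\<^sup>+x. (\<integral>\<^sup>+s. indicator {-1..1} s * indicator E (x + s *\<^sub>R e) \<partial>(lborel :: real measure)) \<partial>lborel)"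
    using nn_integral_sweep[OF E(1), of "-1" 1 e] by simp
  \<comment> \<open>A section through \<open>s0\<close> lies in the interval of radius 2 \<eta> / c
    about \<open>s0\<close>, of length 4 \<eta> / c; the factor 2 on the left, the length of
    \<open>{-1..1}\<close>, halves this in the end.\<close>
  also have "\<dots> \<le> (\<integral>\<^sup>+x. ennreal (4 * \<eta> / c) * indicator ?B x \<partial>lborel)"
  proof (rule nn_integral_mono)
    fix x :: 'a
    show "(\<integral>\<^sup>+s. indicator {-1..1} s * indicator E (x + s *\<^sub>R e) \<partial>lborel) \<le> ennreal (4 * \<eta> / c) * indicator ?B x"
    proof (cases "\<exists>s\<in>{-1..1}. x + s *\<^sub>R e \<in> E")
      case False
      then have "(\<integral>\<^sup>+s. indicator {-1..1} s * indicator E (x + s *\<^sub>R e) \<partial>lborel) = (\<integral>\<^sup>+s. 0 \<partial>(lborel :: real measure))"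
        by (intro nn_integral_cong) (auto simp: indicator_def)
      then show ?thesis by simp
    next
      case True
      then obtain s0 where s0: "s0 \<in> {-1..1}" "x + s0 *\<^sub>R e \<in> E" by blast
      have "dist y x \<le> dist y (x + s0 *\<^sub>R e) + dist (x + s0 *\<^sub>R e) x" by (rule dist_triangle)
      also have "\<dots> \<le> \<rho> + 1" using s0 E(2) e by (intro add_mono) (auto simp: dist_norm)
      finally have xB: "x \<in> ?B" by simp
      have close: "t - s \<le> 2 * \<eta> / c" if "x + s *\<^sub>R e \<in> E" "x + t *\<^sub>R e \<in> E" "s \<le> t" for s t
      proof -
        have "c * (t - s) \<le> r (x + s *\<^sub>R e + (t - s) *\<^sub>R e) - r (x + s *\<^sub>R e)"
          by (rule mono) (use that E(2) in \<open>auto simp: algebra_simps\<close>)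
        also have "x + s *\<^sub>R e + (t - s) *\<^sub>R e = x + t *\<^sub>R e" by (simp add: algebra_simps)
        finally have "c * (t - s) \<le> 2 * \<eta>" using small[OF that(1)] small[OF that(2)] by linarith
        then show ?thesis using c by (simp add: field_simps)
      qed
      have "(\<integral>\<^sup>+s. indicator {-1..1} s * indicator E (x + s *\<^sub>R e) \<partial>lborel)
          \<le> (\<integral>\<^sup>+s. indicator {s0 - 2 * \<eta> / c..s0 + 2 * \<eta> / c} s \<partial>(lborel :: real measure))"
      proof (rule nn_integral_mono)
        fix s :: real
        have "s \<in> {s0 - 2 * \<eta> / c..s0 + 2 * \<eta> / c}" if "x + s *\<^sub>R e \<in> E"
          using close[OF that s0(2)] close[OF s0(2) that] that c \<eta> by (cases "s \<le> s0") auto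
        then show "indicator {-1..1} s * indicator E (x + s *\<^sub>R e) \<le> (indicator {s0 - 2 * \<eta> / c..s0 + 2 * \<eta> / c} s :: ennreal)"
          by (auto simp: indicator_def)
      qed
      also have "\<dots> = ennreal (4 * \<eta> / c)" using c \<eta> by (simp add: field_simps)
      finally show ?thesis using xB by simp
    qed
  qed
  also have "\<dots> = ennreal (4 * \<eta> / c) * emeasure lborel ?B" by (subst nn_integral_cmult_indicator) auto
  also have "\<dots> = 2 * (ennreal (2 * \<eta> / c) * emeasure lborel ?B)"
    using c \<eta> by (subst mult.assoc[symmetric]) (simp add: ennreal_mult[symmetric] ennreal_numeral[symmetric] del: ennreal_numeral)
  finally show ?thesis by (simp add: ennreal_mult_le_mult_iff)
qed


text \<open>Dividing by K + 1 instead of K makes an error small without a separate case K =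
  0.\<close>

lemma mult_div_add_one_le:
  fixes K \<eta> :: real
  assumes "0 \<le> K" "0 \<le> \<eta>"
  shows "K * (\<eta> / (K + 1)) \<le> \<eta>"
proof -
  have "K * (\<eta> / (K + 1)) = \<eta> * (K / (K + 1))" by simp
  also have "\<dots> \<le> \<eta> * 1" using assms by (intro mult_left_mono) (auto simp: divide_le_eq_1)
  finally show ?thesis by simp
qed

text \<open>A line tangent to \<open>{r = 0}\<close> spends length \<open>\<delta>\<close> in the slab \<open>{|r| \<le> \<epsilon>\<delta>}\<close>, whose volume is \<open>O(\<epsilon>\<delta>)\<close>; so
  by Tonelli's theorem the tangent lines fill a set of measure \<open>O(\<epsilon>)\<close>.\<close>

lemma tangential_lines_null_local:
  fixes X :: "'a::euclidean_space set"
  assumes X: "open X" and L: "local_defining_function X y\<^sub>0 U r"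
    and \<theta>: "norm \<theta> = 1" and R: "0 \<le> R"
  shows "\<exists>\<rho>>0. \<exists>N\<in>null_sets lborel.
    {x. \<exists>t\<in>{0..R}. x - t *\<^sub>R \<theta> \<in> frontier X \<inter> ball y\<^sub>0 \<rho> \<and> \<theta> \<bullet> outward_normal X (x - t *\<^sub>R \<theta>) = 0} \<subseteq> N"
proof -
  note D = local_defining_functionD[OF L]
  \<comment> \<open>\<open>e\<close> is the direction of steepest ascent of r at
    \<open>y\<^sub>0\<close> and \<open>c\<close> half of the slope there, so that the slope in
    direction \<open>e\<close> exceeds \<open>c\<close> on a whole ball by continuity. This is the
    transversal direction in which the slab is thin.\<close>
  define e where "e = sgn (gradient r y\<^sub>0)"
  define c where "c = norm (gradient r y\<^sub>0) / 2"
  have g0: "gradient r y\<^sub>0 \<noteq> 0" by (rule D(3)[OF D(2)])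
  have e: "norm e = 1" and c: "0 < c" using g0 by (auto simp: e_def c_def norm_sgn)
  have ge: "c < gradient r y\<^sub>0 \<bullet> e"
  proof -
    have "gradient r y\<^sub>0 \<bullet> e = norm (gradient r y\<^sub>0)"
      using g0 by (simp add: e_def sgn_div_norm dot_square_norm power2_eq_square)
    then show ?thesis using g0 by (simp add: c_def)
  qed
  have "open {x\<in>U. c < gradient r x \<bullet> e}" 
    using continuous_on_open_vimage[THEN iffD1, OF D(1) D(7)[of e], rule_format, of "{c<..}"]
    by (auto simp: vimage_def Int_def conj_commute)
  moreover have "y\<^sub>0 \<in> {x\<in>U. c < gradient r x \<bullet> e}" using D(2) ge by simp
  ultimately obtain \<rho>0 where \<rho>0: "0 < \<rho>0" "cball y\<^sub>0 \<rho>0 \<subseteq> {x\<in>U. c < gradient r x \<bullet> e}"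
    by (metis open_contains_cball)
  let ?B = "cball y\<^sub>0 \<rho>0"
  have BU: "?B \<subseteq> U" using \<rho>0 by blast
  have mono: "c * t \<le> r (x + t *\<^sub>R e) - r x" if "x \<in> ?B" "x + t *\<^sub>R e \<in> ?B" "0 \<le> t" for x t
  proof (cases "t = 0")
    case False
    then have t: "0 < t" using that by simp
    have seg: "x + s *\<^sub>R e \<in> ?B" if s: "0 \<le> s" "s \<le> t" for s
    proof -
      have "x + s *\<^sub>R e = (1 - s / t) *\<^sub>R x + (s / t) *\<^sub>R (x + t *\<^sub>R e)" using t by (simp add: algebra_simps)
      also have "\<dots> \<in> ?B"
        using s t that by (intro convexD_alt[OF convex_cball \<open>x \<in> ?B\<close> \<open>x + t *\<^sub>R e \<in> ?B\<close>]) auto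
      finally show ?thesis .
    qed
    have der: "((\<lambda>s. r (x + s *\<^sub>R e)) has_real_derivative gradient r (x + s *\<^sub>R e) \<bullet> e) (at s)"
      if "0 \<le> s" "s \<le> t" for s
      by (rule has_derivative_along_line, rule D(5)) (use seg[OF that] BU in blast)
    obtain z where z: "0 < z" "z < t" "r (x + t *\<^sub>R e) - r (x + 0 *\<^sub>R e) = (t - 0) * (gradient r (x + z *\<^sub>R e) \<bullet> e)"
      using MVT2[OF t der] by blast
    have "x + z *\<^sub>R e \<in> ?B" using seg[of z] z by simp
    then have "c < gradient r (x + z *\<^sub>R e) \<bullet> e" using \<rho>0(2) by blast
    then have "t * c \<le> t * (gradient r (x + z *\<^sub>R e) \<bullet> e)" using t by (intro mult_left_mono) auto
    then show ?thesis using z(3) by (simp add: mult.commute)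
  qed simp
  \<comment> \<open>Halving the radius leaves room to move by \<delta> \<le> \<rho> from a
    tangential point without leaving the ball on which the slope is controlled.\<close>
  define \<rho> where "\<rho> = \<rho>0 / 2"
  have \<rho>: "0 < \<rho>" using \<rho>0 by (simp add: \<rho>_def)
  define Z where "Z = {z\<in>cball y\<^sub>0 \<rho>. r z = 0 \<and> gradient r z \<bullet> \<theta> = 0}"
  have sub: "cball y\<^sub>0 \<rho> \<subseteq> ?B" using \<rho>0 by (auto simp: \<rho>_def)
  have "closed Z"
  proof -
    have 1: "continuous_on (cball y\<^sub>0 \<rho>) r" "continuous_on (cball y\<^sub>0 \<rho>) (\<lambda>x. gradient r x \<bullet> \<theta>)"
      using D(6) D(7)[of \<theta>] sub BU by (auto intro: continuous_on_subset)
    have "closed {z\<in>cball y\<^sub>0 \<rho>. r z = 0}" "closed {z\<in>cball y\<^sub>0 \<rho>. gradient r z \<bullet> \<theta> = 0}"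
      using continuous_closed_preimage_constant[OF 1(1) closed_cball] continuous_closed_preimage_constant[OF 1(2) closed_cball] by auto
    then have "closed ({z\<in>cball y\<^sub>0 \<rho>. r z = 0} \<inter> {z\<in>cball y\<^sub>0 \<rho>. gradient r z \<bullet> \<theta> = 0})" by (rule closed_Int)
    then show ?thesis by (rule back_subst[of closed]) (auto simp: Z_def)
  qed
  moreover have "bounded Z" by (rule bounded_subset[OF bounded_cball[of y\<^sub>0 \<rho>]]) (auto simp: Z_def)
  ultimately have Zc: "compact Z" by (simp add: compact_eq_bounded_closed)
  define A where "A = (\<lambda>(z, t). z + t *\<^sub>R \<theta>) ` (Z \<times> {0..R})"
  have "compact A" unfolding A_def case_prod_beta'
    by (intro compact_continuous_image compact_Times Zc continuous_intros) simp
  then have Am: "A \<in> sets borel" by (rule borel_compact)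
  define V where "V = emeasure lborel (cball y\<^sub>0 (\<rho>0 + 1))"
  have Vfin: "V < top" unfolding V_def using emeasure_compact_finite[OF compact_cball] by simp
  then obtain V' where V': "V = ennreal V'" "0 \<le> V'" by (cases V) auto
  have bound: "emeasure lborel A \<le> ennreal ((2 * R + 4) * V' / c * \<epsilon>)" if \<epsilon>: "0 < \<epsilon>" for \<epsilon>
  proof -
    have "uniformly_continuous_on ?B (\<lambda>x. gradient r x \<bullet> \<theta>)"
      by (intro compact_uniformly_continuous continuous_on_subset[OF D(7)] BU) auto
    then obtain \<delta>0 where \<delta>0: "0 < \<delta>0" "\<And>x x'. x \<in> ?B \<Longrightarrow> x' \<in> ?B \<Longrightarrow> dist x' x < \<delta>0
        \<Longrightarrow> dist (gradient r x' \<bullet> \<theta>) (gradient r x \<bullet> \<theta>) < \<epsilon>"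
      unfolding uniformly_continuous_on_def using \<epsilon> by meson
    \<comment> \<open>Below \<open>\<delta>0\<close> the derivative of r along \<theta>, zero at a
      tangential point, stays below \<epsilon>; \<delta> \<le> \<rho> keeps the points in the ball;
      \<delta> \<le> 1 fits the parameters \<open>{- t..- t + \<delta>}\<close> into the fixed
      interval \<open>{- R - 1..1}\<close>.\<close>
    define \<delta> where "\<delta> = min (\<delta>0 / 2) (min \<rho> 1)"
    have \<delta>: "0 < \<delta>" "\<delta> < \<delta>0" "\<delta> \<le> \<rho>" "\<delta> \<le> 1" using \<delta>0 \<rho> by (auto simp: \<delta>_def)
    define E where "E = {x\<in>?B. \<bar>r x\<bar> \<le> \<epsilon> * \<delta>}"
    have rB: "continuous_on ?B r" by (rule continuous_on_subset[OF D(6) BU])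
    have "closed E"
    proof -
      have "closed (?B \<inter> (\<lambda>x. \<bar>r x\<bar>) -` {..\<epsilon> * \<delta>})"
        by (intro continuous_closed_preimage continuous_on_rabs rB) auto
      then show ?thesis by (rule back_subst[of closed]) (auto simp: E_def)
    qed
    then have Em: "E \<in> sets borel" by simp
    have near: "z + s *\<^sub>R \<theta> \<in> E" if z: "z \<in> Z" and s: "\<bar>s\<bar> \<le> \<delta>" for z s
    proof -
      have zB: "z + s' *\<^sub>R \<theta> \<in> ?B" if "\<bar>s'\<bar> \<le> \<delta>" for s'
      proof -
        have "dist y\<^sub>0 (z + s' *\<^sub>R \<theta>) \<le> dist y\<^sub>0 z + dist z (z + s' *\<^sub>R \<theta>)" by (rule dist_triangle)
        also have "\<dots> \<le> \<rho> + \<rho>" using z that \<delta> \<theta> by (intro add_mono) (auto simp: Z_def dist_norm)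
        finally show ?thesis by (simp add: \<rho>_def)
      qed
      have "norm (r (z + s *\<^sub>R \<theta>) - r (z + 0 *\<^sub>R \<theta>)) \<le> \<epsilon> * norm (s - 0)"
      proof (rule field_differentiable_bound[of "{-\<delta>..\<delta>}" _ "\<lambda>s. gradient r (z + s *\<^sub>R \<theta>) \<bullet> \<theta>"])
        fix s' assume s': "s' \<in> {-\<delta>..\<delta>}"
        then have "\<bar>s'\<bar> \<le> \<delta>" by auto
        note inB = zB[OF this]
        show "((\<lambda>s. r (z + s *\<^sub>R \<theta>)) has_field_derivative gradient r (z + s' *\<^sub>R \<theta>) \<bullet> \<theta>) (at s' within {-\<delta>..\<delta>})"
          by (rule has_field_derivative_at_within, rule has_derivative_along_line, rule D(5)) (use inB BU in blast)
        have "dist (gradient r (z + s' *\<^sub>R \<theta>) \<bullet> \<theta>) (gradient r z \<bullet> \<theta>) < \<epsilon>"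
          by (rule \<delta>0(2)) (use inB zB[of 0] \<delta> s' \<theta> in \<open>auto simp: dist_norm\<close>)
        then show "norm (gradient r (z + s' *\<^sub>R \<theta>) \<bullet> \<theta>) \<le> \<epsilon>" using z by (simp add: Z_def dist_real_def)
      qed (use s \<delta> in auto)
      also have "\<dots> \<le> \<epsilon> * \<delta>" using s \<epsilon> by simp
      finally show ?thesis using z zB[OF s] by (simp add: Z_def E_def)
    qed
    \<comment> \<open>The length \<delta> on the left will cancel against the factor \<delta> in the
      volume of the slab, leaving a bound proportional to \<epsilon>, which is arbitrary.\<close>
    have "emeasure lborel A * ennreal \<delta> \<le> ennreal (1 - (- R - 1)) * emeasure lborel E"
    proof (rule sweep_measure_bound[OF Am Em])
      fix x assume "x \<in> A"
      then obtain z t where z: "z \<in> Z" "0 \<le> t" "t \<le> R" "x = z + t *\<^sub>R \<theta>" by (auto simp: A_def)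
      have "x + s *\<^sub>R \<theta> \<in> E" if "s \<in> {- t..- t + \<delta>}" for s
        using near[OF z(1), of "s + t"] that by (simp add: z(4) algebra_simps)
      then show "\<exists>c. {c..c + \<delta>} \<subseteq> {- R - 1..1} \<and> (\<forall>s\<in>{c..c + \<delta>}. x + s *\<^sub>R \<theta> \<in> E)"
        using z \<delta> by (intro exI[of _ "- t"]) auto
    qed (use R \<delta> in auto)
    also have "emeasure lborel E \<le> ennreal (2 * (\<epsilon> * \<delta>) / c) * V"
      unfolding V_def
      by (rule monotone_slab_measure[OF Em _ _ e c]) (use \<epsilon> \<delta> \<rho>0 mono in \<open>auto simp: E_def\<close>)
    also have "ennreal (1 - (- R - 1)) * (ennreal (2 * (\<epsilon> * \<delta>) / c) * V) = ennreal ((2 * R + 4) * V' / c * \<epsilon> * \<delta>)"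
    proof -
      have n: "0 \<le> 1 - (- R - 1)" "0 \<le> 2 * (\<epsilon> * \<delta>) / c" using R \<epsilon> \<delta> c by auto
      have "(2 * R + 4) * V' / c * \<epsilon> * \<delta> = (1 - (- R - 1)) * (2 * (\<epsilon> * \<delta>) / c * V')"
        by (simp add: algebra_simps add_divide_distrib)
      then show ?thesis
        by (simp only: V'(1) ennreal_mult[OF n(1) mult_nonneg_nonneg[OF n(2) V'(2)]] ennreal_mult[OF n(2) V'(2)])
    qed
    finally have *: "emeasure lborel A * ennreal \<delta> \<le> ennreal ((2 * R + 4) * V' / c * \<epsilon> * \<delta>)"
      by (simp add: mult_left_mono)
    have "emeasure lborel A < top" using emeasure_compact_finite[OF \<open>compact A\<close>] by simp
    then obtain a where a: "emeasure lborel A = ennreal a" "0 \<le> a" by (cases "emeasure lborel A") auto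
    have "a * \<delta> \<le> (2 * R + 4) * V' / c * \<epsilon> * \<delta>"
      using * R V' c \<epsilon> \<delta> a by (simp add: ennreal_mult[symmetric] ennreal_le_iff)
    then have "a \<le> (2 * R + 4) * V' / c * \<epsilon>" using \<delta>(1) by (simp only: mult_le_cancel_right_pos)
    then show ?thesis unfolding a(1) by (rule ennreal_leI)
  qed
  obtain N where N: "N \<in> null_sets lborel" "A \<subseteq> N"
  proof (rule null_cover)
    fix \<eta> :: real assume \<eta>: "0 < \<eta>"
    let ?K = "(2 * R + 4) * V' / c"
    have K: "0 \<le> ?K" using R V' c by simp
    have "?K * (\<eta> / (?K + 1)) \<le> \<eta>" by (rule mult_div_add_one_le[OF K]) (use \<eta> in simp)
    then have "emeasure lborel A \<le> ennreal \<eta>"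
      using bound[of "\<eta> / (?K + 1)"] \<eta> K by (meson add_nonneg_pos divide_pos_pos ennreal_leI order_trans zero_less_one)
    then show "\<exists>T\<in>sets borel. A \<subseteq> T \<and> emeasure lborel T \<le> ennreal \<eta>" using Am by blast
  qed blast
  have "{x. \<exists>t\<in>{0..R}. x - t *\<^sub>R \<theta> \<in> frontier X \<inter> ball y\<^sub>0 \<rho> \<and> \<theta> \<bullet> outward_normal X (x - t *\<^sub>R \<theta>) = 0} \<subseteq> A"
  proof
    fix x assume "x \<in> {x. \<exists>t\<in>{0..R}. x - t *\<^sub>R \<theta> \<in> frontier X \<inter> ball y\<^sub>0 \<rho> \<and> \<theta> \<bullet> outward_normal X (x - t *\<^sub>R \<theta>) = 0}"
    then obtain t where t: "t \<in> {0..R}" "x - t *\<^sub>R \<theta> \<in> frontier X" "x - t *\<^sub>R \<theta> \<in> ball y\<^sub>0 \<rho>"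
      "\<theta> \<bullet> outward_normal X (x - t *\<^sub>R \<theta>) = 0" by blast
    let ?z = "x - t *\<^sub>R \<theta>"
    have zU: "?z \<in> U" using t(3) sub BU by (meson ball_subset_cball subsetD)
    have "r ?z = 0" by (rule defining_function_zero[OF X t(2) L zU])
    moreover have "\<theta> \<bullet> sgn (gradient r ?z) = 0" using t(4) outward_normal_eq[OF X t(2) L zU] by simp
    then have "gradient r ?z \<bullet> \<theta> = 0" using D(3)[OF zU] by (simp add: sgn_div_norm inner_commute)
    ultimately have "?z \<in> Z" using t(3) by (simp add: Z_def)
    then show "x \<in> A" unfolding A_def using t(1) by (intro image_eqI[of _ _ "(?z, t)"]) auto
  qed
  then show ?thesis using \<rho> N by blast
qed

text \<open>The boundary is compact, so finitely many of the local balls cover it.\<close>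

lemma tangential_lines_null:
  fixes X :: "'a::euclidean_space set"
  assumes X: "smooth_bounded_domain X" and \<theta>: "norm \<theta> = 1" and R: "0 \<le> R"
  shows "AE x in lborel. \<forall>t\<in>{0..R}. x - t *\<^sub>R \<theta> \<in> frontier X \<longrightarrow> \<theta> \<bullet> outward_normal X (x - t *\<^sub>R \<theta>) \<noteq> 0"
proof -
  have op: "open X" and bd: "bounded X" and def: "\<And>y. y \<in> frontier X \<Longrightarrow> \<exists>U r. local_defining_function X y U r"
    using X by (auto simp: smooth_bounded_domain_def)
  define T where "T W = {x. \<exists>t\<in>{0..R}. x - t *\<^sub>R \<theta> \<in> frontier X \<inter> W \<and> \<theta> \<bullet> outward_normal X (x - t *\<^sub>R \<theta>) = 0}" for W
  have "\<exists>\<rho>>0. \<exists>N\<in>null_sets lborel. T (ball y \<rho>) \<subseteq> N" if y: "y \<in> frontier X" for y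
  proof -
    obtain U r where "local_defining_function X y U r" using def[OF y] by blast
    from tangential_lines_null_local[OF op this \<theta> R] show ?thesis unfolding T_def .
  qed
  then obtain \<rho> N where \<rho>: "\<And>y. y \<in> frontier X \<Longrightarrow> 0 < \<rho> y" and N: "\<And>y. y \<in> frontier X \<Longrightarrow> N y \<in> null_sets lborel"
    "\<And>y. y \<in> frontier X \<Longrightarrow> T (ball y (\<rho> y)) \<subseteq> N y" by metis
  have "compact (frontier X)" using bd by (rule compact_frontier_bounded)
  then obtain Y where Y: "Y \<subseteq> frontier X" "finite Y" "frontier X \<subseteq> (\<Union>y\<in>Y. ball y (\<rho> y))"
  proof (rule compactE_image)
    show "frontier X \<subseteq> (\<Union>y\<in>frontier X. ball y (\<rho> y))" using \<rho> by fastforce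
  qed auto
  have "(\<Union>y\<in>Y. N y) \<in> null_sets lborel"
    using Y N(1) by (intro null_sets_UN') (auto intro: countable_finite)
  then have "AE x in lborel. x \<notin> (\<Union>y\<in>Y. N y)" by (rule AE_not_in)
  then show ?thesis
  proof eventually_elim
    case (elim x)
    show ?case
    proof (intro ballI impI notI)
      fix t assume t: "t \<in> {0..R}" "x - t *\<^sub>R \<theta> \<in> frontier X" "\<theta> \<bullet> outward_normal X (x - t *\<^sub>R \<theta>) = 0"
      then obtain y where y: "y \<in> Y" "x - t *\<^sub>R \<theta> \<in> ball y (\<rho> y)" using Y(3) by blast
      then have "x \<in> T (ball y (\<rho> y))" unfolding T_def using t by blast
      then show False using N(2)[of y] y Y(1) elim by blast
    qed
  qed
qed

text \<open>The cylinder over a set of diameter at most d is covered by about R / d balls of radius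
  2 d, centred at steps of length d along \<theta>. Their total volume has order d^(n-1), n the
  dimension, which is the order of the Hausdorff gauge of the set. The 4 comes from (R / d + 2) d =
  R + 2 d with d \<le> 2.\<close>

lemma cylinder_measure_bound:
  fixes U :: "'a::euclidean_space set"
  assumes \<theta>: "norm \<theta> = 1" and R: "0 \<le> R" and U: "bounded U" "diameter U \<le> d" and d: "0 < d" "d \<le> 2"
  obtains T where "T \<in> sets borel" "{x. \<exists>t\<in>{0..R}. x - t *\<^sub>R \<theta> \<in> U} \<subseteq> T"
    "emeasure lborel T \<le> ennreal (unit_ball_vol (real DIM('a)) * 2 ^ DIM('a) * (R + 4) * d ^ (DIM('a) - 1))"
proof (cases "U = {}")
  case True
  then show ?thesis by (intro that[of "{}"]) auto
next
  case False
  then obtain p where p: "p \<in> U" by blast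
  define m where "m = nat \<lceil>R / d\<rceil>"
  let ?T = "\<Union>j\<le>m. cball (p + (real j * d) *\<^sub>R \<theta>) (2 * d)"
  show ?thesis
  proof (rule that[of ?T])
    show "?T \<in> sets borel" by auto
    show "{x. \<exists>t\<in>{0..R}. x - t *\<^sub>R \<theta> \<in> U} \<subseteq> ?T"
    proof
      fix x assume "x \<in> {x. \<exists>t\<in>{0..R}. x - t *\<^sub>R \<theta> \<in> U}"
      then obtain t where t: "0 \<le> t" "t \<le> R" "x - t *\<^sub>R \<theta> \<in> U" by auto
      define j where "j = nat \<lfloor>t / d\<rfloor>"
      have td: "0 \<le> t / d" using t d by simp
      then have j: "real j \<le> t / d" "t / d < real j + 1" by (auto simp: j_def)
      have "t / d \<le> R / d" using t d by (simp add: divide_right_mono)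
      then have "j \<le> m" using td unfolding j_def m_def by (meson floor_le_ceiling floor_mono nat_mono order_trans)
      have "\<bar>t - real j * d\<bar> \<le> d"
      proof -
        have "real j * d \<le> t" "t < (real j + 1) * d" using j d by (auto simp: field_simps)
        then show ?thesis by (simp add: algebra_simps)
      qed
      moreover have "dist p (x - t *\<^sub>R \<theta>) \<le> d"
        using diameter_bounded_bound[OF U(1) p t(3)] U(2) by linarith
      moreover have "dist (p + (real j * d) *\<^sub>R \<theta>) x \<le> dist p (x - t *\<^sub>R \<theta>) + norm ((real j * d - t) *\<^sub>R \<theta>)"
      proof -
        have "(p + (real j * d) *\<^sub>R \<theta>) - x = (p - (x - t *\<^sub>R \<theta>)) + (real j * d - t) *\<^sub>R \<theta>" by (simp add: algebra_simps)
        then show ?thesis unfolding dist_norm by (metis norm_triangle_ineq)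
      qed
      ultimately have "dist (p + (real j * d) *\<^sub>R \<theta>) x \<le> 2 * d" using \<theta> by simp
      then show "x \<in> ?T" using \<open>j \<le> m\<close> by auto
    qed
    have "emeasure lborel ?T \<le> (\<Sum>j\<le>m. emeasure lborel (cball (p + (real j * d) *\<^sub>R \<theta>) (2 * d)))"
      by (rule emeasure_subadditive_finite) auto
    also have "\<dots> = (\<Sum>j\<le>m. ennreal (unit_ball_vol (real DIM('a)) * (2 * d) ^ DIM('a)))"
      using d by (intro sum.cong refl emeasure_cball) auto
    also have "\<dots> = ennreal (real (Suc m) * (unit_ball_vol (real DIM('a)) * (2 * d) ^ DIM('a)))"
      using d by (simp add: ennreal_mult ennreal_of_nat_eq_real_of_nat)
    also have "\<dots> \<le> ennreal (unit_ball_vol (real DIM('a)) * 2 ^ DIM('a) * (R + 4) * d ^ (DIM('a) - 1))"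
    proof (rule ennreal_leI)
      have "real m \<le> R / d + 1" using R d by (simp add: m_def)
      then have "real (Suc m) * d \<le> (R / d + 2) * d" using d by (intro mult_right_mono) auto
      also have "\<dots> = R + 2 * d" using d by (simp add: field_simps)
      also have "\<dots> \<le> R + 4" using d by simp
      finally have md: "real (Suc m) * d \<le> R + 4" .
      have dd: "d ^ DIM('a) = d * d ^ (DIM('a) - 1)"
        by (metis DIM_positive Suc_pred' power_Suc)
      have "real (Suc m) * (unit_ball_vol (real DIM('a)) * (2 * d) ^ DIM('a))
          = (unit_ball_vol (real DIM('a)) * 2 ^ DIM('a)) * (real (Suc m) * d) * d ^ (DIM('a) - 1)"
        by (simp only: power_mult_distrib dd mult_ac)
      also have "\<dots> \<le> (unit_ball_vol (real DIM('a)) * 2 ^ DIM('a)) * (R + 4) * d ^ (DIM('a) - 1)"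
        using d md by (intro mult_right_mono mult_left_mono) auto
      finally show "real (Suc m) * (unit_ball_vol (real DIM('a)) * (2 * d) ^ DIM('a))
          \<le> unit_ball_vol (real DIM('a)) * 2 ^ DIM('a) * (R + 4) * d ^ (DIM('a) - 1)" .
    qed
    finally show "emeasure lborel ?T \<le> ennreal (unit_ball_vol (real DIM('a)) * 2 ^ DIM('a) * (R + 4) * d ^ (DIM('a) - 1))" .
  qed
qed

text \<open>A covering set may have diameter 0, whereas the cylinder estimate needs d > 0. Diameters
  at most 1 are therefore enlarged a little, at a cost that can be made summable.\<close>

lemma power_perturbation:
  fixes d :: real
  assumes "0 \<le> d" "d \<le> 1" "0 < \<epsilon>"
  obtains d' where "d \<le> d'" "0 < d'" "d' \<le> 2" "d' ^ m \<le> d ^ m + \<epsilon>"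
proof -
  have "isCont (\<lambda>x::real. x ^ m) d" by simp
  then obtain \<delta> where \<delta>: "0 < \<delta>" "\<And>x. \<bar>x - d\<bar> < \<delta> \<Longrightarrow> \<bar>x ^ m - d ^ m\<bar> < \<epsilon>"
    unfolding continuous_at_eps_delta using assms(3) by (auto simp: dist_real_def)
  show thesis
  proof (rule that[of "d + min (\<delta> / 2) 1"])
    show "(d + min (\<delta> / 2) 1) ^ m \<le> d ^ m + \<epsilon>"
    proof -
      have "\<bar>d + min (\<delta> / 2) 1 - d\<bar> < \<delta>" using \<delta>(1) by auto
      from \<delta>(2)[OF this] show ?thesis by linarith
    qed
  qed (use assms \<delta> in auto)
qed

text \<open>A cover of N with small total gauge is swept into cylinders whose volumes are comparable
  to the gauges, up to the summable errors from enlarging the diameters. No transversality between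
  \<theta> and N enters, so the result holds in every direction.\<close>

lemma hausdorff_null_lines_null:
  fixes N :: "'a::euclidean_space set"
  assumes N: "hausdorff_outer (DIM('a) - 1) N = 0" and \<theta>: "norm \<theta> = 1" and R: "0 \<le> R"
  shows "\<exists>M\<in>null_sets lborel. {x. \<exists>t\<in>{0..R}. x - t *\<^sub>R \<theta> \<in> N} \<subseteq> M"
proof -
  let ?m = "DIM('a) - 1"
  define C where "C = unit_ball_vol (real DIM('a)) * 2 ^ DIM('a) * (R + 4)"
  let ?S = "{x. \<exists>t\<in>{0..R}. x - t *\<^sub>R \<theta> \<in> N}"
  have C: "0 \<le> C" using R by (simp add: C_def)
  define G where "G = unit_ball_vol (real ?m) / 2 ^ ?m"
  have G: "0 < G" by (simp add: G_def)
  have gauge: "hausdorff_gauge ?m U = ennreal (G * diameter U ^ ?m)" if "U \<noteq> {}" for U :: "'a set"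
    using that by (simp add: hausdorff_gauge_def G_def power_divide)
  obtain M where "M \<in> null_sets lborel" "?S \<subseteq> M"
  proof (rule null_cover)
    fix \<eta> :: real assume \<eta>: "0 < \<eta>"
    define \<epsilon> where "\<epsilon> = \<eta> / (C + 1) / 2"
    have \<epsilon>: "0 < \<epsilon>" using \<eta> C by (simp add: \<epsilon>_def)
    have "hausdorff_pre ?m 1 N \<le> 0" using hausdorff_pre_le_outer[of 1 ?m N] N by (metis zero_less_one)
    also have "0 < ennreal (G * \<epsilon>)" using G \<epsilon> by simp
    finally have "hausdorff_pre ?m 1 N < ennreal (G * \<epsilon>)" .
    then obtain U :: "nat \<Rightarrow> 'a set" where U: "N \<subseteq> (\<Union>i. U i)" "\<And>i. bounded (U i)" "\<And>i. diameter (U i) \<le> 1"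
      and sum: "(\<Sum>i. hausdorff_gauge ?m (U i)) < ennreal (G * \<epsilon>)"
      unfolding hausdorff_pre_def INF_less_iff by blast
    \<comment> \<open>The case distinction mirrors the convention of \<open>hausdorff_gauge\<close>
      for the empty set: in dimension one the exponent is 0 and \<open>diameter {} ^ 0\<close> would
      be 1.\<close>
    define D where "D i = (if U i = {} then 0 else diameter (U i) ^ ?m)" for i
    have D0: "0 \<le> D i" for i using diameter_ge_0[OF U(2)[of i]] by (simp add: D_def)
    have gD: "hausdorff_gauge ?m (U i) = ennreal (G * D i)" for i
      using gauge[of "U i"] by (simp add: D_def hausdorff_gauge_def)
    define Cy where "Cy i = {x. \<exists>t\<in>{0..R}. x - t *\<^sub>R \<theta> \<in> U i}" for i
    have "\<exists>T\<in>sets borel. Cy i \<subseteq> T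
        \<and> emeasure lborel T \<le> ennreal (C * (D i + \<epsilon> * (1 / 2) ^ Suc i))" for i
    proof (cases "U i = {}")
      case True
      then show ?thesis by (intro bexI[of _ "{}"]) (auto simp: Cy_def)
    next
      case False
      obtain d' where d': "diameter (U i) \<le> d'" "0 < d'" "d' \<le> 2" "d' ^ ?m \<le> diameter (U i) ^ ?m + \<epsilon> * (1 / 2) ^ Suc i"
        by (rule power_perturbation[OF diameter_ge_0[OF U(2)[of i]] U(3)[of i], of "\<epsilon> * (1 / 2) ^ Suc i" ?m]) (use \<epsilon> in auto)
      obtain T where T: "T \<in> sets borel" "Cy i \<subseteq> T" "emeasure lborel T \<le> ennreal (C * d' ^ ?m)"
        by (rule cylinder_measure_bound[OF \<theta> R U(2)[of i] d'(1-3), folded C_def Cy_def])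
      have "C * d' ^ ?m \<le> C * (D i + \<epsilon> * (1 / 2) ^ Suc i)"
        using d'(4) C False by (intro mult_left_mono) (auto simp: D_def)
      then show ?thesis using T by (meson ennreal_leI order_trans)
    qed
    then obtain T where T: "\<And>i. T i \<in> sets borel" "\<And>i. Cy i \<subseteq> T i"
      "\<And>i. emeasure lborel (T i) \<le> ennreal (C * (D i + \<epsilon> * (1 / 2) ^ Suc i))" by metis
    have cov: "?S \<subseteq> (\<Union>i. T i)"
    proof
      fix x assume "x \<in> ?S"
      then obtain t i where "t \<in> {0..R}" "x - t *\<^sub>R \<theta> \<in> U i" using U(1) by blast
      then show "x \<in> (\<Union>i. T i)" using T(2)[of i] unfolding Cy_def by blast
    qed
    have sD: "(\<Sum>i. ennreal (D i)) \<le> ennreal \<epsilon>"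
    proof -
      have "ennreal G * (\<Sum>i. ennreal (D i)) = (\<Sum>i. ennreal G * ennreal (D i))"
        by (rule ennreal_suminf_cmult[symmetric])
      also have "\<dots> = (\<Sum>i. hausdorff_gauge ?m (U i))"
        unfolding gD using G D0 by (simp add: ennreal_mult)
      also have "\<dots> \<le> ennreal G * ennreal \<epsilon>" using sum G \<epsilon> by (simp add: ennreal_mult)
      finally show ?thesis using G by (simp add: ennreal_mult_le_mult_iff)
    qed
    have sg: "(\<Sum>i. ennreal (\<epsilon> * (1 / 2) ^ Suc i)) = ennreal \<epsilon>"
    proof -
      have "(\<lambda>i. \<epsilon> * (1/2)^Suc i) sums (\<epsilon> * 1)"
        by (intro sums_mult power_half_series)
      then show ?thesis using \<epsilon> by (intro sums_unique[symmetric]) (auto intro!: sums_ennreal[THEN iffD2])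
    qed
    have "emeasure lborel (\<Union>i. T i) \<le> (\<Sum>i. emeasure lborel (T i))"
      by (rule emeasure_subadditive_countably) (use T(1) in auto)
    also have "\<dots> \<le> (\<Sum>i. ennreal C * (ennreal (D i) + ennreal (\<epsilon> * (1 / 2) ^ Suc i)))"
    proof (intro suminf_le summableI)
      fix i
      have "ennreal (C * (D i + \<epsilon> * (1 / 2) ^ Suc i)) = ennreal C * (ennreal (D i) + ennreal (\<epsilon> * (1 / 2) ^ Suc i))"
        using C D0 \<epsilon> by (simp only: ennreal_mult ennreal_plus add_nonneg_nonneg mult_nonneg_nonneg less_imp_le zero_le_power)
      then show "emeasure lborel (T i) \<le> ennreal C * (ennreal (D i) + ennreal (\<epsilon> * (1 / 2) ^ Suc i))" using T(3)[of i] by simp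
    qed
    also have "\<dots> = ennreal C * ((\<Sum>i. ennreal (D i)) + (\<Sum>i. ennreal (\<epsilon> * (1 / 2) ^ Suc i)))"
      by (subst ennreal_suminf_cmult) (simp only: suminf_add[OF summableI summableI])
    also have "\<dots> \<le> ennreal C * (ennreal \<epsilon> + ennreal \<epsilon>)"
      unfolding sg using sD by (intro mult_left_mono add_mono) auto
    also have "\<dots> = ennreal (C * (2 * \<epsilon>))"
      using C \<epsilon> by (simp add: ennreal_mult ennreal_plus[symmetric] del: ennreal_plus)
    also have "\<dots> \<le> ennreal \<eta>"
    proof (rule ennreal_leI)
      have "2 * \<epsilon> = \<eta> / (C + 1)" using C by (simp add: \<epsilon>_def field_simps)
      then show "C * (2 * \<epsilon>) \<le> \<eta>" using mult_div_add_one_le[OF C] \<eta> by simp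
    qed
    finally show "\<exists>T\<in>sets borel. ?S \<subseteq> T \<and> emeasure lborel T \<le> ennreal \<eta>"
      using cov T(1) by (intro bexI[of _ "\<Union>i. T i"]) auto
  qed blast
  then show ?thesis by blast
qed

text \<open>Carries a property from almost every boundary point to all boundary points met by almost
  every line, within parameter length R. This is how a trace condition known off a boundary null set
  becomes usable on lines.\<close>

lemma AE_surface_lines:
  fixes X :: "'a::euclidean_space set"
  assumes ae: "AE y in surface_measure X. P y" and \<theta>: "norm \<theta> = 1" and R: "0 \<le> R"
  shows "AE x in lborel. \<forall>t\<in>{0..R}. x - t *\<^sub>R \<theta> \<in> frontier X \<longrightarrow> P (x - t *\<^sub>R \<theta>)"
proof -
  have fr: "frontier X \<in> sets borel" by simp
  obtain N where N: "{y \<in> space (surface_measure X). \<not> P y} \<subseteq> N" "N \<in> null_sets (surface_measure X)"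
    using ae by (auto simp: eventually_ae_filter)
  then have N0: "hausdorff_outer (DIM('a) - 1) N = 0"
  proof -
    have "N \<in> null_sets (hausdorff_measure (DIM('a) - 1) :: 'a measure)"
      using N(2) null_sets_restrict_space[of "frontier X" "hausdorff_measure (DIM('a) - 1)" N] fr
      unfolding surface_measure_def sets_hausdorff_measure by blast
    then show "hausdorff_outer (DIM('a) - 1) N = 0"
      unfolding null_sets_def sets_hausdorff_measure by (auto simp del: One_nat_def simp: emeasure_hausdorff_measure)
  qed
  obtain M where M: "M \<in> null_sets lborel" "{x. \<exists>t\<in>{0..R}. x - t *\<^sub>R \<theta> \<in> N} \<subseteq> M"
    using hausdorff_null_lines_null[OF N0 \<theta> R] by blast
  have "AE x in lborel. x \<notin> M" using M(1) by (rule AE_not_in)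
  then show ?thesis
  proof eventually_elim
    case (elim x)
    then show ?case using M(2) N(1) by (auto simp: surface_measure_def space_restrict_space)
  qed
qed

section \<open>A priori estimate and uniqueness\<close>

lemma integrable_interval_mult:
  fixes g :: "real \<Rightarrow> real"
  assumes "g \<in> borel_measurable borel" "\<And>s. \<bar>g s\<bar> \<le> C"
  shows "integrable lborel (\<lambda>s. indicator {a..b} s * g s)"
proof (rule integrable_mult_bounded[of _ _ _ C])
  show "integrable lborel (indicator {a..b} :: real \<Rightarrow> real)"
    by (rule integrable_real_indicator) (auto simp: emeasure_lborel_Icc_eq)
qed (use assms in auto)

lemma interval_integral_lipschitz:
  fixes g :: "real \<Rightarrow> real"
  assumes g: "g \<in> borel_measurable borel" "\<And>s. \<bar>g s\<bar> \<le> C" and t: "0 \<le> t" "t \<le> t'"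
  shows "\<bar>(\<integral>s. indicator {0..t'} s * g s \<partial>lborel) - (\<integral>s. indicator {0..t} s * g s \<partial>lborel)\<bar> \<le> C * (t' - t)"
proof -
  have C: "0 \<le> C" using g(2)[of 0] by linarith
  note i = integrable_interval_mult[OF g]
  have "(\<integral>s. indicator {0..t'} s * g s \<partial>lborel) - (\<integral>s. indicator {0..t} s * g s \<partial>lborel)
      = (\<integral>s. indicator {0..t'} s * g s - indicator {0..t} s * g s \<partial>lborel)"
    by (rule Bochner_Integration.integral_diff[symmetric, OF i i])
  also have "\<bar>\<dots>\<bar> \<le> (\<integral>s. indicator {t..t'} s * C \<partial>lborel)"
  proof (rule integral_abs_bound_integral)
    show "integrable lborel (\<lambda>s. indicator {0..t'} s * g s - indicator {0..t} s * g s)"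
      by (rule Bochner_Integration.integrable_diff[OF i i])
    show "integrable lborel (\<lambda>s. indicator {t..t'} s * C)"
      by (rule integrable_interval_mult[of "\<lambda>_. C" C]) (use C in auto)
    show "\<bar>indicator {0..t'} s * g s - indicator {0..t} s * g s\<bar> \<le> indicator {t..t'} s * C" for s
      using g(2)[of s] t C by (auto simp: indicator_def)
  qed
  also have "\<dots> = C * (t' - t)" using t by simp
  finally show ?thesis .
qed

text \<open>W t is the value of the solution at distance t behind the given point, and W' = - g. Let
  \<open>t1\<close> be the first time with W \<le> b, which exists because W vanishes at l. Before
  it W exceeds b, so g is at most c there, and W drops from w to at most b with slope at most c over
  a length at most l.\<close>

lemma ray_ode_bound:
  fixes g :: "real \<Rightarrow> real"
  assumes g: "g \<in> borel_measurable borel" "\<And>s. \<bar>g s\<bar> \<le> C" and l: "0 \<le> l" and bc: "0 \<le> b" "0 \<le> c"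
    and W: "\<And>t. W t = w - (\<integral>s. indicator {0..t} s * g s \<partial>lborel)" and end0: "W l = 0"
    and bound: "AE s in lborel. 0 < s \<and> s < l \<longrightarrow> b < W s \<longrightarrow> g s \<le> c"
  shows "w \<le> b + c * l"
proof -
  have lip: "\<bar>W t' - W t\<bar> \<le> C * \<bar>t' - t\<bar>" if "0 \<le> t" "0 \<le> t'" for t t'
    using interval_integral_lipschitz[OF g, of t t'] interval_integral_lipschitz[OF g, of t' t] that
    by (cases "t \<le> t'") (auto simp: W abs_minus_commute)
  have "(C)-lipschitz_on {0..l} W"
    by (rule lipschitz_onI) (use lip g(2)[of 0] in \<open>auto simp: dist_real_def\<close>)
  then have cont: "continuous_on {0..l} W" by (rule lipschitz_on_continuous_on)
  have "closed ({0..l} \<inter> W -` {..b})" by (intro continuous_closed_preimage cont) auto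
  then have "compact ({0..l} \<inter> W -` {..b})"
    by (metis bounded_Int bounded_closed_interval compact_eq_bounded_closed)
  moreover have "l \<in> {0..l} \<inter> W -` {..b}" using l end0 bc by simp
  ultimately obtain t1 where t1: "t1 \<in> {0..l}" "W t1 \<le> b" and min: "\<And>t. t \<in> {0..l} \<Longrightarrow> W t \<le> b \<Longrightarrow> t1 \<le> t"
    using compact_attains_inf[of "{0..l} \<inter> W -` {..b}"] by blast
  have "(\<integral>s. indicator {0..t1} s * g s \<partial>lborel) \<le> (\<integral>s. indicator {0..t1} s * c \<partial>lborel)"
  proof (rule integral_mono_AE)
    show "integrable lborel (\<lambda>s. indicator {0..t1} s * g s)" by (rule integrable_interval_mult[OF g])
    show "integrable lborel (\<lambda>s. indicator {0..t1} s * c)"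
      by (rule integrable_interval_mult[of "\<lambda>_. c" c]) (use bc in auto)
    show "AE s in lborel. indicator {0..t1} s * g s \<le> indicator {0..t1} s * c"
      using bound AE_lborel_singleton[of 0] AE_lborel_singleton[of t1]
    proof eventually_elim
      case (elim s)
      show ?case
      proof (cases "0 < s \<and> s < t1")
        case True
        then have "b < W s" using min[of s] t1(1) by force
        then show ?thesis using elim True t1(1) by auto
      next
        case False
        then show ?thesis using elim by (auto simp: indicator_def)
      qed
    qed
  qed
  also have "\<dots> = c * t1" using t1 by simp
  also have "\<dots> \<le> c * l" using t1 bc by (intro mult_left_mono) auto
  finally show ?thesis using t1(2) W[of t1] by linarith
qed

lemma AE_lborel_interval_ex:
  fixes P :: "real \<Rightarrow> bool"
  assumes "AE s in lborel. P s" "a < b"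
  shows "\<exists>s. a < s \<and> s < b \<and> P s"
proof (rule ccontr)
  assume "\<not> ?thesis"
  then have "AE s in lborel. s \<notin> {a<..<b}" using assms(1) by (auto elim!: eventually_mono)
  then have "{a<..<b} \<in> null_sets lborel" by (subst (asm) AE_iff_null_sets[symmetric]) auto
  then show False using assms(2) by (simp add: null_sets_def)
qed

text \<open>The hypothesis \<open>coercive\<close> says that above the level b absorption leaves at
  most c of a source of size \<open>Q\<close>; this is the comparison hypothesis of
  \<open>ray_ode_bound\<close>, used for u and for - u. Almost every x has a backward line on which
  everything needed holds: the integrated equation, the bound of the source, the trace at the inflow
  end, and transversality there.\<close>

lemma weak_transport_bound:
  fixes X :: "'a::euclidean_space set" and u q \<sigma> :: "'a \<Rightarrow> real"
  assumes X: "smooth_bounded_domain X" and \<theta>: "\<theta> \<in> sphere 0 1"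
    and um[measurable]: "u \<in> borel_measurable borel" and qm[measurable]: "q \<in> borel_measurable borel"
    and \<sigma>m[measurable]: "\<sigma> \<in> borel_measurable borel" and \<sigma>M: "\<And>x. \<bar>\<sigma> x\<bar> \<le> M"
    and uB: "AE x in lborel. x \<in> X \<longrightarrow> \<bar>u x\<bar> \<le> B" and qQ: "AE x in lborel. x \<in> X \<longrightarrow> \<bar>q x\<bar> \<le> Q"
    and weak: "\<And>\<psi>. test_function X \<psi> \<Longrightarrow>
        (\<integral>x. u x * (\<sigma> x * \<psi> x - frechet_derivative \<psi> (at x) \<theta>) \<partial>domain_measure X) =
        (\<integral>x. q x * \<psi> x \<partial>domain_measure X)"
    and trace: "AE y in surface_measure X. (y, \<theta>) \<in> Gamma_minus X \<longrightarrow>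
        (\<forall>\<epsilon>>0. \<exists>\<delta>>0. AE t in lborel. 0 < t \<and> t < \<delta> \<longrightarrow> \<bar>u (y + t *\<^sub>R \<theta>)\<bar> < \<epsilon>)"
    and bc: "0 \<le> b" "0 \<le> c" and coercive: "\<And>x m. x \<in> X \<Longrightarrow> b < m \<Longrightarrow> Q - \<sigma> x * m \<le> c"
  shows "AE x in lborel. x \<in> X \<longrightarrow> \<bar>u x\<bar> \<le> b + c * diameter X"
proof -
  have op: "open X" and bd: "bounded X" using X by (auto simp: smooth_bounded_domain_def)
  have n\<theta>: "norm \<theta> = 1" using \<theta> by simp
  have Xm[measurable]: "X \<in> sets borel" using op by simp
  have M0: "0 \<le> M" using \<sigma>M[of undefined] by linarith
  define B' where "B' = max B 0"
  define Q' where "Q' = max Q 0"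
  define C where "C = Q' + M * B'"
  have C0: "0 \<le> C" using M0 by (simp add: C_def Q'_def B'_def)
  define I where "I = (indicator X :: 'a \<Rightarrow> real)"
  have Im[measurable]: "I \<in> borel_measurable borel" by (simp add: I_def)
  have Ifin: "emeasure lborel X < \<infinity>" using emeasure_bounded_finite[OF bd] by simp
  define Iu where "Iu x = I x * u x" for x
  \<comment> \<open>Truncation at \<open>C\<close> makes f bounded everywhere, as the lemmas on
    lines require; on X it changes the source only on a null set.\<close>
  define f where "f x = I x * max (- C) (min C (q x - \<sigma> x * u x))" for x
  have fm[measurable]: "f \<in> borel_measurable borel" unfolding f_def by measurable
  have fC: "\<bar>f x\<bar> \<le> C" for x using C0 by (auto simp: f_def I_def indicator_def)
  have good: "AE x in lborel. x \<in> X \<longrightarrow> f x = q x - \<sigma> x * u x \<and> \<bar>q x\<bar> \<le> Q"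
    using uB qQ
  proof eventually_elim
    case (elim x)
    show ?case
    proof
      assume x: "x \<in> X"
      have "\<bar>\<sigma> x * u x\<bar> \<le> M * B'" unfolding abs_mult using \<sigma>M[of x] elim x M0
        by (intro mult_mono) (auto simp: B'_def)
      moreover have "\<bar>q x\<bar> \<le> Q'" using elim x by (simp add: Q'_def)
      ultimately have "\<bar>q x - \<sigma> x * u x\<bar> \<le> C" unfolding C_def by linarith
      then show "f x = q x - \<sigma> x * u x \<and> \<bar>q x\<bar> \<le> Q" using elim x by (simp add: f_def I_def)
    qed
  qed
  have intb: "integrable lborel (\<lambda>x. I x * z x)" if zm: "z \<in> borel_measurable borel" and zb: "AE x in lborel. x \<in> X \<longrightarrow> \<bar>z x\<bar> \<le> D" for z :: "'a \<Rightarrow> real" and D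
  proof -
    have "integrable lborel (\<lambda>x. indicator X x *\<^sub>R z x)"
      by (rule integrableI_bounded_set_indicator[where B=D]) (use zm zb Ifin in auto)
    then show ?thesis by (simp add: I_def)
  qed
  have Iui: "integrable lborel Iu" unfolding Iu_def by (rule intb[OF um uB])
  have weak': "(\<integral>x. Iu x * frechet_derivative \<psi> (at x) \<theta> \<partial>lborel) = - (\<integral>x. f x * \<psi> x \<partial>lborel)"
    if \<psi>: "test_function X \<psi>" for \<psi>
  proof -
    have C1: "Ck_on 1 UNIV \<psi>" and co: "compact (closure {x. \<psi> x \<noteq> 0})" using \<psi> by (auto simp: test_function_def)
    note L = Ck_on_1_along_line[OF C1]
    obtain P P' where P: "\<And>x. \<bar>\<psi> x\<bar> \<le> P" and P': "\<And>x. \<bar>frechet_derivative \<psi> (at x) \<theta>\<bar> \<le> P'"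
      using Ck_on_1_compact_support_bounds[OF C1 co] by blast
    have pm[measurable]: "\<psi> \<in> borel_measurable borel" and dm[measurable]: "(\<lambda>x. frechet_derivative \<psi> (at x) \<theta>) \<in> borel_measurable borel"
      by (rule borel_measurable_continuous_onI[OF L(1)], rule borel_measurable_continuous_onI[OF L(2)])
    have i1: "integrable lborel (\<lambda>x. Iu x * frechet_derivative \<psi> (at x) \<theta>)"
      by (rule integrable_mult_bounded[OF Iui _ P']) simp
    have i2: "integrable lborel (\<lambda>x. Iu x * (\<sigma> x * \<psi> x))"
    proof (rule integrable_mult_bounded[OF Iui, of _ "M * P"])
      show "\<bar>\<sigma> x * \<psi> x\<bar> \<le> M * P" for x unfolding abs_mult by (intro mult_mono \<sigma>M P M0) simp
    qed simp
    have i3: "integrable lborel (\<lambda>x. (I x * q x) * \<psi> x)"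
      by (rule integrable_mult_bounded[OF intb[OF qm qQ] _ P]) simp
    have X': "X \<inter> space lborel \<in> sets lborel" by simp
    have "(\<integral>x. Iu x * (\<sigma> x * \<psi> x) - Iu x * frechet_derivative \<psi> (at x) \<theta> \<partial>lborel) = (\<integral>x. (I x * q x) * \<psi> x \<partial>lborel)"
      using weak[OF \<psi>] unfolding integral_restrict_space[OF X']
      by (simp add: I_def Iu_def algebra_simps)
    then have "(\<integral>x. Iu x * (\<sigma> x * \<psi> x) \<partial>lborel) - (\<integral>x. Iu x * frechet_derivative \<psi> (at x) \<theta> \<partial>lborel)
        = (\<integral>x. (I x * q x) * \<psi> x \<partial>lborel)"
      by (subst (asm) Bochner_Integration.integral_diff[OF i2 i1])
    then have "(\<integral>x. Iu x * frechet_derivative \<psi> (at x) \<theta> \<partial>lborel)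
        = (\<integral>x. Iu x * (\<sigma> x * \<psi> x) \<partial>lborel) - (\<integral>x. (I x * q x) * \<psi> x \<partial>lborel)" by linarith
    also have "\<dots> = (\<integral>x. Iu x * (\<sigma> x * \<psi> x) - (I x * q x) * \<psi> x \<partial>lborel)"
      by (rule Bochner_Integration.integral_diff[symmetric, OF i2 i3])
    also have "\<dots> = (\<integral>x. - (f x * \<psi> x) \<partial>lborel)"
    proof (rule integral_cong_AE)
      show "AE x in lborel. Iu x * (\<sigma> x * \<psi> x) - (I x * q x) * \<psi> x = - (f x * \<psi> x)"
        using good
      proof eventually_elim
        case (elim x)
        show ?case
        proof (cases "x \<in> X")
          case True
          then have fx: "f x = q x - \<sigma> x * u x" using elim by simp
          show ?thesis unfolding Iu_def fx using True by (simp add: I_def algebra_simps)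
        qed (simp add: Iu_def I_def f_def)
      qed
    qed (unfold Iu_def, measurable)
    finally show ?thesis by simp
  qed
  have lines: "AE x in lborel. AE T in lborel. 0 \<le> T \<longrightarrow> (\<forall>s\<in>{0..T}. x - s *\<^sub>R \<theta> \<in> X) \<longrightarrow>
    Iu x - Iu (x - T *\<^sub>R \<theta>) = (\<integral>s. indicator {0..T} s * f (x - s *\<^sub>R \<theta>) \<partial>lborel)"
    by (rule weak_transport_along_lines[OF op Iui fm fC weak'])
  define G where "G x \<longleftrightarrow> (x \<in> X \<longrightarrow> f x = q x - \<sigma> x * u x \<and> \<bar>q x\<bar> \<le> Q)" for x
  \<comment> \<open>By translation invariance and Fubini, the null set on which f differs from the
    source, or q exceeds \<open>Q\<close>, meets almost every line in a null set of
    parameters.\<close>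
  have good_lines: "AE x in lborel. AE s in (lborel :: real measure). G (x - s *\<^sub>R \<theta>)"
  proof -
    have "AE x in lborel. G (x - s *\<^sub>R \<theta>)" for s
      using AE_lborel_translate[of G "- (s *\<^sub>R \<theta>)"] good by (simp add: G_def)
    then have "AE s in (lborel :: real measure). AE x in lborel. G (x - s *\<^sub>R \<theta>)" by simp
    moreover have "Measurable.pred (lborel \<Otimes>\<^sub>M lborel) (\<lambda>z. G (fst z - snd z *\<^sub>R \<theta>))"
    proof (rule measurable_compose[where g=G])
      show "(\<lambda>z. fst z - snd z *\<^sub>R \<theta>) \<in> lborel \<Otimes>\<^sub>M lborel \<rightarrow>\<^sub>M borel" by measurable
      show "Measurable.pred borel G" unfolding G_def by measurable
    qed
    ultimately show ?thesis
      using lborel_pair.AE_commute[of "\<lambda>x s. G (x - s *\<^sub>R \<theta>)"] by (simp add: pred_def)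
  qed
  \<comment> \<open>At parameter \<open>R\<close>, more than the diameter, the line through a point
    of X has certainly left X.\<close>
  define R where "R = diameter X + 1"
  have R0: "0 \<le> R" using diameter_ge_0[OF bd] by (simp add: R_def)
  show ?thesis
    using lines good_lines AE_surface_lines[OF trace n\<theta> R0] tangential_lines_null[OF X n\<theta> R0]
  proof eventually_elim
    case (elim x)
    show ?case
    proof
      assume x: "x \<in> X"
      have dist: "t \<le> diameter X" if "x - t *\<^sub>R \<theta> \<in> X" "0 \<le> t" for t
        using diameter_bounded_bound[OF bd x that(1)] that n\<theta> by (simp add: dist_norm)
      \<comment> \<open>X is open, so the parameters outside X form a compact set, and the backward
        line has a first exit time l. The line stays in X before l, so its point at l is a boundary
        point through which it enters X.\<close>
      let ?D = "{0..R} \<inter> (\<lambda>t. x - t *\<^sub>R \<theta>) -` (- X)"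
      have "closed ?D" by (intro continuous_closed_preimage continuous_intros) (use op in auto)
      then have "compact ?D" by (metis bounded_Int bounded_closed_interval compact_eq_bounded_closed)
      moreover have "R \<in> ?D" using dist[of R] R0 by (auto simp: R_def)
      ultimately obtain l where l: "l \<in> {0..R}" "x - l *\<^sub>R \<theta> \<notin> X"
        and min: "\<And>t. 0 \<le> t \<Longrightarrow> t \<le> R \<Longrightarrow> x - t *\<^sub>R \<theta> \<notin> X \<Longrightarrow> l \<le> t"
        using compact_attains_inf[of ?D] by fastforce
      have inX: "x - t *\<^sub>R \<theta> \<in> X" if "0 \<le> t" "t < l" for t using min[of t] that l by fastforce
      have "l \<noteq> 0" using l(2) x by auto
      then have l0: "0 < l" using l(1) by auto
      have ld: "l \<le> diameter X"
      proof (rule dense_le_bounded[OF l0])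
        fix t assume "0 < t" "t < l"
        then show "t \<le> diameter X" using dist[of t] inX[of t] by auto
      qed
      define y where "y = x - l *\<^sub>R \<theta>"
      have yt: "y + t *\<^sub>R \<theta> = x - (l - t) *\<^sub>R \<theta>" for t by (simp add: y_def algebra_simps)
      have "y \<in> closure X"
      proof -
        have "(\<lambda>n. x - (l - l / Suc n) *\<^sub>R \<theta>) \<longlonglongrightarrow> x - (l - 0) *\<^sub>R \<theta>"
          by (intro tendsto_intros LIMSEQ_Suc lim_const_over_n)
        moreover have "x - (l - l / Suc n) *\<^sub>R \<theta> \<in> X" for n
          using l0 by (intro inX) (auto simp: field_simps)
        ultimately show ?thesis
          unfolding y_def closure_sequential by (intro exI[of _ "\<lambda>n. x - (l - l / Suc n) *\<^sub>R \<theta>"]) simp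
      qed
      then have yf: "y \<in> frontier X" using l(2) op by (simp add: frontier_def y_def interior_open)
      have "(y, \<theta>) \<in> Gamma_minus X \<or> \<theta> \<bullet> outward_normal X y = 0"
        by (rule entering_line_tangent_or_inflow[OF X yf \<theta> l0]) (simp add: yt inX)
      then have "(y, \<theta>) \<in> Gamma_minus X" using elim(4) l(1) yf by (auto simp: y_def)
      then have tr: "\<forall>\<epsilon>>0. \<exists>\<delta>>0. AE t in lborel. 0 < t \<and> t < \<delta> \<longrightarrow> \<bar>u (y + t *\<^sub>R \<theta>)\<bar> < \<epsilon>"
        using elim(3) l(1) yf by (auto simp: y_def)
      define g where "g s = f (x - s *\<^sub>R \<theta>)" for s
      have g: "g \<in> borel_measurable borel" "\<And>s. \<bar>g s\<bar> \<le> C"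
        unfolding g_def by measurable (rule fC)
      \<comment> \<open>The Lipschitz representative of u on the line; u itself agrees with it only
        for almost every parameter.\<close>
      define W where "W t = u x - (\<integral>s. indicator {0..t} s * g s \<partial>lborel)" for t
      have Wu: "AE t in lborel. 0 < t \<and> t < l \<longrightarrow> u (x - t *\<^sub>R \<theta>) = W t"
        using elim(1)
      proof eventually_elim
        case (elim t)
        show ?case
        proof
          assume t: "0 < t \<and> t < l"
          then have "\<forall>s\<in>{0..t}. x - s *\<^sub>R \<theta> \<in> X" using inX by auto
          then show "u (x - t *\<^sub>R \<theta>) = W t"
            using elim t x inX[of t] by (simp add: W_def g_def Iu_def I_def)
        qed
      qed
      \<comment> \<open>Both the agreement of u with \<open>W\<close> and the smallness of u near
        the inflow end hold for almost every parameter only, after the reflection s = l - t. So one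
        parameter s close to l is chosen at which both hold, and the Lipschitz bound carries the
        smallness on to l.\<close>
      have Wl: "W l = 0"
      proof (rule ccontr)
        assume ne: "W l \<noteq> 0"
        define \<epsilon> where "\<epsilon> = \<bar>W l\<bar> / 2"
        have \<epsilon>: "0 < \<epsilon>" using ne by (simp add: \<epsilon>_def)
        then obtain \<delta> where \<delta>: "0 < \<delta>" and t\<delta>: "AE t in lborel. 0 < t \<and> t < \<delta> \<longrightarrow> \<bar>u (y + t *\<^sub>R \<theta>)\<bar> < \<epsilon>"
          using tr by blast
        have "AE s in lborel. 0 < l + -1 * s \<and> l + -1 * s < \<delta> \<longrightarrow> \<bar>u (y + (l + -1 * s) *\<^sub>R \<theta>)\<bar> < \<epsilon>"
          by (rule AE_borel_affine[OF _ _ t\<delta>]) auto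
        then have "AE s in lborel. (0 < s \<and> s < l \<longrightarrow> u (x - s *\<^sub>R \<theta>) = W s) \<and> (0 < l - s \<and> l - s < \<delta> \<longrightarrow> \<bar>u (x - s *\<^sub>R \<theta>)\<bar> < \<epsilon>)"
          using Wu by eventually_elim (simp add: yt)
        moreover define \<delta>' where "\<delta>' = min \<delta> (min l (\<epsilon> / (C + 1)))"
        have \<delta>': "0 < \<delta>'" using \<delta> l0 \<epsilon> C0 by (simp add: \<delta>'_def)
        ultimately obtain s where s: "l - \<delta>' < s" "s < l" "0 < s \<and> s < l \<longrightarrow> u (x - s *\<^sub>R \<theta>) = W s"
          "0 < l - s \<and> l - s < \<delta> \<longrightarrow> \<bar>u (x - s *\<^sub>R \<theta>)\<bar> < \<epsilon>"
          using AE_lborel_interval_ex[of "\<lambda>s. (0 < s \<and> s < l \<longrightarrow> u (x - s *\<^sub>R \<theta>) = W s) \<and> (0 < l - s \<and> l - s < \<delta> \<longrightarrow> \<bar>u (x - s *\<^sub>R \<theta>)\<bar> < \<epsilon>)" "l - \<delta>'" l]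
          by auto
        have s0: "0 < s" "l - s < \<delta>" "l - s < \<epsilon> / (C + 1)" using s(1) by (auto simp: \<delta>'_def)
        then have "\<bar>W s\<bar> < \<epsilon>" using s by auto
        moreover have "\<bar>W l - W s\<bar> \<le> C * (l - s)"
          using interval_integral_lipschitz[OF g, of s l] s0 s(2) by (simp add: W_def)
        moreover have "C * (l - s) \<le> \<epsilon>"
        proof -
          have "C * (l - s) \<le> C * (\<epsilon> / (C + 1))" using s0 C0 by (intro mult_left_mono) auto
          also have "\<dots> \<le> \<epsilon>" using mult_div_add_one_le[OF C0] \<epsilon> by simp
          finally show ?thesis .
        qed
        ultimately have "\<bar>W l\<bar> < 2 * \<epsilon>" by linarith
        then show False by (simp add: \<epsilon>_def)
      qed
      have gq: "AE s in lborel. 0 < s \<and> s < l \<longrightarrow> g s = q (x - s *\<^sub>R \<theta>) - \<sigma> (x - s *\<^sub>R \<theta>) * W s \<and> \<bar>q (x - s *\<^sub>R \<theta>)\<bar> \<le> Q \<and> x - s *\<^sub>R \<theta> \<in> X"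
        using Wu elim(2)
      proof eventually_elim
        case (elim s)
        then show ?case using inX[of s] by (auto simp: g_def G_def)
      qed
      have "u x \<le> b + c * l"
      proof (rule ray_ode_bound[OF g _ bc W_def Wl])
        show "AE s in lborel. 0 < s \<and> s < l \<longrightarrow> b < W s \<longrightarrow> g s \<le> c"
          using gq
        proof eventually_elim
          case (elim s)
          then show ?case using coercive[of "x - s *\<^sub>R \<theta>" "W s"] by (auto simp: abs_le_iff)
        qed
      qed (use l0 in simp)
      moreover have "- u x \<le> b + c * l"
      proof (rule ray_ode_bound[where g="\<lambda>s. - g s" and W="\<lambda>t. - W t", OF _ _ _ bc])
        show "- W t = - u x - (\<integral>s. indicator {0..t} s * - g s \<partial>lborel)" for t by (simp add: W_def)
        show "AE s in lborel. 0 < s \<and> s < l \<longrightarrow> b < - W s \<longrightarrow> - g s \<le> c"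
          using gq
        proof eventually_elim
          case (elim s)
          then show ?case using coercive[of "x - s *\<^sub>R \<theta>" "- W s"] by (auto simp: abs_le_iff)
        qed
      qed (use l0 g Wl in auto)
      moreover have "c * l \<le> c * diameter X" using ld bc by (intro mult_left_mono) auto
      ultimately show "\<bar>u x\<bar> \<le> b + c * diameter X" by linarith
    qed
  qed
qed

section \<open>Measurability in position and direction, and the scattering operator\<close>

lemma id_measurable_sphere [measurable]: "(\<lambda>x. x) \<in> sphere_measure \<rightarrow>\<^sub>M borel"
  by (rule borel_measurable_sphereI) simp

lemma id_measurable_domain [measurable]: "(\<lambda>x. x) \<in> domain_measure X \<rightarrow>\<^sub>M borel"
  by (rule measurable_restrict_space1) simp

lemma id_measurable_surface [measurable]: "(\<lambda>x. x) \<in> surface_measure X \<rightarrow>\<^sub>M borel"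
  unfolding surface_measure_def
  by (rule measurable_restrict_space1, rule measurable_ident_sets, rule sets_hausdorff_measure)

lemma continuous_pair_measurable:
  fixes v :: "'a::euclidean_space \<Rightarrow> 'a \<Rightarrow> real"
  assumes N: "(\<lambda>x. x) \<in> N \<rightarrow>\<^sub>M borel" and v: "continuous_on UNIV (\<lambda>(x, \<theta>). v x \<theta>)"
  shows "(\<lambda>(x, \<theta>). v x \<theta>) \<in> borel_measurable (N \<Otimes>\<^sub>M sphere_measure)"
proof -
  have 1: "(\<lambda>z. (fst z, snd z)) \<in> N \<Otimes>\<^sub>M sphere_measure \<rightarrow>\<^sub>M (borel :: 'a measure) \<Otimes>\<^sub>M (borel :: 'a measure)"
    by (rule measurable_Pair measurable_compose[OF measurable_fst N] measurable_compose[OF measurable_snd id_measurable_sphere])+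
  have 2: "(\<lambda>(x, \<theta>). v x \<theta>) \<in> borel_measurable ((borel :: 'a measure) \<Otimes>\<^sub>M (borel :: 'a measure))"
    unfolding borel_prod by (rule borel_measurable_continuous_onI[OF v])
  show ?thesis using measurable_compose[OF 1 2] by (simp only: prod.collapse)
qed

lemma finite_measure_domain:
  fixes X :: "'a::euclidean_space set"
  assumes "open X" "bounded X"
  shows "finite_measure (domain_measure X)"
proof (rule finite_measureI)
  have "emeasure (domain_measure X) (space (domain_measure X)) = emeasure lborel X"
    using assms by (simp add: space_restrict_space emeasure_restrict_space)
  then show "emeasure (domain_measure X) (space (domain_measure X)) \<noteq> \<infinity>"
    using emeasure_bounded_finite[OF assms(2)] by simp
qed

lemma AE_domain_iff:
  fixes X :: "'a::euclidean_space set"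
  assumes "open X"
  shows "(AE x in domain_measure X. P x) \<longleftrightarrow> (AE x in lborel. x \<in> X \<longrightarrow> P x)"
  by (rule AE_restrict_space_iff) (use assms in simp)

lemma scattering_cong:
  assumes "\<And>\<theta>'. \<theta>' \<in> sphere 0 1 \<Longrightarrow> k x \<theta> \<theta>' = k' x \<theta> \<theta>'"
  shows "scattering k v x \<theta> = scattering k' v x \<theta>"
  unfolding scattering_def by (rule Bochner_Integration.integral_cong) (use assms in auto)

lemma solves_transport_cong:
  assumes "\<And>x. x \<in> X \<Longrightarrow> \<sigma> x = \<sigma>' x"
    and "\<And>x \<theta> \<theta>'. x \<in> X \<Longrightarrow> \<theta> \<in> sphere 0 1 \<Longrightarrow> \<theta>' \<in> sphere 0 1 \<Longrightarrow> k x \<theta> \<theta>' = k' x \<theta> \<theta>'"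
  shows "solves_transport X \<sigma> k v \<longleftrightarrow> solves_transport X \<sigma>' k' v"
proof -
  have "(\<integral>x. v x \<theta> * (\<sigma> x * \<psi> x - frechet_derivative \<psi> (at x) \<theta>) \<partial>domain_measure X)
      = (\<integral>x. v x \<theta> * (\<sigma>' x * \<psi> x - frechet_derivative \<psi> (at x) \<theta>) \<partial>domain_measure X)"
    "\<theta> \<in> sphere 0 1 \<Longrightarrow> (\<integral>x. scattering k v x \<theta> * \<psi> x \<partial>domain_measure X)
      = (\<integral>x. scattering k' v x \<theta> * \<psi> x \<partial>domain_measure X)" for \<theta> \<psi>
    using assms scattering_cong[of k _ \<theta> k' v]
    by (auto intro!: Bochner_Integration.integral_cong simp: space_restrict_space)
  then show ?thesis
    unfolding solves_transport_def by (intro AE_cong) (simp add: space_sphere_measure)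
qed

lemma section_measurable:
  assumes um: "(\<lambda>(x, \<theta>). u x \<theta>) \<in> borel_measurable (N \<Otimes>\<^sub>M sphere_measure)"
  shows "x \<in> space N \<Longrightarrow> u x \<in> borel_measurable sphere_measure"
    and "\<theta> \<in> sphere 0 1 \<Longrightarrow> (\<lambda>x. u x \<theta>) \<in> borel_measurable N"
  using measurable_compose[OF measurable_Pair1' um, of x] measurable_compose[OF measurable_Pair2' um, of \<theta>] by auto

lemma kernel_section_measurable:
  fixes k :: "'a::euclidean_space \<Rightarrow> 'a \<Rightarrow> 'a \<Rightarrow> real"
  assumes k: "continuous_on UNIV (\<lambda>(x, \<theta>, \<theta>'). k x \<theta> \<theta>')"
  shows "k x \<theta> \<in> borel_measurable sphere_measure"
    and "continuous_on UNIV (\<lambda>(x, \<theta>'). k x \<theta> \<theta>')"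
proof -
  show "k x \<theta> \<in> borel_measurable sphere_measure"
    using continuous_on_compose2[OF k, of UNIV "\<lambda>\<theta>'. (x, \<theta>, \<theta>')"]
    by (intro borel_measurable_sphereI borel_measurable_continuous_onI) (simp add: continuous_on_Pair)
  show "continuous_on UNIV (\<lambda>(x, \<theta>'). k x \<theta> \<theta>')"
    using continuous_on_compose2[OF k, of UNIV "\<lambda>z. (fst z, \<theta>, snd z)"]
    by (simp add: case_prod_beta' continuous_on_Pair continuous_on_fst continuous_on_snd continuous_on_id)
qed

lemma scattering_measurable:
  fixes k :: "'a::euclidean_space \<Rightarrow> 'a \<Rightarrow> 'a \<Rightarrow> real"
  assumes k: "continuous_on UNIV (\<lambda>(x, \<theta>, \<theta>'). k x \<theta> \<theta>')"
    and um: "(\<lambda>(x, \<theta>). u x \<theta>) \<in> borel_measurable (domain_measure X \<Otimes>\<^sub>M sphere_measure)"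
  shows "(\<lambda>x. scattering k u x \<theta>) \<in> borel_measurable (domain_measure X)"
proof -
  have "(\<lambda>(x, \<theta>'). k x \<theta> \<theta>') \<in> borel_measurable (domain_measure X \<Otimes>\<^sub>M sphere_measure)"
    by (rule continuous_pair_measurable[OF id_measurable_domain kernel_section_measurable(2)[OF k]])
  then have "(\<lambda>z. (case z of (x, \<theta>') \<Rightarrow> k x \<theta> \<theta>') * (case z of (x, \<theta>') \<Rightarrow> u x \<theta>')) \<in> borel_measurable (domain_measure X \<Otimes>\<^sub>M sphere_measure)"
    using um by (rule borel_measurable_times)
  then have "(\<lambda>(x, \<theta>'). k x \<theta> \<theta>' * u x \<theta>') \<in> borel_measurable (domain_measure X \<Otimes>\<^sub>M sphere_measure)"
    by (simp add: case_prod_beta')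
  then show ?thesis
    unfolding scattering_def by (rule sphere.borel_measurable_lebesgue_integral)
qed

text \<open>The bounded kernel turns an integrable majorant in the direction into a bound of the
  scattering term that is the same for all \<theta>. This is where control in
  \<open>L\<^sup>p\<close> becomes control in the sup norm.\<close>

lemma scattering_integrable_bound:
  fixes k :: "'a::euclidean_space \<Rightarrow> 'a \<Rightarrow> 'a \<Rightarrow> real"
  assumes k: "continuous_on UNIV (\<lambda>(x, \<theta>, \<theta>'). k x \<theta> \<theta>')" and M: "\<And>x \<theta> \<theta>'. \<bar>k x \<theta> \<theta>'\<bar> \<le> M"
    and um: "u x \<in> borel_measurable sphere_measure"
    and U: "integrable sphere_measure U" "AE \<theta>' in sphere_measure. \<bar>u x \<theta>'\<bar> \<le> U \<theta>'"
  shows "integrable sphere_measure (\<lambda>\<theta>'. k x \<theta> \<theta>' * u x \<theta>')"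
    and "\<bar>scattering k u x \<theta>\<bar> \<le> M * (\<integral>\<theta>'. U \<theta>' \<partial>sphere_measure)"
proof -
  have M0: "0 \<le> M" using M[of x x x] by linarith
  have iMU: "integrable sphere_measure (\<lambda>\<theta>'. M * U \<theta>')" using U(1) by simp
  have bd: "AE \<theta>' in sphere_measure. \<bar>k x \<theta> \<theta>' * u x \<theta>'\<bar> \<le> M * U \<theta>'"
    using U(2)
  proof eventually_elim
    case (elim \<theta>')
    then show ?case unfolding abs_mult by (intro mult_mono M M0) auto
  qed
  show i: "integrable sphere_measure (\<lambda>\<theta>'. k x \<theta> \<theta>' * u x \<theta>')"
  proof (rule Bochner_Integration.integrable_bound[OF iMU])
    show "(\<lambda>\<theta>'. k x \<theta> \<theta>' * u x \<theta>') \<in> borel_measurable sphere_measure"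
      by (intro borel_measurable_times kernel_section_measurable(1)[OF k] um)
    show "AE \<theta>' in sphere_measure. norm (k x \<theta> \<theta>' * u x \<theta>') \<le> norm (M * U \<theta>')"
      using bd by eventually_elim auto
  qed
  have "\<bar>scattering k u x \<theta>\<bar> \<le> (\<integral>\<theta>'. \<bar>k x \<theta> \<theta>' * u x \<theta>'\<bar> \<partial>sphere_measure)"
    unfolding scattering_def by (rule integral_abs_bound)
  also have "\<dots> \<le> (\<integral>\<theta>'. M * U \<theta>' \<partial>sphere_measure)"
    by (rule integral_mono_AE[OF integrable_abs[OF i] iMU bd])
  finally show "\<bar>scattering k u x \<theta>\<bar> \<le> M * (\<integral>\<theta>'. U \<theta>' \<partial>sphere_measure)" by simp
qed

text \<open>Transport is solved at fixed \<theta>, scattering is evaluated at fixed x; the iteration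
  alternates between the two orders of quantifiers, and joint measurability permits the
  exchange.\<close>

lemma AE_domain_sphere_swap:
  fixes X :: "'a::euclidean_space set" and u :: "'a \<Rightarrow> 'a \<Rightarrow> real"
  assumes X: "open X" "bounded X"
    and um: "(\<lambda>(x, \<theta>). u x \<theta>) \<in> borel_measurable (domain_measure X \<Otimes>\<^sub>M sphere_measure)"
    and U: "U \<in> borel_measurable sphere_measure"
  shows "(AE \<theta> in sphere_measure. AE x in domain_measure X. \<bar>u x \<theta>\<bar> \<le> U \<theta>)
    \<longleftrightarrow> (AE x in domain_measure X. AE \<theta> in sphere_measure. \<bar>u x \<theta>\<bar> \<le> U \<theta>)"
    and "(AE \<theta> in sphere_measure. AE x in domain_measure X. \<bar>u x \<theta>\<bar> \<le> U \<theta>)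
    \<Longrightarrow> (AE z in domain_measure X \<Otimes>\<^sub>M sphere_measure. \<bar>u (fst z) (snd z)\<bar> \<le> U (snd z))"
proof -
  interpret D: finite_measure "domain_measure X" by (rule finite_measure_domain[OF X])
  interpret P: pair_sigma_finite "domain_measure X" "sphere_measure :: 'a measure" ..
  have m: "Measurable.pred (domain_measure X \<Otimes>\<^sub>M sphere_measure) (\<lambda>z. \<bar>u (fst z) (snd z)\<bar> \<le> U (snd z))"
  proof -
    have "(\<lambda>z. u (fst z) (snd z)) \<in> borel_measurable (domain_measure X \<Otimes>\<^sub>M sphere_measure)"
      using um by (simp add: case_prod_beta')
    moreover have "(\<lambda>z. U (snd z)) \<in> borel_measurable (domain_measure X \<Otimes>\<^sub>M sphere_measure)"
      by (rule measurable_compose[OF measurable_snd U])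
    ultimately show ?thesis unfolding pred_def by (intro borel_measurable_le borel_measurable_abs)
  qed
  show eq: "(AE \<theta> in sphere_measure. AE x in domain_measure X. \<bar>u x \<theta>\<bar> \<le> U \<theta>)
    \<longleftrightarrow> (AE x in domain_measure X. AE \<theta> in sphere_measure. \<bar>u x \<theta>\<bar> \<le> U \<theta>)"
    using P.AE_commute[of "\<lambda>x \<theta>. \<bar>u x \<theta>\<bar> \<le> U \<theta>"] m unfolding pred_def by blast
  show "(AE \<theta> in sphere_measure. AE x in domain_measure X. \<bar>u x \<theta>\<bar> \<le> U \<theta>)
    \<Longrightarrow> (AE z in domain_measure X \<Otimes>\<^sub>M sphere_measure. \<bar>u (fst z) (snd z)\<bar> \<le> U (snd z))"
    using eq P.AE_pair_iff[of "\<lambda>x \<theta>. \<bar>u x \<theta>\<bar> \<le> U \<theta>"] m unfolding pred_def by blast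
qed

text \<open>The estimate on lines, run for almost every \<theta>. The bound \<open>Q\<close> holds
  at almost every x for all \<theta> simultaneously, so that fixing a direction afterwards costs no
  further null set.\<close>

lemma transport_sup_bound:
  fixes X :: "'a::euclidean_space set"
  assumes X: "smooth_bounded_domain X" and \<sigma>: "continuous_on UNIV \<sigma>" "\<And>x. \<bar>\<sigma> x\<bar> \<le> M"
    and k: "continuous_on UNIV (\<lambda>(x, \<theta>, \<theta>'). k x \<theta> \<theta>')"
    and um: "(\<lambda>(x, \<theta>). u x \<theta>) \<in> borel_measurable (domain_measure X \<Otimes>\<^sub>M sphere_measure)"
    and u: "AE \<theta> in sphere_measure. AE x in domain_measure X. \<bar>u x \<theta>\<bar> \<le> U \<theta>"
    and Q: "AE x in domain_measure X. \<forall>\<theta>\<in>sphere 0 1. \<bar>scattering k u x \<theta>\<bar> \<le> Q"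
    and sol: "solves_transport X \<sigma> k u" and tr: "inflow_trace X u (\<lambda>_ _. 0)"
    and bc: "0 \<le> b" "0 \<le> c" "\<And>x m. x \<in> X \<Longrightarrow> b < m \<Longrightarrow> Q - \<sigma> x * m \<le> c"
  shows "AE \<theta> in sphere_measure. AE x in domain_measure X. \<bar>u x \<theta>\<bar> \<le> b + c * diameter X"
proof -
  have op: "open X" using X by (simp add: smooth_bounded_domain_def)
  then have Xs: "X \<inter> space lborel \<in> sets lborel" by simp
  show ?thesis
    using u sol[unfolded solves_transport_def] tr[unfolded inflow_trace_def] AE_space
  proof eventually_elim
    case (elim \<theta>)
    then have \<theta>: "\<theta> \<in> sphere 0 1" by simp
    \<comment> \<open>Multiplication by the indicator turns functions measurable on X into Borel
      functions on the whole space without changing any integral over X.\<close>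
    define u' where "u' x = indicator X x * u x \<theta>" for x
    define q where "q x = indicator X x * scattering k u x \<theta>" for x
    have um': "u' \<in> borel_measurable borel"
      using section_measurable(2)[OF um \<theta>] borel_measurable_restrict_space_iff[OF Xs, of "\<lambda>x. u x \<theta>"]
      by (simp add: u'_def[abs_def] mult.commute)
    have qm: "q \<in> borel_measurable borel"
      using scattering_measurable[OF k um, of \<theta>] borel_measurable_restrict_space_iff[OF Xs, of "\<lambda>x. scattering k u x \<theta>"]
      by (simp add: q_def[abs_def] mult.commute)
    have "AE x in lborel. x \<in> X \<longrightarrow> \<bar>u' x\<bar> \<le> b + c * diameter X"
    proof (rule weak_transport_bound[OF X \<theta> um' qm _ \<sigma>(2) _ _ _ _ bc])
      show "\<sigma> \<in> borel_measurable borel" by (rule borel_measurable_continuous_onI[OF \<sigma>(1)])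
      show "AE x in lborel. x \<in> X \<longrightarrow> \<bar>u' x\<bar> \<le> U \<theta>"
        using elim(1) unfolding AE_domain_iff[OF op] by eventually_elim (simp add: u'_def)
      show "AE x in lborel. x \<in> X \<longrightarrow> \<bar>q x\<bar> \<le> Q"
        using Q unfolding AE_domain_iff[OF op] by eventually_elim (use \<theta> in \<open>simp add: q_def\<close>)
      fix \<psi> assume \<psi>: "test_function X \<psi>"
      have "(\<integral>x. u' x * (\<sigma> x * \<psi> x - frechet_derivative \<psi> (at x) \<theta>) \<partial>domain_measure X)
          = (\<integral>x. u x \<theta> * (\<sigma> x * \<psi> x - frechet_derivative \<psi> (at x) \<theta>) \<partial>domain_measure X)"
        by (rule Bochner_Integration.integral_cong) (auto simp: u'_def space_restrict_space)
      also have "\<dots> = (\<integral>x. scattering k u x \<theta> * \<psi> x \<partial>domain_measure X)" using elim(2) \<psi> by blast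
      also have "\<dots> = (\<integral>x. q x * \<psi> x \<partial>domain_measure X)"
        by (rule Bochner_Integration.integral_cong) (auto simp: q_def space_restrict_space)
      finally show "(\<integral>x. u' x * (\<sigma> x * \<psi> x - frechet_derivative \<psi> (at x) \<theta>) \<partial>domain_measure X)
          = (\<integral>x. q x * \<psi> x \<partial>domain_measure X)" .
    next
      show "AE y in surface_measure X. (y, \<theta>) \<in> Gamma_minus X \<longrightarrow>
        (\<forall>\<epsilon>>0. \<exists>\<delta>>0. AE t in lborel. 0 < t \<and> t < \<delta> \<longrightarrow> \<bar>u' (y + t *\<^sub>R \<theta>)\<bar> < \<epsilon>)"
        using elim(3)
      proof eventually_elim
        case (elim y)
        show ?case
        proof (intro impI allI)
          fix \<epsilon> :: real assume "(y, \<theta>) \<in> Gamma_minus X" "0 < \<epsilon>"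
          then obtain \<delta> where \<delta>: "0 < \<delta>" "AE t in lborel. 0 < t \<and> t < \<delta> \<longrightarrow> \<bar>u (y + t *\<^sub>R \<theta>) \<theta> - 0\<bar> < \<epsilon>"
            using elim by blast
          from \<delta>(2) have "AE t in lborel. 0 < t \<and> t < \<delta> \<longrightarrow> \<bar>u' (y + t *\<^sub>R \<theta>)\<bar> < \<epsilon>"
            by eventually_elim (use \<open>0 < \<epsilon>\<close> in \<open>auto simp: u'_def indicator_def\<close>)
          then show "\<exists>\<delta>>0. AE t in lborel. 0 < t \<and> t < \<delta> \<longrightarrow> \<bar>u' (y + t *\<^sub>R \<theta>)\<bar> < \<epsilon>" using \<delta>(1) by blast
        qed
      qed
    qed
    then show ?case unfolding AE_domain_iff[OF op] by eventually_elim (simp add: u'_def)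
  qed
qed

text \<open>The two subcritical regimes are \<open>(\<beta>, \<gamma>) = (1 / (1 + \<alpha>), 0)\<close> and \<open>(\<beta>, \<gamma>) = (0, 1)\<close>, where
  \<open>\<rho> = 1\<close> because of the normalization.\<close>

lemma transport_homogeneous_zero:
  fixes X :: "'a::euclidean_space set"
  assumes X: "smooth_bounded_domain X" and \<sigma>: "continuous_on UNIV \<sigma>" "\<And>x. \<bar>\<sigma> x\<bar> \<le> M"
    and k: "continuous_on UNIV (\<lambda>(x, \<theta>, \<theta>'). k x \<theta> \<theta>')" "\<And>x \<theta> \<theta>'. \<bar>k x \<theta> \<theta>'\<bar> \<le> M"
    and \<sigma>0: "\<And>x. x \<in> X \<Longrightarrow> 0 \<le> \<sigma> x"
    and k0: "\<And>x \<theta> \<theta>'. x \<in> X \<Longrightarrow> \<theta> \<in> sphere 0 1 \<Longrightarrow> \<theta>' \<in> sphere 0 1 \<Longrightarrow> 0 \<le> k x \<theta> \<theta>'"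
    and k1: "\<And>x \<theta>. x \<in> X \<Longrightarrow> \<theta> \<in> sphere 0 1 \<Longrightarrow> (\<integral>\<theta>'. k x \<theta> \<theta>' \<partial>sphere_measure) = 1"
    and sub: "0 \<le> \<beta>" "0 \<le> \<gamma>" "\<beta> + \<gamma> * diameter X < 1" "\<And>x m. x \<in> X \<Longrightarrow> \<beta> < m \<Longrightarrow> 1 - \<sigma> x * m \<le> \<gamma>"
    and um: "(\<lambda>(x, \<theta>). u x \<theta>) \<in> borel_measurable (domain_measure X \<Otimes>\<^sub>M sphere_measure)"
    and U: "integrable sphere_measure U" "AE \<theta> in sphere_measure. AE x in domain_measure X. \<bar>u x \<theta>\<bar> \<le> U \<theta>"
    and sol: "solves_transport X \<sigma> k u" and tr: "inflow_trace X u (\<lambda>_ _. 0)"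
  shows "AE z in domain_measure X \<Otimes>\<^sub>M sphere_measure. u (fst z) (snd z) = 0"
proof -
  have op: "open X" and bd: "bounded X" using X by (auto simp: smooth_bounded_domain_def)
  define \<kappa> where "\<kappa> = \<beta> + \<gamma> * diameter X"
  have \<kappa>: "0 \<le> \<kappa>" "\<kappa> < 1" using sub diameter_ge_0[OF bd] by (auto simp: \<kappa>_def)
  define Q where "Q = max 0 (M * (\<integral>\<theta>'. U \<theta>' \<partial>sphere_measure))"
  define B where "B = Q * diameter X"
  have Q0: "0 \<le> Q" by (simp add: Q_def)
  have B0: "0 \<le> B" using Q0 diameter_ge_0[OF bd] by (simp add: B_def)
  have "AE x in domain_measure X. \<forall>\<theta>\<in>sphere 0 1. \<bar>scattering k u x \<theta>\<bar> \<le> Q"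
    using U(2)[unfolded AE_domain_sphere_swap(1)[OF op bd um borel_measurable_integrable[OF U(1)]]] AE_space
  proof eventually_elim
    case (elim x)
    then show ?case
      using scattering_integrable_bound(2)[where u=u, OF k section_measurable(1)[OF um elim(2)] U(1) elim(1)]
      by (simp add: Q_def le_max_iff_disj)
  qed
  \<comment> \<open>The first pass, with b = 0 and c = \<open>Q\<close>: since \<sigma> \<ge> 0,
    absorption can only help, and u becomes essentially bounded although its majorant
    \<open>U\<close> was merely integrable.\<close>
  then have start: "AE \<theta> in sphere_measure. AE x in domain_measure X. \<bar>u x \<theta>\<bar> \<le> 0 + Q * diameter X"
    by (rule transport_sup_bound[OF X \<sigma> k(1) um U(2) _ sol tr order_refl Q0]) (use \<sigma>0 in auto)
  have iter: "AE \<theta> in sphere_measure. AE x in domain_measure X. \<bar>u x \<theta>\<bar> \<le> \<kappa> ^ n * B" for n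
  proof (induction n)
    case 0
    then show ?case using start by (simp add: B_def)
  next
    case (Suc n)
    define b where "b = \<kappa> ^ n * B"
    have b0: "0 \<le> b" using \<kappa> B0 by (simp add: b_def)
    have IH: "AE \<theta> in sphere_measure. AE x in domain_measure X. \<bar>u x \<theta>\<bar> \<le> b" using Suc by (simp add: b_def)
    have sc: "AE x in domain_measure X. \<forall>\<theta>\<in>sphere 0 1. \<bar>scattering k u x \<theta>\<bar> \<le> b"
      using IH[unfolded AE_domain_sphere_swap(1)[OF op bd um borel_measurable_const]] AE_space
    proof eventually_elim
      case (elim x)
      then have x: "x \<in> X" by (simp add: space_restrict_space)
      show ?case
      proof
        fix \<theta> :: 'a assume \<theta>: "\<theta> \<in> sphere 0 1"
        have i: "integrable sphere_measure (\<lambda>\<theta>'. k x \<theta> \<theta>' * u x \<theta>')"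
          by (rule scattering_integrable_bound(1)[where u=u, OF k section_measurable(1)[OF um elim(2)] _ elim(1)]) simp
        \<comment> \<open>A nonintegrable function would have integral 0 by convention, not
          1.\<close>
        have ik: "integrable sphere_measure (k x \<theta>)"
          using k1[OF x \<theta>] by (metis not_integrable_integral_eq zero_neq_one)
        have "\<bar>scattering k u x \<theta>\<bar> \<le> (\<integral>\<theta>'. \<bar>k x \<theta> \<theta>' * u x \<theta>'\<bar> \<partial>sphere_measure)"
          unfolding scattering_def by (rule integral_abs_bound)
        also have "\<dots> \<le> (\<integral>\<theta>'. k x \<theta> \<theta>' * b \<partial>sphere_measure)"
        proof (rule integral_mono_AE)
          show "AE \<theta>' in sphere_measure. \<bar>k x \<theta> \<theta>' * u x \<theta>'\<bar> \<le> k x \<theta> \<theta>' * b"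
            using elim(1) AE_space
          proof eventually_elim
            case (elim \<theta>')
            then have "0 \<le> k x \<theta> \<theta>'" by (intro k0 x \<theta>) simp
            then show ?case using elim by (simp add: abs_mult mult_left_mono)
          qed
        qed (use i ik in auto)
        also have "\<dots> = b" using k1[OF x \<theta>] by simp
        finally show "\<bar>scattering k u x \<theta>\<bar> \<le> b" .
      qed
    qed
    \<comment> \<open>With u bounded by b, the normalization bounds the scattering term by the same
      b. The level and the source are then both scaled, to \<beta> b and \<gamma> b, and the new
      bound is \<kappa> b.\<close>
    have "AE \<theta> in sphere_measure. AE x in domain_measure X. \<bar>u x \<theta>\<bar> \<le> \<beta> * b + \<gamma> * b * diameter X"
    proof (rule transport_sup_bound[OF X \<sigma> k(1) um IH sc sol tr])
      \<comment> \<open>The coercivity hypothesis is homogeneous: apply it at m / b and multiply by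
        b. For b = 0 there is nothing to divide by, and \<sigma> \<ge> 0 suffices.\<close>
      fix x m assume x: "x \<in> X" "\<beta> * b < m"
      show "b - \<sigma> x * m \<le> \<gamma> * b"
      proof (cases "b = 0")
        case True
        then show ?thesis using x \<sigma>0[OF x(1)] by simp
      next
        case False
        then have b: "0 < b" using b0 by simp
        then have "1 - \<sigma> x * (m / b) \<le> \<gamma>" using x by (intro sub(4)) (auto simp: field_simps)
        then have "b * (1 - \<sigma> x * (m / b)) \<le> b * \<gamma>" using b by (intro mult_left_mono) auto
        then show ?thesis using b by (simp add: algebra_simps)
      qed
    qed (use sub b0 in auto)
    moreover have "\<beta> * b + \<gamma> * b * diameter X = \<kappa> ^ Suc n * B"
      by (simp add: \<kappa>_def b_def algebra_simps)
    ultimately show ?case by simp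
  qed
  have "AE z in domain_measure X \<Otimes>\<^sub>M sphere_measure. \<bar>u (fst z) (snd z)\<bar> \<le> \<kappa> ^ n * B" for n
    by (rule AE_domain_sphere_swap(2)[OF op bd um _ iter]) simp
  then have "AE z in domain_measure X \<Otimes>\<^sub>M sphere_measure. \<forall>n. \<bar>u (fst z) (snd z)\<bar> \<le> \<kappa> ^ n * B"
    by (simp add: AE_all_countable)
  then show ?thesis
  proof eventually_elim
    case (elim z)
    have "(\<lambda>n. \<kappa> ^ n * B) \<longlonglongrightarrow> 0 * B"
      using \<kappa> by (intro tendsto_mult tendsto_const LIMSEQ_realpow_zero)
    then have "\<bar>u (fst z) (snd z)\<bar> \<le> 0 * B" by (rule LIMSEQ_le_const) (use elim in blast)
    then show ?case by simp
  qed
qed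


section \<open>Mixed norms and the value of \<rho>\<close>

text \<open>The essential supremum at \<theta> is at most c exactly if the section at \<theta> of
  the set where |w| > c is null, and the measure of sections of a measurable set is a measurable
  function of \<theta>.\<close>

lemma Linf_norm_section_measurable:
  fixes X :: "'a::euclidean_space set" and w :: "'a \<Rightarrow> 'a \<Rightarrow> real"
  assumes X: "open X" "bounded X"
    and wm: "(\<lambda>(x, \<theta>). w x \<theta>) \<in> borel_measurable (domain_measure X \<Otimes>\<^sub>M sphere_measure)"
  shows "(\<lambda>\<theta>. Linf_norm (domain_measure X) (\<lambda>x. ennreal \<bar>w x \<theta>\<bar>)) \<in> borel_measurable sphere_measure"
proof (rule borel_measurableI_le)
  interpret D: finite_measure "domain_measure X" by (rule finite_measure_domain[OF X])
  interpret P: pair_sigma_finite "domain_measure X" "sphere_measure :: 'a measure" ..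
  fix c :: ennreal
  let ?A = "{z\<in>space (domain_measure X \<Otimes>\<^sub>M sphere_measure). c < ennreal \<bar>case z of (x, \<theta>) \<Rightarrow> w x \<theta>\<bar>}"
  have A: "?A \<in> sets (domain_measure X \<Otimes>\<^sub>M sphere_measure)"
    using wm by (intro borel_measurable_less borel_measurable_const measurable_compose[OF _ measurable_ennreal] borel_measurable_abs)
  have "Linf_norm (domain_measure X) (\<lambda>x. ennreal \<bar>w x \<theta>\<bar>) \<le> c
      \<longleftrightarrow> emeasure (domain_measure X) ((\<lambda>x. (x, \<theta>)) -` ?A) = 0" if \<theta>: "\<theta> \<in> sphere 0 1" for \<theta>
  proof -
    let ?B = "(\<lambda>x. (x, \<theta>)) -` ?A"
    have B: "?B \<in> sets (domain_measure X)" using A by (rule sets_Pair2)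
    have Be: "?B = {x\<in>space (domain_measure X). \<not> ennreal \<bar>w x \<theta>\<bar> \<le> c}"
      using \<theta> by (auto simp: space_pair_measure not_le)
    have "Linf_norm (domain_measure X) (\<lambda>x. ennreal \<bar>w x \<theta>\<bar>) \<le> c \<longleftrightarrow> (AE x in domain_measure X. ennreal \<bar>w x \<theta>\<bar> \<le> c)"
      using AE_le_Linf_norm[where M="domain_measure X" and F="\<lambda>x. ennreal \<bar>w x \<theta>\<bar>"]
      by (auto intro: Linf_norm_le elim!: eventually_mono)
    also have "\<dots> \<longleftrightarrow> emeasure (domain_measure X) ?B = 0"
      using AE_iff_measurable[OF B, of "\<lambda>x. ennreal \<bar>w x \<theta>\<bar> \<le> c"] Be by simp
    finally show ?thesis .
  qed
  then have "{\<theta>\<in>space sphere_measure. Linf_norm (domain_measure X) (\<lambda>x. ennreal \<bar>w x \<theta>\<bar>) \<le> c}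
      = {\<theta>\<in>space sphere_measure. emeasure (domain_measure X) ((\<lambda>x. (x, \<theta>)) -` ?A) = 0}" by auto
  also have "\<dots> \<in> sets sphere_measure"
    by (rule borel_measurable_eq[OF P.measurable_emeasure_Pair2[OF A] borel_measurable_const])
  finally show "{\<theta>\<in>space sphere_measure. Linf_norm (domain_measure X) (\<lambda>x. ennreal \<bar>w x \<theta>\<bar>) \<le> c} \<in> sets sphere_measure" .
qed

text \<open>The sphere has finite measure, so every exponent reduces to an integrable majorant: the
  essential supremum L in x satisfies L \<le> 1 + L^q. Uniqueness can then be proved without
  reference to p.\<close>

lemma mixed_space_dominated:
  fixes X :: "'a::euclidean_space set"
  assumes X: "open X" "bounded X" and p: "1 \<le> p" and w: "w \<in> mixed_space p (domain_measure X)"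
  obtains U where "integrable sphere_measure U" "AE \<theta> in sphere_measure. AE x in domain_measure X. \<bar>w x \<theta>\<bar> \<le> U \<theta>"
proof -
  have wm: "(\<lambda>(x, \<theta>). w x \<theta>) \<in> borel_measurable (domain_measure X \<Otimes>\<^sub>M sphere_measure)"
    and fin: "mixed_norm p (domain_measure X) w < \<infinity>" using w by (auto simp: mixed_space_def)
  define L where "L \<theta> = Linf_norm (domain_measure X) (\<lambda>x. ennreal \<bar>w x \<theta>\<bar>)" for \<theta>
  have Lm[measurable]: "L \<in> borel_measurable sphere_measure"
    unfolding L_def by (rule Linf_norm_section_measurable[OF X wm])
  have "(\<integral>\<^sup>+\<theta>. L \<theta> \<partial>sphere_measure) < \<infinity>"
  proof (cases "p = \<infinity>")
    case True
    then have c: "Linf_norm sphere_measure L < \<infinity>" using fin by (simp add: mixed_norm_def Lp_norm_def L_def[abs_def])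
    have "(\<integral>\<^sup>+\<theta>. L \<theta> \<partial>sphere_measure) \<le> nn_integral sphere_measure (\<lambda>\<theta>::'a. Linf_norm sphere_measure L)"
      by (rule nn_integral_mono_AE) (rule AE_le_Linf_norm)
    also have "\<dots> < \<infinity>"
      using c by (simp add: emeasure_sphere_measure_space ennreal_mult_less_top)
    finally show ?thesis .
  next
    case False
    define q where "q = enn2real p"
    have q: "1 \<le> q" using p False unfolding q_def
      by (metis enn2real_1 enn2real_mono ennreal_one_less_top infinity_ennreal_def le_less_trans less_top not_le top.not_eq_extremum)
    have "ennreal_powr (\<integral>\<^sup>+\<theta>. ennreal_powr (L \<theta>) q \<partial>sphere_measure) (1 / q) < \<infinity>"
      using fin False by (simp add: mixed_norm_def Lp_norm_def L_def q_def)
    then have fq: "(\<integral>\<^sup>+\<theta>. ennreal_powr (L \<theta>) q \<partial>sphere_measure) < \<infinity>"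
      by (auto simp: ennreal_powr_def less_top split: if_splits)
    have "L \<theta> \<le> 1 + ennreal_powr (L \<theta>) q" for \<theta>
    proof (cases "L \<theta>")
      case (real l)
      have "l \<le> 1 + l powr q"
      proof (cases "l \<le> 1")
        case False
        then have "l powr 1 \<le> l powr q" using q by (intro powr_mono) auto
        then show ?thesis using False by simp
      qed (simp add: add_increasing2)
      then have "ennreal l \<le> ennreal (1 + l powr q)" by (rule ennreal_leI)
      then show ?thesis using real by (simp add: ennreal_powr_ennreal)
    qed (simp add: ennreal_powr_def)
    then have "(\<integral>\<^sup>+\<theta>. L \<theta> \<partial>sphere_measure) \<le> (\<integral>\<^sup>+\<theta>. 1 + ennreal_powr (L \<theta>) q \<partial>sphere_measure)"
      by (intro nn_integral_mono)
    also have "\<dots> = nn_integral sphere_measure (\<lambda>\<theta>::'a. 1) + (\<integral>\<^sup>+\<theta>. ennreal_powr (L \<theta>) q \<partial>sphere_measure)"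
      by (rule nn_integral_add) (simp_all add: ennreal_powr_def)
    also have "\<dots> < \<infinity>" using fq by (simp add: emeasure_sphere_measure_space)
    finally show ?thesis .
  qed
  then have Lf: "(\<integral>\<^sup>+\<theta>. L \<theta> \<partial>sphere_measure) \<noteq> \<infinity>" by simp
  have ae: "AE \<theta> in sphere_measure. L \<theta> \<noteq> \<infinity>" by (rule nn_integral_PInf_AE[OF Lm Lf])
  have eL: "(\<integral>\<^sup>+\<theta>. ennreal (enn2real (L \<theta>)) \<partial>sphere_measure) = (\<integral>\<^sup>+\<theta>. L \<theta> \<partial>sphere_measure)"
    by (rule nn_integral_cong_AE) (use ae in eventually_elim, simp add: less_top)
  show thesis
  proof (rule that[of "\<lambda>\<theta>. enn2real (L \<theta>)"])
    show "integrable sphere_measure (\<lambda>\<theta>. enn2real (L \<theta>))"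
      by (rule integrableI_bounded) (use eL Lf in \<open>auto simp: less_top\<close>)
    show "AE \<theta> in sphere_measure. AE x in domain_measure X. \<bar>w x \<theta>\<bar> \<le> enn2real (L \<theta>)"
      using ae
    proof eventually_elim
      case (elim \<theta>)
      then obtain l where l: "L \<theta> = ennreal l" "0 \<le> l" by (cases "L \<theta>") auto
      have "AE x in domain_measure X. ennreal \<bar>w x \<theta>\<bar> \<le> L \<theta>" unfolding L_def by (rule AE_le_Linf_norm)
      then show ?case using l by simp
    qed
  qed
qed

text \<open>The function inside the norm is constantly 1, so all depends on the product measure not
  being zero; the open nonempty set X is not negligible, and the sphere has positive mass.\<close>

lemma scattering_bound_eq_1:
  fixes X :: "'a::euclidean_space set"
  assumes X: "open X" "bounded X" "X \<noteq> {}"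
    and k1: "\<And>x \<theta>. x \<in> X \<Longrightarrow> \<theta> \<in> sphere 0 1 \<Longrightarrow> (\<integral>\<theta>'. k x \<theta> \<theta>' \<partial>sphere_measure) = 1"
  shows "scattering_bound X k = 1"
proof -
  interpret D: finite_measure "domain_measure X" by (rule finite_measure_domain[OF X(1,2)])
  let ?M = "domain_measure X \<Otimes>\<^sub>M (sphere_measure :: 'a measure)"
  let ?F = "\<lambda>(x, \<theta>). ennreal \<bar>\<integral>\<theta>'. k x \<theta> \<theta>' \<partial>sphere_measure\<bar>"
  have one: "?F z = 1" if "z \<in> space ?M" for z
    using that k1 by (auto simp: space_pair_measure space_restrict_space)
  have nz: "emeasure ?M (space ?M) \<noteq> 0"
  proof -
    have "emeasure ?M (space ?M) = emeasure (domain_measure X) (space (domain_measure X)) * emeasure sphere_measure (sphere (0::'a) 1)"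
      unfolding space_pair_measure space_sphere_measure
      by (rule sphere.emeasure_pair_measure_Times) (simp_all add: sets.top[of sphere_measure, simplified])
    also have "emeasure (domain_measure X) (space (domain_measure X)) = emeasure lborel X"
      using X by (simp add: space_restrict_space emeasure_restrict_space)
    finally have eq: "emeasure ?M (space ?M) = emeasure lborel X * emeasure sphere_measure (sphere (0::'a) 1)" .
    have "emeasure lborel X \<noteq> 0"
    proof
      assume "emeasure lborel X = 0"
      then have "AE x in lborel. x \<notin> X" using X by (intro AE_not_in) (simp add: null_sets_def)
      then have "negligible X" using X(1) AE_iff_null_sets[of X lborel] negligible_iff_null_sets null_sets_completionI by auto
      then show False using open_not_negligible[OF X(1) X(3)] by blast
    qed
    then show ?thesis using eq sphere_measure_nonzero by simp
  qed
  have "Linf_norm ?M ?F = 1"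
  proof (rule antisym)
    show "Linf_norm ?M ?F \<le> 1" by (rule Linf_norm_le) (use one in \<open>auto intro!: AE_I2\<close>)
    show "1 \<le> Linf_norm ?M ?F"
    proof (rule ccontr)
      assume lt: "\<not> 1 \<le> Linf_norm ?M ?F"
      have "AE z in ?M. False"
        using AE_le_Linf_norm[where M="?M" and F="?F"] AE_space
      proof eventually_elim
        case (elim z)
        then show ?case using one[OF elim(2)] lt by simp
      qed
      then have "AE z in ?M. z \<notin> space ?M" by eventually_elim simp
      then have "space ?M \<in> null_sets ?M" using AE_iff_null_sets[OF sets.top[of ?M]] by blast
      then have "emeasure ?M (space ?M) = 0" by (rule null_setsD1)
      then show False using nz by blast
    qed
  qed
  then show ?thesis by (simp add: scattering_bound_def)
qed

lemma mixed_norm_le_Lp_norm: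
  assumes "\<And>x \<theta>. x \<in> space N \<Longrightarrow> \<theta> \<in> sphere 0 1 \<Longrightarrow> \<bar>v x \<theta>\<bar> \<le> G \<theta>"
  shows "mixed_norm p N v \<le> Lp_norm p sphere_measure (\<lambda>\<theta>. ennreal (G \<theta>))"
  unfolding mixed_norm_def
proof (rule Lp_norm_mono, rule AE_I2)
  fix \<theta> :: 'a assume "\<theta> \<in> space sphere_measure"
  then show "Linf_norm N (\<lambda>x. ennreal \<bar>v x \<theta>\<bar>) \<le> ennreal (G \<theta>)"
    by (intro Linf_norm_le AE_I2 ennreal_leI assms) auto
qed

lemma Lp_norm_bounded_finite:
  assumes fin: "finite_measure M" and B: "\<And>x. x \<in> space M \<Longrightarrow> F x \<le> ennreal B" "0 \<le> B"
  shows "Lp_norm p M F < \<infinity>"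
proof -
  interpret finite_measure M by (rule fin)
  have "Lp_norm p M F \<le> Lp_norm p M (\<lambda>_. ennreal B)" by (rule Lp_norm_mono) (use B in \<open>auto intro: AE_I2\<close>)
  also have "\<dots> < \<infinity>"
  proof (cases "p = \<infinity>")
    case True
    have "Linf_norm M (\<lambda>_. ennreal B) \<le> ennreal B" by (rule Linf_norm_le) simp
    then show ?thesis using True by (simp add: Lp_norm_def le_less_trans)
  next
    case False
    have "ennreal (B powr enn2real p) * emeasure M (space M) < \<infinity>"
      by (simp add: emeasure_eq_measure ennreal_mult[symmetric])
    then show ?thesis using False B by (auto simp: Lp_norm_def ennreal_powr_ennreal ennreal_powr_def)
  qed
  finally show ?thesis .
qed

section \<open>Existence, traces, and differences of solutions\<close>

text \<open>The fixed point is merely continuous in x, but differentiable along each direction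
  \<theta>, and the weak equation needs no more. It is defined on the whole space, so it solves the
  equation on every open set.\<close>

lemma transport_solution_exists:
  fixes \<sigma> :: "'a::euclidean_space \<Rightarrow> real" and k :: "'a \<Rightarrow> 'a \<Rightarrow> 'a \<Rightarrow> real"
  assumes \<sigma>: "continuous_on UNIV \<sigma>" and k: "continuous_on UNIV (\<lambda>(x, \<theta>, \<theta>'). k x \<theta> \<theta>')"
    and M: "\<And>x. \<bar>\<sigma> x\<bar> \<le> M" "\<And>x \<theta> \<theta>'. \<bar>k x \<theta> \<theta>'\<bar> \<le> M"
  obtains \<mu> where "0 < \<mu>" and "\<And>x\<^sub>0 h B. continuous_on UNIV h \<Longrightarrow> (\<And>\<theta>. \<bar>h \<theta>\<bar> \<le> B) \<Longrightarrow>
    \<exists>v. continuous_on UNIV (\<lambda>(x, \<theta>). v x \<theta>) \<and> (\<forall>\<theta>\<in>sphere 0 1. v x\<^sub>0 \<theta> = h \<theta>) \<and>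
      (\<forall>x. \<forall>\<theta>\<in>sphere 0 1. \<bar>v x \<theta>\<bar>
         \<le> exp (\<mu> * (norm (x - x\<^sub>0))\<^sup>2) * (2 * \<bar>h \<theta>\<bar> + (\<integral>\<theta>'. \<bar>h \<theta>'\<bar> \<partial>sphere_measure))) \<and>
      (\<forall>X. open X \<longrightarrow> solves_transport X \<sigma> k v)"
proof (rule ray_fixpoint_exists[OF \<sigma> k M])
  fix \<mu> :: real
  assume \<mu>: "0 < \<mu>" and ex: "\<And>x\<^sub>0 h B. continuous_on UNIV h \<Longrightarrow> (\<And>\<theta>. \<bar>h \<theta>\<bar> \<le> B) \<Longrightarrow>
    \<exists>v. continuous_on UNIV (\<lambda>(x, \<theta>). v x \<theta>) \<and>
      (\<forall>x. \<forall>\<theta>\<in>sphere 0 1. \<bar>v x \<theta>\<bar>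
         \<le> exp (\<mu> * (norm (x - x\<^sub>0))\<^sup>2) * (2 * \<bar>h \<theta>\<bar> + (\<integral>\<theta>'. \<bar>h \<theta>'\<bar> \<partial>sphere_measure))) \<and>
      (\<forall>x. \<forall>\<theta>\<in>sphere 0 1. v x \<theta> = h \<theta> + integral {0..1} (\<lambda>s. ((x - x\<^sub>0) \<bullet> \<theta>) *
         transport_source \<sigma> k v (x - (s * ((x - x\<^sub>0) \<bullet> \<theta>)) *\<^sub>R \<theta>) \<theta>))"
  show thesis
  proof (rule that[OF \<mu>])
    fix x\<^sub>0 :: 'a and h :: "'a \<Rightarrow> real" and B :: real
    assume h: "continuous_on UNIV h" and B: "\<And>\<theta>. \<bar>h \<theta>\<bar> \<le> B"
    obtain v where vc: "continuous_on UNIV (\<lambda>(x, \<theta>). v x \<theta>)"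
      and vb: "\<forall>x. \<forall>\<theta>\<in>sphere 0 1. \<bar>v x \<theta>\<bar>
         \<le> exp (\<mu> * (norm (x - x\<^sub>0))\<^sup>2) * (2 * \<bar>h \<theta>\<bar> + (\<integral>\<theta>'. \<bar>h \<theta>'\<bar> \<partial>sphere_measure))"
      and eq: "\<And>x \<theta>. \<theta> \<in> sphere 0 1 \<Longrightarrow> v x \<theta> = h \<theta> + integral {0..1} (\<lambda>s. ((x - x\<^sub>0) \<bullet> \<theta>) *
         transport_source \<sigma> k v (x - (s * ((x - x\<^sub>0) \<bullet> \<theta>)) *\<^sub>R \<theta>) \<theta>)"
      using ex[OF h B] by blast
    have fc: "continuous_on UNIV (\<lambda>x. transport_source \<sigma> k v x \<theta>)"
      and sc: "continuous_on UNIV (\<lambda>x. scattering k v x \<theta>)" and v1: "continuous_on UNIV (\<lambda>x. v x \<theta>)" for \<theta>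
      by (rule continuous_on_compose_pair[OF continuous_on_transport_source(1)[OF \<sigma> k vc] continuous_on_id continuous_on_const]
          continuous_on_compose_pair[OF continuous_on_transport_source(2)[OF \<sigma> k vc] continuous_on_id continuous_on_const]
          continuous_on_compose_pair[OF vc continuous_on_id continuous_on_const])+
    have sol: "solves_transport X \<sigma> k v" if X: "open X" for X
      unfolding solves_transport_def
    proof (rule AE_I2, intro allI impI)
      fix \<theta> :: 'a and \<psi> assume "\<theta> \<in> space sphere_measure" and \<psi>: "test_function X \<psi>"
      then have \<theta>: "\<theta> \<in> sphere 0 1" by simp
      have C1: "Ck_on 1 UNIV \<psi>" and co: "compact (closure {x. \<psi> x \<noteq> 0})" and sub: "closure {x. \<psi> x \<noteq> 0} \<subseteq> X"
        using \<psi> by (auto simp: test_function_def)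
      note L = Ck_on_1_along_line[OF C1]
      define S where "S = closure {x. \<psi> x \<noteq> 0}"
      have S: "compact S" using co by (simp add: S_def)
      have z: "\<psi> x = 0" "frechet_derivative \<psi> (at x) \<theta> = 0" if "x \<notin> S" for x
        using frechet_derivative_zero_outside[of x \<psi>] that unfolding S_def by auto
      have zX: "\<psi> x = 0" "frechet_derivative \<psi> (at x) \<theta> = 0" if "x \<notin> X" for x
        using z[of x] that sub unfolding S_def by blast+
      let ?d = "\<lambda>x. frechet_derivative \<psi> (at x) \<theta>"
      have weak: "(\<integral>x. v x \<theta> * ?d x \<partial>lborel) = - (\<integral>x. transport_source \<sigma> k v x \<theta> * \<psi> x \<partial>lborel)"
        by (rule classical_transport_imp_weak[OF v1 fc _ C1 co]) 
           (rule ray_fixpoint_has_derivative[where f="transport_source \<sigma> k v" and v=v and \<theta>=\<theta>, OF \<theta> fc eq[OF \<theta>]])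
      have i1: "integrable lborel (\<lambda>x. v x \<theta> * (\<sigma> x * \<psi> x))"
        by (rule integrable_compact_support[OF continuous_on_mult[OF v1 continuous_on_mult[OF \<sigma> L(1)]] S]) (simp add: z)
      have i2: "integrable lborel (\<lambda>x. v x \<theta> * ?d x)"
        by (rule integrable_compact_support[OF continuous_on_mult[OF v1 L(2)] S]) (simp add: z)
      have i3: "integrable lborel (\<lambda>x. transport_source \<sigma> k v x \<theta> * \<psi> x)"
        by (rule integrable_compact_support[OF continuous_on_mult[OF fc L(1)] S]) (simp add: z)
      have Xs: "X \<inter> space lborel \<in> sets lborel" using X by simp
      have "(\<integral>x. v x \<theta> * (\<sigma> x * \<psi> x - ?d x) \<partial>domain_measure X) = (\<integral>x. v x \<theta> * (\<sigma> x * \<psi> x) - v x \<theta> * ?d x \<partial>lborel)"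
        unfolding integral_restrict_space[OF Xs]
        by (rule Bochner_Integration.integral_cong) (auto simp: indicator_def zX algebra_simps)
      also have "\<dots> = (\<integral>x. v x \<theta> * (\<sigma> x * \<psi> x) \<partial>lborel) + (\<integral>x. transport_source \<sigma> k v x \<theta> * \<psi> x \<partial>lborel)"
        by (subst Bochner_Integration.integral_diff[OF i1 i2]) (simp add: weak)
      also have "\<dots> = (\<integral>x. v x \<theta> * (\<sigma> x * \<psi> x) + transport_source \<sigma> k v x \<theta> * \<psi> x \<partial>lborel)"
        by (rule Bochner_Integration.integral_add[symmetric, OF i1 i3])
      also have "\<dots> = (\<integral>x. scattering k v x \<theta> * \<psi> x \<partial>domain_measure X)"
        unfolding integral_restrict_space[OF Xs]
        by (rule Bochner_Integration.integral_cong) (auto simp: indicator_def zX transport_source_def algebra_simps)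
      finally show "(\<integral>x. v x \<theta> * (\<sigma> x * \<psi> x - ?d x) \<partial>domain_measure X) = (\<integral>x. scattering k v x \<theta> * \<psi> x \<partial>domain_measure X)" .
    qed
    have "v x\<^sub>0 \<theta> = h \<theta>" if "\<theta> \<in> sphere 0 1" for \<theta> using eq[OF that, of x\<^sub>0] by simp
    then show "\<exists>v. continuous_on UNIV (\<lambda>(x, \<theta>). v x \<theta>) \<and> (\<forall>\<theta>\<in>sphere 0 1. v x\<^sub>0 \<theta> = h \<theta>) \<and>
      (\<forall>x. \<forall>\<theta>\<in>sphere 0 1. \<bar>v x \<theta>\<bar>
         \<le> exp (\<mu> * (norm (x - x\<^sub>0))\<^sup>2) * (2 * \<bar>h \<theta>\<bar> + (\<integral>\<theta>'. \<bar>h \<theta>'\<bar> \<partial>sphere_measure))) \<and>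
      (\<forall>X. open X \<longrightarrow> solves_transport X \<sigma> k v)"
      using vc vb sol by blast
  qed
qed

lemma inflow_trace_continuous:
  fixes v :: "'a::euclidean_space \<Rightarrow> 'a \<Rightarrow> real"
  assumes v: "continuous_on UNIV (\<lambda>(x, \<theta>). v x \<theta>)"
  shows "inflow_trace X v v"
  unfolding inflow_trace_def
proof (intro AE_I2 impI allI)
  fix \<theta> y :: 'a and \<epsilon> :: real assume \<epsilon>: "0 < \<epsilon>"
  have "continuous_on UNIV (\<lambda>t. v (y + t *\<^sub>R \<theta>) \<theta>)"
    by (intro continuous_on_compose_pair[OF v] continuous_intros)
  then have "isCont (\<lambda>t. v (y + t *\<^sub>R \<theta>) \<theta>) 0" by (simp add: continuous_on_eq_continuous_at)
  then obtain \<delta> where \<delta>: "0 < \<delta>" "\<And>t. \<bar>t\<bar> < \<delta> \<Longrightarrow> \<bar>v (y + t *\<^sub>R \<theta>) \<theta> - v y \<theta>\<bar> < \<epsilon>"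
    unfolding continuous_at_eps_delta using \<epsilon> by (auto simp: dist_real_def)
  then show "\<exists>\<delta>>0. AE t in lborel. 0 < t \<and> t < \<delta> \<longrightarrow> \<bar>v (y + t *\<^sub>R \<theta>) \<theta> - v y \<theta>\<bar> < \<epsilon>"
    by (intro exI[of _ \<delta>]) auto
qed

lemma inflow_trace_diff:
  assumes "inflow_trace X v g" "inflow_trace X w g"
  shows "inflow_trace X (\<lambda>x \<theta>. w x \<theta> - v x \<theta>) (\<lambda>_ _. 0)"
  using assms unfolding inflow_trace_def
proof eventually_elim
  case (elim \<theta>)
  from elim show ?case
  proof eventually_elim
    case (elim y)
    show ?case
    proof (intro impI allI)
      fix \<epsilon> :: real assume y: "(y, \<theta>) \<in> Gamma_minus X" and \<epsilon>: "0 < \<epsilon>"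
      then have "0 < \<epsilon> / 2" by simp
      then obtain \<delta>1 \<delta>2 where \<delta>: "0 < \<delta>1" "0 < \<delta>2"
        "AE t in lborel. 0 < t \<and> t < \<delta>1 \<longrightarrow> \<bar>v (y + t *\<^sub>R \<theta>) \<theta> - g y \<theta>\<bar> < \<epsilon> / 2"
        "AE t in lborel. 0 < t \<and> t < \<delta>2 \<longrightarrow> \<bar>w (y + t *\<^sub>R \<theta>) \<theta> - g y \<theta>\<bar> < \<epsilon> / 2"
        using elim y by meson
      from \<delta>(3,4) have "AE t in lborel. 0 < t \<and> t < min \<delta>1 \<delta>2 \<longrightarrow> \<bar>w (y + t *\<^sub>R \<theta>) \<theta> - v (y + t *\<^sub>R \<theta>) \<theta> - 0\<bar> < \<epsilon>"
      proof eventually_elim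
        case (elim t)
        show ?case
        proof
          assume "0 < t \<and> t < min \<delta>1 \<delta>2"
          then have "\<bar>v (y + t *\<^sub>R \<theta>) \<theta> - g y \<theta>\<bar> < \<epsilon> / 2" "\<bar>w (y + t *\<^sub>R \<theta>) \<theta> - g y \<theta>\<bar> < \<epsilon> / 2" using elim by auto
          then show "\<bar>w (y + t *\<^sub>R \<theta>) \<theta> - v (y + t *\<^sub>R \<theta>) \<theta> - 0\<bar> < \<epsilon>" by linarith
        qed
      qed
      then show "\<exists>\<delta>>0. AE t in lborel. 0 < t \<and> t < \<delta> \<longrightarrow> \<bar>w (y + t *\<^sub>R \<theta>) \<theta> - v (y + t *\<^sub>R \<theta>) \<theta> - 0\<bar> < \<epsilon>"
        using \<delta>(1,2) by (intro exI[of _ "min \<delta>1 \<delta>2"]) auto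
    qed
  qed
qed

text \<open>Linearity is not automatic, because the integral of a nonintegrable function is 0 by
  convention. The majorants \<open>V\<close> and \<open>W\<close> supply integrability of all terms:
  in the direction for the scattering integrals, at almost every x, and in x for both sides of the
  weak equation.\<close>

lemma solves_transport_diff:
  fixes X :: "'a::euclidean_space set"
  assumes X: "open X" "bounded X" and \<sigma>: "continuous_on UNIV \<sigma>" "\<And>x. \<bar>\<sigma> x\<bar> \<le> M"
    and k: "continuous_on UNIV (\<lambda>(x, \<theta>, \<theta>'). k x \<theta> \<theta>')" "\<And>x \<theta> \<theta>'. \<bar>k x \<theta> \<theta>'\<bar> \<le> M"
    and m: "(\<lambda>(x, \<theta>). v x \<theta>) \<in> borel_measurable (domain_measure X \<Otimes>\<^sub>M sphere_measure)"
      "(\<lambda>(x, \<theta>). w x \<theta>) \<in> borel_measurable (domain_measure X \<Otimes>\<^sub>M sphere_measure)"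
    and V: "integrable sphere_measure V" "AE \<theta> in sphere_measure. AE x in domain_measure X. \<bar>v x \<theta>\<bar> \<le> V \<theta>"
    and W: "integrable sphere_measure W" "AE \<theta> in sphere_measure. AE x in domain_measure X. \<bar>w x \<theta>\<bar> \<le> W \<theta>"
    and sol: "solves_transport X \<sigma> k v" "solves_transport X \<sigma> k w"
  shows "solves_transport X \<sigma> k (\<lambda>x \<theta>. w x \<theta> - v x \<theta>)"
proof -
  interpret D: finite_measure "domain_measure X" by (rule finite_measure_domain[OF X])
  note swap = AE_domain_sphere_swap(1)[OF X]
  have V': "AE x in domain_measure X. AE \<theta> in sphere_measure. \<bar>v x \<theta>\<bar> \<le> V \<theta>"
    using V(2) unfolding swap[OF m(1) borel_measurable_integrable[OF V(1)]] .
  have W': "AE x in domain_measure X. AE \<theta> in sphere_measure. \<bar>w x \<theta>\<bar> \<le> W \<theta>"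
    using W(2) unfolding swap[OF m(2) borel_measurable_integrable[OF W(1)]] .
  have sc: "scattering k (\<lambda>x \<theta>. w x \<theta> - v x \<theta>) x \<theta> = scattering k w x \<theta> - scattering k v x \<theta>"
    if "integrable sphere_measure (\<lambda>\<theta>'. k x \<theta> \<theta>' * w x \<theta>')" "integrable sphere_measure (\<lambda>\<theta>'. k x \<theta> \<theta>' * v x \<theta>')" for x \<theta>
    unfolding scattering_def right_diff_distrib by (rule Bochner_Integration.integral_diff[OF that])
  show ?thesis
    using sol V(2) W(2) AE_space unfolding solves_transport_def
  proof eventually_elim
    case (elim \<theta>)
    then have \<theta>: "\<theta> \<in> sphere 0 1" by simp
    show ?case
    proof (intro allI impI)
      fix \<psi> assume \<psi>: "test_function X \<psi>"
      then have C1: "Ck_on 1 UNIV \<psi>" and co: "compact (closure {x. \<psi> x \<noteq> 0})" by (auto simp: test_function_def)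
      note L = Ck_on_1_along_line[OF C1]
      let ?d = "\<lambda>x. frechet_derivative \<psi> (at x) \<theta>"
      obtain P P' where P: "\<And>x. \<bar>\<psi> x\<bar> \<le> P" and P': "\<And>x. \<bar>?d x\<bar> \<le> P'"
        using Ck_on_1_compact_support_bounds[OF C1 co] by blast
      have M0: "0 \<le> M" using \<sigma>(2)[of undefined] by linarith
      have meas: "z \<in> borel_measurable (domain_measure X)" if "continuous_on UNIV z" for z :: "'a \<Rightarrow> real"
        using measurable_compose[OF id_measurable_domain borel_measurable_continuous_onI[OF that]] by simp
      have bd: "\<bar>\<sigma> x * \<psi> x - ?d x\<bar> \<le> M * P + P'" for x
      proof -
        have "\<bar>\<sigma> x * \<psi> x\<bar> \<le> M * P" unfolding abs_mult by (intro mult_mono \<sigma>(2) P M0) simp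
        then show ?thesis using P'[of x] by linarith
      qed
      have cm: "(\<lambda>x. \<sigma> x * \<psi> x - ?d x) \<in> borel_measurable (domain_measure X)"
        by (intro meas continuous_on_diff continuous_on_mult \<sigma>(1) L(1,2))
      have pm: "\<psi> \<in> borel_measurable (domain_measure X)" by (rule meas[OF L(1)])
      have iv: "integrable (domain_measure X) (\<lambda>x. v x \<theta> * (\<sigma> x * \<psi> x - ?d x))"
        by (rule integrable_mult_bounded[OF D.integrable_const_bound cm bd])
           (use elim(3) section_measurable(2)[OF m(1) \<theta>] in auto)
      have iw: "integrable (domain_measure X) (\<lambda>x. w x \<theta> * (\<sigma> x * \<psi> x - ?d x))"
        by (rule integrable_mult_bounded[OF D.integrable_const_bound cm bd])
           (use elim(4) section_measurable(2)[OF m(2) \<theta>] in auto)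
      have sv: "AE x in domain_measure X. norm (scattering k v x \<theta>) \<le> M * (\<integral>\<theta>'. V \<theta>' \<partial>sphere_measure)"
        using V' AE_space
      proof eventually_elim
        case (elim x)
        then show ?case
          using scattering_integrable_bound(2)[where u=v, OF k section_measurable(1)[OF m(1) elim(2)] V(1) elim(1)] by simp
      qed
      have sw: "AE x in domain_measure X. norm (scattering k w x \<theta>) \<le> M * (\<integral>\<theta>'. W \<theta>' \<partial>sphere_measure)"
        using W' AE_space
      proof eventually_elim
        case (elim x)
        then show ?case
          using scattering_integrable_bound(2)[where u=w, OF k section_measurable(1)[OF m(2) elim(2)] W(1) elim(1)] by simp
      qed
      have jv: "integrable (domain_measure X) (\<lambda>x. scattering k v x \<theta> * \<psi> x)"
        by (rule integrable_mult_bounded[OF D.integrable_const_bound[OF sv scattering_measurable[OF k(1) m(1)]] pm P])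
      have jw: "integrable (domain_measure X) (\<lambda>x. scattering k w x \<theta> * \<psi> x)"
        by (rule integrable_mult_bounded[OF D.integrable_const_bound[OF sw scattering_measurable[OF k(1) m(2)]] pm P])
      have dm: "(\<lambda>(x, \<theta>). w x \<theta> - v x \<theta>) \<in> borel_measurable (domain_measure X \<Otimes>\<^sub>M sphere_measure)"
        using borel_measurable_diff[OF m(2) m(1)] by (simp add: case_prod_beta')
      have "(\<integral>x. (w x \<theta> - v x \<theta>) * (\<sigma> x * \<psi> x - ?d x) \<partial>domain_measure X)
          = (\<integral>x. w x \<theta> * (\<sigma> x * \<psi> x - ?d x) \<partial>domain_measure X) - (\<integral>x. v x \<theta> * (\<sigma> x * \<psi> x - ?d x) \<partial>domain_measure X)"
        unfolding left_diff_distrib by (rule Bochner_Integration.integral_diff[OF iw iv])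
      also have "\<dots> = (\<integral>x. scattering k w x \<theta> * \<psi> x \<partial>domain_measure X) - (\<integral>x. scattering k v x \<theta> * \<psi> x \<partial>domain_measure X)"
        using elim(1,2) \<psi> by simp
      also have "\<dots> = (\<integral>x. scattering k w x \<theta> * \<psi> x - scattering k v x \<theta> * \<psi> x \<partial>domain_measure X)"
        by (rule Bochner_Integration.integral_diff[symmetric, OF jw jv])
      also have "\<dots> = (\<integral>x. scattering k (\<lambda>x \<theta>. w x \<theta> - v x \<theta>) x \<theta> * \<psi> x \<partial>domain_measure X)"
      proof (rule integral_cong_AE)
        show "(\<lambda>x. scattering k w x \<theta> * \<psi> x - scattering k v x \<theta> * \<psi> x) \<in> borel_measurable (domain_measure X)"
          using jw jv by (intro borel_measurable_diff borel_measurable_integrable)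
        show "(\<lambda>x. scattering k (\<lambda>x \<theta>. w x \<theta> - v x \<theta>) x \<theta> * \<psi> x) \<in> borel_measurable (domain_measure X)"
          by (intro borel_measurable_times scattering_measurable[OF k(1) dm] pm)
        show "AE x in domain_measure X. scattering k w x \<theta> * \<psi> x - scattering k v x \<theta> * \<psi> x
            = scattering k (\<lambda>x \<theta>. w x \<theta> - v x \<theta>) x \<theta> * \<psi> x"
          using V' W' AE_space
        proof eventually_elim
          case (elim x)
          note iv = scattering_integrable_bound(1)[where u=v, OF k section_measurable(1)[OF m(1) elim(3)] V(1) elim(1)]
          note iw = scattering_integrable_bound(1)[where u=w, OF k section_measurable(1)[OF m(2) elim(3)] W(1) elim(2)]
          show ?case unfolding sc[OF iw iv] by (simp add: left_diff_distrib)
        qed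
      qed
      finally show "(\<integral>x. (w x \<theta> - v x \<theta>) * (\<sigma> x * \<psi> x - ?d x) \<partial>domain_measure X)
          = (\<integral>x. scattering k (\<lambda>x \<theta>. w x \<theta> - v x \<theta>) x \<theta> * \<psi> x \<partial>domain_measure X)" .
    qed
  qed
qed

section \<open>Extension of the coefficients and choice of the constant\<close>

lemma compact_continuous_extension:
  fixes f :: "'c::euclidean_space \<Rightarrow> real"
  assumes K: "compact K" and f: "continuous_on K f"
  obtains F B where "continuous_on UNIV F" "\<And>x. x \<in> K \<Longrightarrow> F x = f x" "\<And>x. \<bar>F x\<bar> \<le> B"
proof -
  have "bounded (f ` K)" by (intro compact_imp_bounded compact_continuous_image f K)
  then obtain B where B: "0 < B" "\<And>x. x \<in> K \<Longrightarrow> norm (f x) \<le> B" unfolding bounded_pos by auto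
  obtain F where "continuous_on UNIV F" "\<And>x. x \<in> K \<Longrightarrow> F x = f x" "\<And>x. x \<in> UNIV \<Longrightarrow> norm (F x) \<le> B"
    by (rule Tietze[OF f _ less_imp_le[OF B(1)] B(2), of UNIV]) (use compact_imp_closed[OF K] in auto)
  then show thesis using that[of F B] by auto
qed

theorem theorem1p3:
  fixes X :: "'a::euclidean_space set"
    and \<sigma> :: "'a \<Rightarrow> real"
    and k :: "'a \<Rightarrow> 'a \<Rightarrow> 'a \<Rightarrow> real"
  assumes dim: "DIM('a) \<ge> 2"
    and X: "smooth_bounded_domain X"
    and sigma_cont: "continuous_on (closure X) \<sigma>"
    and sigma_nonneg: "\<forall>x\<in>X. 0 \<le> \<sigma> x"
    and k_cont: "continuous_on (closure X \<times> sphere 0 1 \<times> sphere 0 1) (\<lambda>(x, \<theta>, \<theta>'). k x \<theta> \<theta>')"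
    and k_nonneg: "\<forall>x\<in>X. \<forall>\<theta>\<in>sphere 0 1. \<forall>\<theta>'\<in>sphere 0 1. 0 \<le> k x \<theta> \<theta>'"
    and reciprocity:
      "\<forall>x\<in>X. \<forall>\<theta>\<in>sphere 0 1. \<forall>\<theta>'\<in>sphere 0 1. k x \<theta> \<theta>' = k x (- \<theta>') (- \<theta>)"
    and normalization:
      "\<forall>x\<in>X. \<forall>\<theta>\<in>sphere 0 1. (\<integral>\<theta>'. k x \<theta> \<theta>' \<partial>sphere_measure) = 1"
    and rotation_invariance:
      "\<exists>\<kappa>::'a \<Rightarrow> real \<Rightarrow> real. \<forall>x\<in>X. \<forall>\<theta>\<in>sphere 0 1. \<forall>\<theta>'\<in>sphere 0 1. k x \<theta> \<theta>' = \<kappa> x (\<theta> \<bullet> \<theta>')"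
    and subcritical:
      "(\<exists>\<alpha>>0. \<forall>x\<in>X. \<sigma> x - scattering_bound X k \<ge> \<alpha>) \<or> diameter X * scattering_bound X k < 1"
  shows "\<exists>C::real. \<forall>(p::ennreal) x\<^sub>0 (h::'a \<Rightarrow> real).
    1 \<le> p \<longrightarrow> x\<^sub>0 \<in> X \<longrightarrow> continuous_on (sphere 0 1) h \<longrightarrow>
    (\<exists>g \<in> mixed_space p (surface_measure X). \<exists>v \<in> mixed_space p (domain_measure X).
       solves_bvp X \<sigma> k g v \<and>
       (\<forall>w \<in> mixed_space p (domain_measure X). solves_bvp X \<sigma> k g w \<longrightarrow>
          (AE (x, \<theta>) in domain_measure X \<Otimes>\<^sub>M sphere_measure. w x \<theta> = v x \<theta>)) \<and>
       (\<exists>U. open U \<and> x\<^sub>0 \<in> U \<and> U \<subseteq> X \<and>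
          continuous_on (U \<times> sphere 0 1) (\<lambda>(x, \<theta>). v x \<theta>)) \<and>
       (\<forall>\<theta>\<in>sphere 0 1. v x\<^sub>0 \<theta> = h \<theta>) \<and>
       mixed_norm p (domain_measure X) v + mixed_norm p (surface_measure X) g
         \<le> ennreal C * Lp_norm p sphere_measure (\<lambda>\<theta>. ennreal \<bar>h \<theta>\<bar>))"
proof -
  have op: "open X" and bd: "bounded X" and ne: "X \<noteq> {}" using X by (auto simp: smooth_bounded_domain_def)
  have clc: "compact (closure X)" using bd by simp
  obtain \<sigma>' M1 where \<sigma>': "continuous_on UNIV \<sigma>'" "\<And>x. x \<in> closure X \<Longrightarrow> \<sigma>' x = \<sigma> x" "\<And>x. \<bar>\<sigma>' x\<bar> \<le> M1"
    using compact_continuous_extension[OF clc sigma_cont] by blast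
  have "compact (closure X \<times> sphere (0::'a) 1 \<times> sphere (0::'a) 1)" by (intro compact_Times clc) auto
  from compact_continuous_extension[OF this k_cont] obtain K M2 where
    K: "continuous_on UNIV K" "\<And>z. z \<in> closure X \<times> sphere 0 1 \<times> sphere 0 1 \<Longrightarrow> K z = (\<lambda>(x, \<theta>, \<theta>'). k x \<theta> \<theta>') z" "\<And>z. \<bar>K z\<bar> \<le> M2"
    by blast
  define k' where "k' x \<theta> \<theta>' = K (x, \<theta>, \<theta>')" for x \<theta> \<theta>'
  define M where "M = max M1 M2"
  have k'c: "continuous_on UNIV (\<lambda>(x, \<theta>, \<theta>'). k' x \<theta> \<theta>')"
    using K(1) by (simp add: k'_def case_prod_beta')
  have k'k: "k' x \<theta> \<theta>' = k x \<theta> \<theta>'" if "x \<in> X" "\<theta> \<in> sphere 0 1" "\<theta>' \<in> sphere 0 1" for x \<theta> \<theta>'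
    using K(2)[of "(x, \<theta>, \<theta>')"] that closure_subset by (auto simp: k'_def)
  have \<sigma>\<sigma>: "\<sigma>' x = \<sigma> x" if "x \<in> X" for x using \<sigma>'(2) that closure_subset by blast
  have M: "\<And>x. \<bar>\<sigma>' x\<bar> \<le> M" "\<And>x \<theta> \<theta>'. \<bar>k' x \<theta> \<theta>'\<bar> \<le> M"
    using \<sigma>'(3) K(3) by (auto simp: M_def k'_def le_max_iff_disj)
  have k1: "(\<integral>\<theta>'. k' x \<theta> \<theta>' \<partial>sphere_measure) = 1" if "x \<in> X" "\<theta> \<in> sphere 0 1" for x \<theta>
  proof -
    have "(\<integral>\<theta>'. k' x \<theta> \<theta>' \<partial>sphere_measure) = (\<integral>\<theta>'. k x \<theta> \<theta>' \<partial>sphere_measure)"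
      by (rule Bochner_Integration.integral_cong) (use k'k that in auto)
    then show ?thesis using normalization that by simp
  qed
  have \<rho>: "scattering_bound X k = 1" by (rule scattering_bound_eq_1[OF op bd ne]) (use normalization in blast)
  have "\<exists>\<beta> \<gamma>. 0 \<le> \<beta> \<and> 0 \<le> \<gamma> \<and> \<beta> + \<gamma> * diameter X < 1 \<and> (\<forall>x\<in>X. \<forall>m>\<beta>. 1 - \<sigma>' x * m \<le> \<gamma>)"
    using subcritical
  proof
    assume "\<exists>\<alpha>>0. \<forall>x\<in>X. \<sigma> x - scattering_bound X k \<ge> \<alpha>"
    then obtain \<alpha> where \<alpha>: "0 < \<alpha>" "\<And>x. x \<in> X \<Longrightarrow> 1 + \<alpha> \<le> \<sigma> x" by (force simp: \<rho>)
    \<comment> \<open>At a level m above 1 / (1 + \<alpha>) the absorption, at least (1 + \<alpha>)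
      m, already exceeds a scattering source of size 1, so the solution cannot stay above that
      level; no length of the line enters.\<close>
    have "1 - \<sigma>' x * m \<le> 0" if x: "x \<in> X" and m: "1 / (1 + \<alpha>) < m" for x m
    proof -
      have "1 < (1 + \<alpha>) * m" using m \<alpha>(1) by (simp add: field_simps)
      moreover have "0 < m" using m \<alpha>(1) by (smt (verit) divide_pos_pos)
      then have "(1 + \<alpha>) * m \<le> \<sigma>' x * m" using \<alpha>(2)[OF x] \<sigma>\<sigma>[OF x] by (intro mult_right_mono) auto
      ultimately show ?thesis by linarith
    qed
    then show ?thesis using \<alpha>(1) by (intro exI[of _ "1 / (1 + \<alpha>)"] exI[of _ 0]) auto
  next
    assume "diameter X * scattering_bound X k < 1"
    then show ?thesis
      using sigma_nonneg \<sigma>\<sigma> by (intro exI[of _ 0] exI[of _ 1]) (auto simp: \<rho>)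
  qed
  then obtain \<beta> \<gamma> where bg: "0 \<le> \<beta>" "0 \<le> \<gamma>" "\<beta> + \<gamma> * diameter X < 1" "\<And>x m. x \<in> X \<Longrightarrow> \<beta> < m \<Longrightarrow> 1 - \<sigma>' x * m \<le> \<gamma>"
    by blast
  obtain \<mu> where \<mu>: "0 < \<mu>" and ex: "\<And>x\<^sub>0 h B. continuous_on UNIV h \<Longrightarrow> (\<And>\<theta>. \<bar>h \<theta>\<bar> \<le> B) \<Longrightarrow>
    \<exists>v. continuous_on UNIV (\<lambda>(x, \<theta>). v x \<theta>) \<and> (\<forall>\<theta>\<in>sphere 0 1. v x\<^sub>0 \<theta> = h \<theta>) \<and>
      (\<forall>x. \<forall>\<theta>\<in>sphere 0 1. \<bar>v x \<theta>\<bar>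
         \<le> exp (\<mu> * (norm (x - x\<^sub>0))\<^sup>2) * (2 * \<bar>h \<theta>\<bar> + (\<integral>\<theta>'. \<bar>h \<theta>'\<bar> \<partial>sphere_measure))) \<and>
      (\<forall>X. open X \<longrightarrow> solves_transport X \<sigma>' k' v)"
    by (rule transport_solution_exists[OF \<sigma>'(1) k'c M]) blast
  \<comment> \<open>A bound of the weight on the closure of X, uniform in \<open>x\<^sub>0\<close>
    because both points lie within the diameter. The constant \<open>c\<close> is then that of
    \<open>Lp_norm_add_mean_le\<close> for the majorant 2 A |h| + A I.\<close>
  define A where "A = exp (\<mu> * (diameter X)\<^sup>2)"
  have A: "0 \<le> A" by (simp add: A_def)
  define c where "c = 4 * (A * 2 + A * (measure sphere_measure (sphere (0::'a) 1) + 1)\<^sup>2)"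
  have c0: "0 \<le> c" using A by (simp add: c_def)
  have solves_iff: "solves_transport X \<sigma> k u \<longleftrightarrow> solves_transport X \<sigma>' k' u" for u
    by (rule solves_transport_cong) (use \<sigma>\<sigma> k'k in auto)
  show ?thesis
  \<comment> \<open>\<open>c\<close> is counted twice: once for v on X, once for its boundary values
    g.\<close>
  proof (intro exI[of _ "c + c"] allI impI)
    fix p :: ennreal and x\<^sub>0 and h :: "'a \<Rightarrow> real"
    assume p: "1 \<le> p" and x0: "x\<^sub>0 \<in> X" and h: "continuous_on (sphere 0 1) h"
    obtain H B where H: "continuous_on UNIV H" "\<And>\<theta>. \<theta> \<in> sphere 0 1 \<Longrightarrow> H \<theta> = h \<theta>" "\<And>\<theta>. \<bar>H \<theta>\<bar> \<le> B"
      using compact_continuous_extension[OF compact_sphere h] by blast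
    have B0: "0 \<le> B" using H(3)[of undefined] by linarith
    define I where "I = (\<integral>\<theta>'. \<bar>H \<theta>'\<bar> \<partial>sphere_measure)"
    obtain v where vc: "continuous_on UNIV (\<lambda>(x, \<theta>). v x \<theta>)" and v0: "\<And>\<theta>. \<theta> \<in> sphere 0 1 \<Longrightarrow> v x\<^sub>0 \<theta> = H \<theta>"
      and vb: "\<And>x \<theta>. \<theta> \<in> sphere 0 1 \<Longrightarrow> \<bar>v x \<theta>\<bar> \<le> exp (\<mu> * (norm (x - x\<^sub>0))\<^sup>2) * (2 * \<bar>H \<theta>\<bar> + I)"
      and vsol: "solves_transport X \<sigma>' k' v"
      using ex[OF H(1) H(3), of x\<^sub>0] op unfolding I_def by blast
    define G where "G \<theta> = (A * 2) * \<bar>H \<theta>\<bar> + A * I" for \<theta>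
    have I0: "0 \<le> I" by (simp add: I_def)
    \<comment> \<open>Stated on the closure of X, so that one majorant bounds both v and its
      restriction to the boundary.\<close>
    have vG: "\<bar>v x \<theta>\<bar> \<le> G \<theta>" if x: "x \<in> closure X" and \<theta>: "\<theta> \<in> sphere 0 1" for x \<theta>
    proof -
      have "x\<^sub>0 \<in> closure X" using x0 closure_subset by blast
      then have "norm (x - x\<^sub>0) \<le> diameter X"
        using diameter_bounded_bound[of "closure X" x x\<^sub>0] x bounded_closure[OF bd] bd
        by (simp add: diameter_closure dist_norm)
      then have "(norm (x - x\<^sub>0))\<^sup>2 \<le> (diameter X)\<^sup>2" by (intro power_mono) auto
      then have "exp (\<mu> * (norm (x - x\<^sub>0))\<^sup>2) \<le> A" using \<mu> by (simp add: A_def)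
      then have "exp (\<mu> * (norm (x - x\<^sub>0))\<^sup>2) * (2 * \<bar>H \<theta>\<bar> + I) \<le> A * (2 * \<bar>H \<theta>\<bar> + I)"
        using I0 by (intro mult_right_mono) auto
      then show ?thesis using vb[OF \<theta>, of x] by (simp add: G_def algebra_simps)
    qed
    let ?h = "Lp_norm p sphere_measure (\<lambda>\<theta>. ennreal \<bar>h \<theta>\<bar>)"
    have Hm: "H \<in> borel_measurable sphere_measure"
      by (intro borel_measurable_sphereI borel_measurable_continuous_onI H(1))
    have "Lp_norm p sphere_measure (\<lambda>\<theta>. ennreal (G \<theta>)) \<le> ennreal c * Lp_norm p sphere_measure (\<lambda>\<theta>. ennreal \<bar>H \<theta>\<bar>)"
      unfolding G_def I_def c_def
      using Lp_norm_add_mean_le[OF finite_measure_sphere Hm H(3) p, of "A * 2" A] A by simp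
    also have "Lp_norm p sphere_measure (\<lambda>\<theta>. ennreal \<bar>H \<theta>\<bar>) \<le> ?h"
      by (rule Lp_norm_mono) (use H(2) in \<open>auto intro!: AE_I2\<close>)
    finally have LG: "Lp_norm p sphere_measure (\<lambda>\<theta>. ennreal (G \<theta>)) \<le> ennreal c * ?h"
      by (simp add: mult_left_mono)
    have hfin: "?h < \<infinity>"
      by (rule Lp_norm_bounded_finite[OF finite_measure_sphere _ B0]) (use H(2,3) in \<open>metis ennreal_leI space_sphere_measure\<close>)
    have nD: "mixed_norm p (domain_measure X) v \<le> ennreal c * ?h"
      by (rule order_trans[OF mixed_norm_le_Lp_norm LG])
         (use vG closure_subset in \<open>auto simp: space_restrict_space\<close>)
    have nS: "mixed_norm p (surface_measure X) v \<le> ennreal c * ?h"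
      by (rule order_trans[OF mixed_norm_le_Lp_norm LG])
         (use vG in \<open>auto simp: surface_measure_def space_restrict_space frontier_def\<close>)
    have cfin: "ennreal c * ?h < \<infinity>" using hfin by (simp add: ennreal_mult_less_top)
    have vm: "(\<lambda>(x, \<theta>). v x \<theta>) \<in> borel_measurable (domain_measure X \<Otimes>\<^sub>M sphere_measure)"
      by (rule continuous_pair_measurable[OF id_measurable_domain vc])
    have vD: "v \<in> mixed_space p (domain_measure X)"
      using vm le_less_trans[OF nD cfin] by (simp add: mixed_space_def)
    have vS: "v \<in> mixed_space p (surface_measure X)"
      using continuous_pair_measurable[OF id_measurable_surface vc] le_less_trans[OF nS cfin] by (simp add: mixed_space_def)
    have tr: "inflow_trace X v v" by (rule inflow_trace_continuous[OF vc])
    have bvp: "solves_bvp X \<sigma> k v v" using vsol tr by (simp add: solves_bvp_def solves_iff)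
    have unique: "AE (x, \<theta>) in domain_measure X \<Otimes>\<^sub>M sphere_measure. w x \<theta> = v x \<theta>"
      if w: "w \<in> mixed_space p (domain_measure X)" and wb: "solves_bvp X \<sigma> k v w" for w
    proof -
      have wm: "(\<lambda>(x, \<theta>). w x \<theta>) \<in> borel_measurable (domain_measure X \<Otimes>\<^sub>M sphere_measure)"
        using w by (simp add: mixed_space_def)
      obtain V where V: "integrable sphere_measure V" "AE \<theta> in sphere_measure. AE x in domain_measure X. \<bar>v x \<theta>\<bar> \<le> V \<theta>"
        by (rule mixed_space_dominated[OF op bd p vD])
      obtain W where W: "integrable sphere_measure W" "AE \<theta> in sphere_measure. AE x in domain_measure X. \<bar>w x \<theta>\<bar> \<le> W \<theta>"
        by (rule mixed_space_dominated[OF op bd p w])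
      let ?u = "\<lambda>x \<theta>. w x \<theta> - v x \<theta>"
      have wsol: "solves_transport X \<sigma>' k' w" and wtr: "inflow_trace X w v"
        using wb by (auto simp: solves_bvp_def solves_iff)
      have "AE z in domain_measure X \<Otimes>\<^sub>M sphere_measure. ?u (fst z) (snd z) = 0"
      proof (rule transport_homogeneous_zero[OF X \<sigma>'(1) M(1) k'c M(2) _ _ k1 bg])
        show "0 \<le> \<sigma>' x" if "x \<in> X" for x using sigma_nonneg \<sigma>\<sigma> that by simp
        show "0 \<le> k' x \<theta> \<theta>'" if "x \<in> X" "\<theta> \<in> sphere 0 1" "\<theta>' \<in> sphere 0 1" for x \<theta> \<theta>'
          using k_nonneg k'k that by simp
        show "(\<lambda>(x, \<theta>). ?u x \<theta>) \<in> borel_measurable (domain_measure X \<Otimes>\<^sub>M sphere_measure)"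
          using borel_measurable_diff[OF wm vm] by (simp add: case_prod_beta')
        show "integrable sphere_measure (\<lambda>\<theta>. W \<theta> + V \<theta>)"
          by (rule Bochner_Integration.integrable_add[OF W(1) V(1)])
        show "AE \<theta> in sphere_measure. AE x in domain_measure X. \<bar>?u x \<theta>\<bar> \<le> W \<theta> + V \<theta>"
          using W(2) V(2)
        proof eventually_elim
          case (elim \<theta>)
          then show ?case by eventually_elim linarith
        qed
        show "solves_transport X \<sigma>' k' ?u"
          by (rule solves_transport_diff[OF op bd \<sigma>'(1) M(1) k'c M(2) vm wm V W vsol wsol])
        show "inflow_trace X ?u (\<lambda>_ _. 0)" by (rule inflow_trace_diff[OF tr wtr])
      qed
      then show ?thesis by eventually_elim (simp add: case_prod_beta')
    qed
    have "ennreal (c + c) * ?h = ennreal c * ?h + ennreal c * ?h"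
      by (simp only: ennreal_plus[OF c0 c0] distrib_right)
    then have norms: "mixed_norm p (domain_measure X) v + mixed_norm p (surface_measure X) v \<le> ennreal (c + c) * ?h"
      using add_mono[OF nD nS] by simp
    show "\<exists>g \<in> mixed_space p (surface_measure X). \<exists>v \<in> mixed_space p (domain_measure X).
       solves_bvp X \<sigma> k g v \<and>
       (\<forall>w \<in> mixed_space p (domain_measure X). solves_bvp X \<sigma> k g w \<longrightarrow>
          (AE (x, \<theta>) in domain_measure X \<Otimes>\<^sub>M sphere_measure. w x \<theta> = v x \<theta>)) \<and>
       (\<exists>U. open U \<and> x\<^sub>0 \<in> U \<and> U \<subseteq> X \<and>
          continuous_on (U \<times> sphere 0 1) (\<lambda>(x, \<theta>). v x \<theta>)) \<and>
       (\<forall>\<theta>\<in>sphere 0 1. v x\<^sub>0 \<theta> = h \<theta>) \<and>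
       mixed_norm p (domain_measure X) v + mixed_norm p (surface_measure X) g
         \<le> ennreal (c + c) * Lp_norm p sphere_measure (\<lambda>\<theta>. ennreal \<bar>h \<theta>\<bar>)"
    proof (rule bexI[OF _ vS], rule bexI[OF _ vD], intro conjI ballI impI)
      show "\<exists>U. open U \<and> x\<^sub>0 \<in> U \<and> U \<subseteq> X \<and> continuous_on (U \<times> sphere 0 1) (\<lambda>(x, \<theta>). v x \<theta>)"
        using op x0 continuous_on_subset[OF vc subset_UNIV] by blast
    qed (use bvp unique v0 H(2) norms in auto)
  qed
qed

end
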